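(* Let $\mathbf{C}$ be a locally finitely presentable category, and let $(\Sigma,\Gamma,d)$ be a simple structural law on $\mathbf{C}$, with $$d_{X,Y}\colon \Gamma(\Sigma X,Y)\to S\bigl(\Gamma(X,SY)+X+Y\bigr),\qquad S=\Sigma^* .$$ Let $T$ be the free monad on the endofunctor $\Gamma_S\Delta\colon X\mapsto\Gamma(X,SX)$. Then $d$ induces a monad distributive law $\delta\colon TS\to ST$ such that, for every object $X$, the composite $$\Gamma(\Sigma X,X)\xrightarrow{\Gamma(\eta_{\Sigma,X},\,\eta^S_X)}\Gamma(SX,SX)\xrightarrow{\Gamma(SX,\eta^S_{SX})}\Gamma(SX,SSX)\xrightarrow{\eta_{\Gamma_S,SX}}TSX\xrightarrow{\delta_X}STX$$ equals the composite $$\Gamma(\Sigma X,X)\xrightarrow{d_{X,X}}S(\Gamma(X,SX)+X+X)\xrightarrow{S[\eta_{\Gamma_S,X},\,\eta^T_X,\,\eta^T_X]}STX .$$ Furthermore, $T$ is constant-free, and the monad morphism $S\eta^T\colon S\to ST$ is admissible.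
   Context: A simple structural law on a locally finitely presentable category $\mathbf{C}$ consists of: a finitary endofunctor $\Sigma\colon\mathbf{C}\to\mathbf{C}$; a functor $\Gamma\colon\mathbf{C}^2\to\mathbf{C}$ which is cocontinuous in its first argument and finitary in its second argument; and a natural transformation (natural in $X$ and $Y$) $d_{X,Y}\colon\Gamma(\Sigma X,Y)\to S(\Gamma(X,SY)+X+Y)$, where $S=\Sigma^*$ is the free monad on $\Sigma$. For a finitary endofunctor $F$, $\eta_F\colon F\to F^*$ denotes the canonical natural transformation into the free monad; $\eta_\Sigma\colon\Sigma\to S$ and $\eta_{\Gamma_S,X}\colon\Gamma(X,SX)\to TX$ are the instances used. $\eta^M,\mu^M$ denote unit and multiplication of a monad $M$. A monad distributive law $\delta\colon TS\to ST$ is a natural transformation commuting with units and multiplications of both monads (Beck); it makes $ST$ a monad and $S\eta^T\colon S\to ST$ a monad morphism. A monad $T$ is constant-free iff $\eta^T_\emptyset\colon\emptyset\to T\emptyset$ is an isomorphism ($\emptyset$ initial). A monad morphism $\alpha\colon R\to R'$ is admissible iff $\alpha_\emptyset$ is an isomorphism. *)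

theory Defs
  imports
    "HOL-Library.FuncSet"
    "HOL-Library.Countable_Set"
    "HOL-Library.Equipollence"
begin

section \<open>Categories, functors, natural transformations\<close>

text \<open>
  Only the values on \<open>Obj\<close> and \<open>Arr\<close> matter; composition is in applicative
  order and is constrained only on composable pairs.
\<close>

record ('o, 'a) category =
  Obj :: "'o set"
  Arr :: "'a set"
  Dom :: "'a \<Rightarrow> 'o"
  Cod :: "'a \<Rightarrow> 'o"
  Id :: "'o \<Rightarrow> 'a"
  Comp :: "'a \<Rightarrow> 'a \<Rightarrow> 'a" (infixr "\<odot>\<index>" 70)

definition hom :: "('o, 'a) category \<Rightarrow> 'o \<Rightarrow> 'o \<Rightarrow> 'a set" where
  "hom C x y = {f \<in> Arr C. Dom C f = x \<and> Cod C f = y}"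

locale category =
  fixes C :: "('o, 'a) category" (structure)
  assumes Dom_in_Obj: "f \<in> Arr C \<Longrightarrow> Dom C f \<in> Obj C"
    and Cod_in_Obj: "f \<in> Arr C \<Longrightarrow> Cod C f \<in> Obj C"
    and Id_in_hom: "x \<in> Obj C \<Longrightarrow> Id C x \<in> hom C x x"
    and Comp_in_hom: "f \<in> hom C x y \<Longrightarrow> g \<in> hom C y z \<Longrightarrow> g \<odot> f \<in> hom C x z"
    and Comp_Id: "f \<in> hom C x y \<Longrightarrow> f \<odot> Id C x = f"
    and Id_Comp: "f \<in> hom C x y \<Longrightarrow> Id C y \<odot> f = f"
    and Comp_assoc: "f \<in> hom C w x \<Longrightarrow> g \<in> hom C x y \<Longrightarrow> h \<in> hom C y z \<Longrightarrow>
      (h \<odot> g) \<odot> f = h \<odot> (g \<odot> f)"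

definition iso :: "('o, 'a) category \<Rightarrow> 'a \<Rightarrow> bool" where
  "iso C f \<longleftrightarrow> f \<in> Arr C \<and>
    (\<exists>g \<in> hom C (Cod C f) (Dom C f). g \<odot>\<^bsub>C\<^esub> f = Id C (Dom C f) \<and> f \<odot>\<^bsub>C\<^esub> g = Id C (Cod C f))"

record ('o, 'a, 'p, 'b) cat_functor =
  fobj :: "'o \<Rightarrow> 'p"
  farr :: "'a \<Rightarrow> 'b"

type_synonym ('o, 'a) endofunctor = "('o, 'a, 'o, 'a) cat_functor"

locale cat_functor = dom: category C + cod: category D
  for C :: "('o, 'a) category" and D :: "('p, 'b) category" +
  fixes F :: "('o, 'a, 'p, 'b) cat_functor"
  assumes fobj_in_Obj: "x \<in> Obj C \<Longrightarrow> fobj F x \<in> Obj D"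
    and farr_in_hom: "f \<in> hom C x y \<Longrightarrow> farr F f \<in> hom D (fobj F x) (fobj F y)"
    and farr_Id: "x \<in> Obj C \<Longrightarrow> farr F (Id C x) = Id D (fobj F x)"
    and farr_Comp: "f \<in> hom C x y \<Longrightarrow> g \<in> hom C y z \<Longrightarrow>
      farr F (g \<odot>\<^bsub>C\<^esub> f) = farr F g \<odot>\<^bsub>D\<^esub> farr F f"

definition id_functor :: "('o, 'a) endofunctor" where
  "id_functor = \<lparr>fobj = (\<lambda>x. x), farr = (\<lambda>f. f)\<rparr>"

definition comp_functor ::
  "('p, 'b, 'q, 'c) cat_functor \<Rightarrow> ('o, 'a, 'p, 'b) cat_functor \<Rightarrow> ('o, 'a, 'q, 'c) cat_functor"
  (infixr "\<circ>\<^sub>F" 75) where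
  "G \<circ>\<^sub>F F = \<lparr>fobj = (\<lambda>x. fobj G (fobj F x)), farr = (\<lambda>f. farr G (farr F f))\<rparr>"

locale nat_trans = source: cat_functor C D F + target: cat_functor C D G
  for C :: "('o, 'a) category" and D :: "('p, 'b) category"
    and F :: "('o, 'a, 'p, 'b) cat_functor" and G :: "('o, 'a, 'p, 'b) cat_functor" +
  fixes \<tau> :: "'o \<Rightarrow> 'b"
  assumes component_in_hom: "x \<in> Obj C \<Longrightarrow> \<tau> x \<in> hom D (fobj F x) (fobj G x)"
    and naturality: "f \<in> hom C x y \<Longrightarrow> \<tau> y \<odot>\<^bsub>D\<^esub> farr F f = farr G f \<odot>\<^bsub>D\<^esub> \<tau> x"

definition prod_cat ::
  "('o, 'a) category \<Rightarrow> ('p, 'b) category \<Rightarrow> ('o \<times> 'p, 'a \<times> 'b) category" where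
  "prod_cat C D = \<lparr>
     Obj = Obj C \<times> Obj D,
     Arr = Arr C \<times> Arr D,
     Dom = (\<lambda>(f, g). (Dom C f, Dom D g)),
     Cod = (\<lambda>(f, g). (Cod C f, Cod D g)),
     Id = (\<lambda>(x, y). (Id C x, Id D y)),
     Comp = (\<lambda>(f', g') (f, g). (f' \<odot>\<^bsub>C\<^esub> f, g' \<odot>\<^bsub>D\<^esub> g))\<rparr>"

text \<open>The functors \<open>\<Gamma>(-, y)\<close> and \<open>\<Gamma>(x, -)\<close> for a functor \<open>\<Gamma>\<close> out of \<open>C \<times> D\<close>.\<close>

definition fix_snd ::
  "('p, 'b) category \<Rightarrow> ('o \<times> 'p, 'a \<times> 'b, 'q, 'c) cat_functor \<Rightarrow> 'p \<Rightarrow> ('o, 'a, 'q, 'c) cat_functor" where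
  "fix_snd D \<Gamma> y = \<lparr>fobj = (\<lambda>x. fobj \<Gamma> (x, y)), farr = (\<lambda>f. farr \<Gamma> (f, Id D y))\<rparr>"

definition fix_fst ::
  "('o, 'a) category \<Rightarrow> ('o \<times> 'p, 'a \<times> 'b, 'q, 'c) cat_functor \<Rightarrow> 'o \<Rightarrow> ('p, 'b, 'q, 'c) cat_functor" where
  "fix_fst C \<Gamma> x = \<lparr>fobj = (\<lambda>y. fobj \<Gamma> (x, y)), farr = (\<lambda>g. farr \<Gamma> (Id C x, g))\<rparr>"


section \<open>Colimits\<close>

definition cocone ::
  "('o, 'a) category \<Rightarrow> ('i, 'j) category \<Rightarrow> ('i, 'j, 'o, 'a) cat_functor \<Rightarrow> 'o \<Rightarrow> ('i \<Rightarrow> 'a) \<Rightarrow> bool" where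
  "cocone C J D L \<kappa> \<longleftrightarrow> cat_functor J C D \<and> L \<in> Obj C \<and>
     (\<forall>i \<in> Obj J. \<kappa> i \<in> hom C (fobj D i) L) \<and>
     (\<forall>u \<in> Arr J. \<kappa> (Cod J u) \<odot>\<^bsub>C\<^esub> farr D u = \<kappa> (Dom J u))"

definition is_colimit ::
  "('o, 'a) category \<Rightarrow> ('i, 'j) category \<Rightarrow> ('i, 'j, 'o, 'a) cat_functor \<Rightarrow> 'o \<Rightarrow> ('i \<Rightarrow> 'a) \<Rightarrow> bool" where
  "is_colimit C J D L \<kappa> \<longleftrightarrow> cocone C J D L \<kappa> \<and>
     (\<forall>M \<kappa>'. cocone C J D M \<kappa>' \<longrightarrow>
        (\<exists>!h. h \<in> hom C L M \<and> (\<forall>i \<in> Obj J. h \<odot>\<^bsub>C\<^esub> \<kappa> i = \<kappa>' i)))"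

definition preserves_colimit ::
  "('o, 'a) category \<Rightarrow> ('p, 'b) category \<Rightarrow> ('o, 'a, 'p, 'b) cat_functor \<Rightarrow>
   ('i, 'j) category \<Rightarrow> ('i, 'j, 'o, 'a) cat_functor \<Rightarrow> bool" where
  "preserves_colimit C D F J E \<longleftrightarrow>
     (\<forall>L \<kappa>. is_colimit C J E L \<kappa> \<longrightarrow>
        is_colimit D J (F \<circ>\<^sub>F E) (fobj F L) (\<lambda>i. farr F (\<kappa> i)))"

definition initial :: "('o, 'a) category \<Rightarrow> 'o \<Rightarrow> bool" where
  "initial C z \<longleftrightarrow> z \<in> Obj C \<and> (\<forall>x \<in> Obj C. \<exists>!f. f \<in> hom C z x)"

definition is_coproduct :: "('o, 'a) category \<Rightarrow> 'o \<Rightarrow> 'o \<Rightarrow> 'o \<Rightarrow> 'a \<Rightarrow> 'a \<Rightarrow> bool" where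
  "is_coproduct C x y p i j \<longleftrightarrow> p \<in> Obj C \<and> i \<in> hom C x p \<and> j \<in> hom C y p \<and>
     (\<forall>z \<in> Obj C. \<forall>f \<in> hom C x z. \<forall>g \<in> hom C y z.
        \<exists>!h. h \<in> hom C p z \<and> h \<odot>\<^bsub>C\<^esub> i = f \<and> h \<odot>\<^bsub>C\<^esub> j = g)"

text \<open>A fixed but arbitrary choice of binary coproducts, meaningful whenever they exist.\<close>

definition coproduct :: "('o, 'a) category \<Rightarrow> 'o \<Rightarrow> 'o \<Rightarrow> 'o \<times> 'a \<times> 'a" where
  "coproduct C x y = (SOME (p, i, j). is_coproduct C x y p i j)"

definition coprod :: "('o, 'a) category \<Rightarrow> 'o \<Rightarrow> 'o \<Rightarrow> 'o" where
  "coprod C x y = fst (coproduct C x y)"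

definition inl :: "('o, 'a) category \<Rightarrow> 'o \<Rightarrow> 'o \<Rightarrow> 'a" where
  "inl C x y = fst (snd (coproduct C x y))"

definition inr :: "('o, 'a) category \<Rightarrow> 'o \<Rightarrow> 'o \<Rightarrow> 'a" where
  "inr C x y = snd (snd (coproduct C x y))"

definition copair :: "('o, 'a) category \<Rightarrow> 'a \<Rightarrow> 'a \<Rightarrow> 'a" where
  "copair C f g = (THE h. h \<in> hom C (coprod C (Dom C f) (Dom C g)) (Cod C f) \<and>
     h \<odot>\<^bsub>C\<^esub> inl C (Dom C f) (Dom C g) = f \<and> h \<odot>\<^bsub>C\<^esub> inr C (Dom C f) (Dom C g) = g)"

definition coprod_arr :: "('o, 'a) category \<Rightarrow> 'a \<Rightarrow> 'a \<Rightarrow> 'a" where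
  "coprod_arr C f g = copair C
     (inl C (Cod C f) (Cod C g) \<odot>\<^bsub>C\<^esub> f) (inr C (Cod C f) (Cod C g) \<odot>\<^bsub>C\<^esub> g)"

definition coprod3 :: "('o, 'a) category \<Rightarrow> 'o \<Rightarrow> 'o \<Rightarrow> 'o \<Rightarrow> 'o" where
  "coprod3 C x y z = coprod C (coprod C x y) z"

definition copair3 :: "('o, 'a) category \<Rightarrow> 'a \<Rightarrow> 'a \<Rightarrow> 'a \<Rightarrow> 'a" where
  "copair3 C f g h = copair C (copair C f g) h"

definition coprod3_arr :: "('o, 'a) category \<Rightarrow> 'a \<Rightarrow> 'a \<Rightarrow> 'a \<Rightarrow> 'a" where
  "coprod3_arr C f g h = coprod_arr C (coprod_arr C f g) h"


section \<open>Smallness and locally finitely presentable categories\<close>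

text \<open>
  Smallness is relative to a type \<open>'u\<close> playing the role of the universe: a set is small iff
  its cardinality is strictly below that of \<open>'u\<close>.  If the cardinality of \<open>'u\<close> is inaccessible,
  this is smallness with respect to the corresponding Grothendieck universe; uncountability of
  \<open>'u\<close> means that countable sets are small.  A small category
  is isomorphic to one whose objects and arrows lie in \<open>'u\<close>, so it suffices to let
  diagrams range over the latter.
\<close>

definition small :: "'u itself \<Rightarrow> 'x set \<Rightarrow> bool" where
  "small U A \<longleftrightarrow> A \<prec> (UNIV :: 'u set)"

definition small_category :: "('u, 'u) category \<Rightarrow> bool" where
  "small_category J \<longleftrightarrow> category J \<and> small TYPE('u) (Obj J) \<and> small TYPE('u) (Arr J)"

definition filtered :: "('i, 'j) category \<Rightarrow> bool" where
  "filtered J \<longleftrightarrow> Obj J \<noteq> {} \<and>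
     (\<forall>x \<in> Obj J. \<forall>y \<in> Obj J. \<exists>z \<in> Obj J. hom J x z \<noteq> {} \<and> hom J y z \<noteq> {}) \<and>
     (\<forall>x \<in> Obj J. \<forall>y \<in> Obj J. \<forall>f \<in> hom J x y. \<forall>g \<in> hom J x y.
        \<exists>z \<in> Obj J. \<exists>h \<in> hom J y z. h \<odot>\<^bsub>J\<^esub> f = h \<odot>\<^bsub>J\<^esub> g)"

definition cocomplete :: "'u itself \<Rightarrow> ('o, 'a) category \<Rightarrow> bool" where
  "cocomplete U C \<longleftrightarrow> category C \<and>
     (\<forall>(J :: ('u, 'u) category) D. small_category J \<and> cat_functor J C D \<longrightarrow>
        (\<exists>L \<kappa>. is_colimit C J D L \<kappa>))"

definition cocontinuous ::
  "'u itself \<Rightarrow> ('o, 'a) category \<Rightarrow> ('p, 'b) category \<Rightarrow> ('o, 'a, 'p, 'b) cat_functor \<Rightarrow> bool" where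
  "cocontinuous U C D F \<longleftrightarrow> cat_functor C D F \<and>
     (\<forall>(J :: ('u, 'u) category) E. small_category J \<and> cat_functor J C E \<longrightarrow>
        preserves_colimit C D F J E)"

definition finitary ::
  "'u itself \<Rightarrow> ('o, 'a) category \<Rightarrow> ('p, 'b) category \<Rightarrow> ('o, 'a, 'p, 'b) cat_functor \<Rightarrow> bool" where
  "finitary U C D F \<longleftrightarrow> cat_functor C D F \<and>
     (\<forall>(J :: ('u, 'u) category) E. small_category J \<and> filtered J \<and> cat_functor J C E \<longrightarrow>
        preserves_colimit C D F J E)"

text \<open>
  The category of subsets of a type \<open>'x\<close>; an arrow is a triple of domain, (extensional) function
  and codomain.
\<close>

definition set_cat :: "('x set, 'x set \<times> ('x \<Rightarrow> 'x) \<times> 'x set) category" where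
  "set_cat = \<lparr>
     Obj = UNIV,
     Arr = {(X, f, Y). f \<in> X \<rightarrow>\<^sub>E Y},
     Dom = (\<lambda>(X, f, Y). X),
     Cod = (\<lambda>(X, f, Y). Y),
     Id = (\<lambda>X. (X, (\<lambda>x\<in>X. x), X)),
     Comp = (\<lambda>(Y', g, Z) (X, f, Y). (X, compose X g f, Z))\<rparr>"

definition hom_functor ::
  "('o, 'a) category \<Rightarrow> 'o \<Rightarrow> ('o, 'a, 'a set, 'a set \<times> ('a \<Rightarrow> 'a) \<times> 'a set) cat_functor" where
  "hom_functor C a = \<lparr>
     fobj = (\<lambda>x. hom C a x),
     farr = (\<lambda>f. (hom C a (Dom C f), (\<lambda>g \<in> hom C a (Dom C f). f \<odot>\<^bsub>C\<^esub> g), hom C a (Cod C f)))\<rparr>"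

text \<open>
  The hom-functor of \<open>a\<close> takes values in the sets of arrows of \<open>C\<close>.  Restricting the codomain
  to these sets does not affect which colimits are preserved as soon as \<open>'a\<close> has two elements,
  because maps into a two-element set detect bijections; if \<open>'a\<close> has only one
  element, filtered colimits are preserved in either reading.
\<close>

definition finitely_presentable :: "'u itself \<Rightarrow> ('o, 'a) category \<Rightarrow> 'o \<Rightarrow> bool" where
  "finitely_presentable U C a \<longleftrightarrow> a \<in> Obj C \<and> finitary U C set_cat (hom_functor C a)"

definition locally_finitely_presentable :: "'u itself \<Rightarrow> ('o, 'a) category \<Rightarrow> bool" where
  "locally_finitely_presentable U C \<longleftrightarrow> cocomplete U C \<and>
     (\<forall>x \<in> Obj C. \<forall>y \<in> Obj C. small U (hom C x y)) \<and>
     (\<exists>A. small U A \<and> (\<forall>a \<in> A. finitely_presentable U C a) \<and>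
        (\<forall>x \<in> Obj C. \<exists>(J :: ('u, 'u) category) D \<kappa>. small_category J \<and> filtered J \<and>
           is_colimit C J D x \<kappa> \<and> (\<forall>i \<in> Obj J. fobj D i \<in> A)))"


section \<open>Monads\<close>

record ('o, 'a) monad =
  mfun :: "('o, 'a) endofunctor"
  eta :: "'o \<Rightarrow> 'a"
  mu :: "'o \<Rightarrow> 'a"

locale monad = category C
  for C :: "('o, 'a) category" (structure) +
  fixes M :: "('o, 'a) monad"
  assumes eta_nat: "nat_trans C C id_functor (mfun M) (eta M)"
    and mu_nat: "nat_trans C C (mfun M \<circ>\<^sub>F mfun M) (mfun M) (mu M)"
    and mu_eta: "x \<in> Obj C \<Longrightarrow> mu M x \<odot> eta M (fobj (mfun M) x) = Id C (fobj (mfun M) x)"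
    and mu_map_eta: "x \<in> Obj C \<Longrightarrow> mu M x \<odot> farr (mfun M) (eta M x) = Id C (fobj (mfun M) x)"
    and mu_mu: "x \<in> Obj C \<Longrightarrow>
      mu M x \<odot> mu M (fobj (mfun M) x) = mu M x \<odot> farr (mfun M) (mu M x)"

locale monad_morphism = source: monad C R + target: monad C R'
  for C :: "('o, 'a) category" (structure) and R R' +
  fixes \<alpha> :: "'o \<Rightarrow> 'a"
  assumes natural: "nat_trans C C (mfun R) (mfun R') \<alpha>"
    and map_eta: "x \<in> Obj C \<Longrightarrow> \<alpha> x \<odot> eta R x = eta R' x"
    and map_mu: "x \<in> Obj C \<Longrightarrow>
      \<alpha> x \<odot> mu R x = mu R' x \<odot> farr (mfun R') (\<alpha> x) \<odot> \<alpha> (fobj (mfun R) x)"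

text \<open>\<open>free_monad C F M \<iota>\<close>: the monad \<open>M\<close> together with \<open>\<iota> : F \<rightarrow> M\<close> is free on \<open>F\<close>.\<close>

definition free_monad ::
  "('o, 'a) category \<Rightarrow> ('o, 'a) endofunctor \<Rightarrow> ('o, 'a) monad \<Rightarrow> ('o \<Rightarrow> 'a) \<Rightarrow> bool" where
  "free_monad C F M \<iota> \<longleftrightarrow> monad C M \<and> nat_trans C C F (mfun M) \<iota> \<and>
     (\<forall>N \<theta>. monad C N \<and> nat_trans C C F (mfun N) \<theta> \<longrightarrow>
        (\<exists>\<alpha>. monad_morphism C M N \<alpha> \<and> (\<forall>x \<in> Obj C. \<alpha> x \<odot>\<^bsub>C\<^esub> \<iota> x = \<theta> x) \<and>
          (\<forall>\<beta>. monad_morphism C M N \<beta> \<and> (\<forall>x \<in> Obj C. \<beta> x \<odot>\<^bsub>C\<^esub> \<iota> x = \<theta> x) \<longrightarrow>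
             (\<forall>x \<in> Obj C. \<beta> x = \<alpha> x))))"

definition constant_free :: "('o, 'a) category \<Rightarrow> ('o, 'a) monad \<Rightarrow> bool" where
  "constant_free C M \<longleftrightarrow> monad C M \<and> (\<forall>z. initial C z \<longrightarrow> iso C (eta M z))"

definition admissible ::
  "('o, 'a) category \<Rightarrow> ('o, 'a) monad \<Rightarrow> ('o, 'a) monad \<Rightarrow> ('o \<Rightarrow> 'a) \<Rightarrow> bool" where
  "admissible C R R' \<alpha> \<longleftrightarrow> monad_morphism C R R' \<alpha> \<and> (\<forall>z. initial C z \<longrightarrow> iso C (\<alpha> z))"

locale monad_distributive_law = S: monad C S + T: monad C T
  for C :: "('o, 'a) category" (structure) and S T +
  fixes \<delta> :: "'o \<Rightarrow> 'a"
  assumes natural: "nat_trans C C (mfun T \<circ>\<^sub>F mfun S) (mfun S \<circ>\<^sub>F mfun T) \<delta>"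
    and eta_S: "x \<in> Obj C \<Longrightarrow> \<delta> x \<odot> farr (mfun T) (eta S x) = eta S (fobj (mfun T) x)"
    and eta_T: "x \<in> Obj C \<Longrightarrow> \<delta> x \<odot> eta T (fobj (mfun S) x) = farr (mfun S) (eta T x)"
    and mu_S: "x \<in> Obj C \<Longrightarrow>
      \<delta> x \<odot> farr (mfun T) (mu S x) =
      mu S (fobj (mfun T) x) \<odot> farr (mfun S) (\<delta> x) \<odot> \<delta> (fobj (mfun S) x)"
    and mu_T: "x \<in> Obj C \<Longrightarrow>
      \<delta> x \<odot> mu T (fobj (mfun S) x) =
      farr (mfun S) (mu T x) \<odot> \<delta> (fobj (mfun T) x) \<odot> farr (mfun T) (\<delta> x)"

text \<open>The monad \<open>ST\<close> induced by a distributive law \<open>TS \<rightarrow> ST\<close>.\<close>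

definition composite_monad ::
  "('o, 'a) category \<Rightarrow> ('o, 'a) monad \<Rightarrow> ('o, 'a) monad \<Rightarrow> ('o \<Rightarrow> 'a) \<Rightarrow> ('o, 'a) monad" where
  "composite_monad C S T \<delta> = \<lparr>
     mfun = mfun S \<circ>\<^sub>F mfun T,
     eta = (\<lambda>x. eta S (fobj (mfun T) x) \<odot>\<^bsub>C\<^esub> eta T x),
     mu = (\<lambda>x. mu S (fobj (mfun T) x) \<odot>\<^bsub>C\<^esub> farr (mfun S) (farr (mfun S) (mu T x)) \<odot>\<^bsub>C\<^esub>
       farr (mfun S) (\<delta> (fobj (mfun T) x)))\<rparr>"


section \<open>Simple structural laws\<close>

text \<open>The functors \<open>(X, Y) \<mapsto> \<Gamma>(\<Sigma>X, Y)\<close> and \<open>(X, Y) \<mapsto> S(\<Gamma>(X, SY) + X + Y)\<close>, and the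
  endofunctor \<open>\<Gamma>\<^sub>S\<Delta>\<close>, that is \<open>X \<mapsto> \<Gamma>(X, SX)\<close>.\<close>

definition law_source ::
  "('o, 'a) endofunctor \<Rightarrow> ('o \<times> 'o, 'a \<times> 'a, 'o, 'a) cat_functor \<Rightarrow>
   ('o \<times> 'o, 'a \<times> 'a, 'o, 'a) cat_functor" where
  "law_source \<Sigma> \<Gamma> = \<lparr>
     fobj = (\<lambda>(X, Y). fobj \<Gamma> (fobj \<Sigma> X, Y)),
     farr = (\<lambda>(f, g). farr \<Gamma> (farr \<Sigma> f, g))\<rparr>"

definition law_target ::
  "('o, 'a) category \<Rightarrow> ('o \<times> 'o, 'a \<times> 'a, 'o, 'a) cat_functor \<Rightarrow> ('o, 'a) endofunctor \<Rightarrow>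
   ('o \<times> 'o, 'a \<times> 'a, 'o, 'a) cat_functor" where
  "law_target C \<Gamma> S = \<lparr>
     fobj = (\<lambda>(X, Y). fobj S (coprod3 C (fobj \<Gamma> (X, fobj S Y)) X Y)),
     farr = (\<lambda>(f, g). farr S (coprod3_arr C (farr \<Gamma> (f, farr S g)) f g))\<rparr>"

definition Gamma_S_Delta ::
  "('o \<times> 'o, 'a \<times> 'a, 'o, 'a) cat_functor \<Rightarrow> ('o, 'a) endofunctor \<Rightarrow> ('o, 'a) endofunctor" where
  "Gamma_S_Delta \<Gamma> S = \<lparr>
     fobj = (\<lambda>X. fobj \<Gamma> (X, fobj S X)),
     farr = (\<lambda>f. farr \<Gamma> (f, farr S f))\<rparr>"

text \<open>Here \<open>S\<close> with \<open>\<iota>\<close> is the free monad on \<open>\<Sigma>\<close>.\<close>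

definition simple_structural_law ::
  "'u itself \<Rightarrow> ('o, 'a) category \<Rightarrow> ('o, 'a) endofunctor \<Rightarrow>
   ('o \<times> 'o, 'a \<times> 'a, 'o, 'a) cat_functor \<Rightarrow> ('o, 'a) monad \<Rightarrow> ('o \<Rightarrow> 'a) \<Rightarrow> ('o \<times> 'o \<Rightarrow> 'a) \<Rightarrow> bool" where
  "simple_structural_law U C \<Sigma> \<Gamma> S \<iota> d \<longleftrightarrow>
     finitary U C C \<Sigma> \<and>
     cat_functor (prod_cat C C) C \<Gamma> \<and>
     (\<forall>Y \<in> Obj C. cocontinuous U C C (fix_snd C \<Gamma> Y)) \<and>
     (\<forall>X \<in> Obj C. finitary U C C (fix_fst C \<Gamma> X)) \<and>
     free_monad C \<Sigma> S \<iota> \<and>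
     nat_trans (prod_cat C C) C (law_source \<Sigma> \<Gamma>) (law_target C \<Gamma> (mfun S)) d"

end

(* A distributive law of T over S amounts to a lifting of the monad S to algebras for the endofunctor
   G X = Gamma(X, SX).  Given a G-algebra a : Gamma(A, SA) -> A, the structure on SA is
   Gamma(SA, SSA) -> Gamma(SA, SA) -> SA, where the first map is Gamma(SA, mu) and the second one is defined
   by recursion on SA: it is a on generators, and d prescribes it on operations.  Gamma(-, SA) preserves the
   initial sequence A_0 -> A_1 -> ... with colimit SA, so this recursion has a unique solution, and the
   same uniqueness shows that Sf, the unit and the multiplication of S are G-algebra morphisms.  Then delta_X is
   the unique G-algebra morphism TSX -> STX extending the S-image of the unit of T, and all axioms of a
   distributive law compare two morphisms out of a free G-algebra.

   Only countable colimits are used.  Since Sigma preserves colimits of sequences, so do S and G; hence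
   free algebras exist, and the monads S and T, which are given only by their universal property among
   monads, consist of free algebras. *)

theory Submission
  imports Defs
begin

section \<open>Arrows\<close>

text \<open>The obstacle is the second argument of \<Gamma>. It is only finitary, so \<Gamma>(X, -)
  need not preserve coproducts or initial objects, and a recursion over SA cannot run along the
  diagonal \<Gamma>(X, SX). The second argument is therefore frozen at some Y while the first climbs
  the initial sequence. Each use of \<open>d\<close>, however, turns Y into SY. For Y = SA the
  multiplication SSA \<rightarrow> SA brings it back, and the recursion closes; this is why the
  structure on SA factors through \<Gamma>(SA, \<mu>).

  The functor G does move both arguments at once, but for it only colimits of sequences matter.
  There finitarity in the second argument suffices, because the diagonal of a doubly indexed
  sequence is cofinal.\<close>

lemma hom_iff [simp]: "f \<in> hom C x y \<longleftrightarrow> f \<in> Arr C \<and> Dom C f = x \<and> Cod C f = y"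
  by (simp add: hom_def)

context category
begin

lemma Id_arr [simp]:
  assumes "x \<in> Obj C"
  shows "Id C x \<in> Arr C" "Dom C (Id C x) = x" "Cod C (Id C x) = x"
  using Id_in_hom[OF assms] by auto

lemma Comp_arr [simp]:
  assumes "f \<in> Arr C" "g \<in> Arr C" "Dom C g = Cod C f"
  shows "g \<odot> f \<in> Arr C" "Dom C (g \<odot> f) = Dom C f" "Cod C (g \<odot> f) = Cod C g"
  using Comp_in_hom[of f _ "Cod C f" g] assms by auto

lemma Obj_arr [simp]: "f \<in> Arr C \<Longrightarrow> Dom C f \<in> Obj C" "f \<in> Arr C \<Longrightarrow> Cod C f \<in> Obj C"
  by (auto intro: Dom_in_Obj Cod_in_Obj)

lemma hom_Obj: "f \<in> hom C x y \<Longrightarrow> x \<in> Obj C" "f \<in> hom C x y \<Longrightarrow> y \<in> Obj C"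
  by (auto intro: Dom_in_Obj Cod_in_Obj)

lemma Id_laws [simp]:
  "f \<in> Arr C \<Longrightarrow> Dom C f = x \<Longrightarrow> f \<odot> Id C x = f"
  "f \<in> Arr C \<Longrightarrow> Cod C f = x \<Longrightarrow> Id C x \<odot> f = f"
  using Comp_Id Id_Comp by auto

lemma assoc [simp]:
  assumes "f \<in> Arr C" "g \<in> Arr C" "h \<in> Arr C" "Dom C g = Cod C f" "Dom C h = Cod C g"
  shows "(h \<odot> g) \<odot> f = h \<odot> (g \<odot> f)"
  using Comp_assoc[of f _ "Cod C f" g "Cod C g" h] assms by auto

text \<open>Simplification associates composites to the right, which hides
  \<open>g \<odot> f\<close> inside \<open>g \<odot> (f \<odot> k)\<close>. In this form an equation
  for \<open>g \<odot> f\<close> can be applied there.\<close>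

lemma whisker:
  assumes "g \<odot> f = h" "f \<in> Arr C" "g \<in> Arr C" "Dom C g = Cod C f" "k \<in> Arr C" "Dom C f = Cod C k"
  shows "g \<odot> (f \<odot> k) = h \<odot> k"
  using assms assoc[of k f g] by auto

end

context cat_functor
begin

lemma farr_arr [simp]:
  assumes "f \<in> Arr C"
  shows "farr F f \<in> Arr D" "Dom D (farr F f) = fobj F (Dom C f)" "Cod D (farr F f) = fobj F (Cod C f)"
  using farr_in_hom[of f "Dom C f" "Cod C f"] assms by auto

lemma farr_Comp' [simp]:
  "f \<in> Arr C \<Longrightarrow> g \<in> Arr C \<Longrightarrow> Dom C g = Cod C f \<Longrightarrow> farr F (g \<odot>\<^bsub>C\<^esub> f) = farr F g \<odot>\<^bsub>D\<^esub> farr F f"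
  using farr_Comp[of f _ "Cod C f" g] by auto

lemmas [simp] = fobj_in_Obj farr_Id

text \<open>Since \<open>farr_Comp'\<close> expands images of composites, the image of a commuting
  triangle has to be available in expanded form, alone and with a further arrow \<open>k\<close> on
  the right.\<close>

lemma farr_eq:
  assumes "g \<odot>\<^bsub>C\<^esub> f = h" "f \<in> Arr C" "g \<in> Arr C" "Dom C g = Cod C f"
  shows "farr F g \<odot>\<^bsub>D\<^esub> farr F f = farr F h"
    and "k \<in> Arr D \<Longrightarrow> Cod D k = fobj F (Dom C f) \<Longrightarrow> farr F g \<odot>\<^bsub>D\<^esub> (farr F f \<odot>\<^bsub>D\<^esub> k) = farr F h \<odot>\<^bsub>D\<^esub> k"
proof -
  show eq: "farr F g \<odot>\<^bsub>D\<^esub> farr F f = farr F h"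
    using farr_Comp'[OF assms(2-)] assms(1) by simp
  show "farr F g \<odot>\<^bsub>D\<^esub> (farr F f \<odot>\<^bsub>D\<^esub> k) = farr F h \<odot>\<^bsub>D\<^esub> k"
    if "k \<in> Arr D" "Cod D k = fobj F (Dom C f)"
    by (rule cod.whisker[OF eq]) (use that assms in auto)
qed

end

context nat_trans
begin

lemma component_arr [simp]:
  assumes "x \<in> Obj C"
  shows "\<tau> x \<in> Arr D" "Dom D (\<tau> x) = fobj F x" "Cod D (\<tau> x) = fobj G x"
  using component_in_hom[OF assms] by auto

lemma natural_Comp:
  "f \<in> Arr C \<Longrightarrow> Cod C f = y \<Longrightarrow> \<tau> y \<odot>\<^bsub>D\<^esub> farr F f = farr G f \<odot>\<^bsub>D\<^esub> \<tau> (Dom C f)"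
  using naturality[of f] by auto

lemma natural_Comp':
  assumes "f \<in> Arr C" "Cod C f = y" "k \<in> Arr D" "Cod D k = fobj F (Dom C f)"
  shows "\<tau> y \<odot>\<^bsub>D\<^esub> (farr F f \<odot>\<^bsub>D\<^esub> k) = farr G f \<odot>\<^bsub>D\<^esub> (\<tau> (Dom C f) \<odot>\<^bsub>D\<^esub> k)"
proof -
  have "\<tau> y \<odot>\<^bsub>D\<^esub> (farr F f \<odot>\<^bsub>D\<^esub> k) = (farr G f \<odot>\<^bsub>D\<^esub> \<tau> (Dom C f)) \<odot>\<^bsub>D\<^esub> k"
    using natural_Comp[OF assms(1,2)] source.cod.whisker[of "\<tau> y" "farr F f"] assms by auto
  then show ?thesis
    using assms by auto
qed

end

lemma cat_functor_comp:
  assumes "cat_functor C D F" "cat_functor D E G"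
  shows "cat_functor C E (G \<circ>\<^sub>F F)"
proof -
  interpret F: cat_functor C D F by fact
  interpret G: cat_functor D E G by fact
  show ?thesis
    by unfold_locales (auto simp: comp_functor_def)
qed

lemma fobj_comp_functor [simp]: "fobj (G \<circ>\<^sub>F F) x = fobj G (fobj F x)"
  and farr_comp_functor [simp]: "farr (G \<circ>\<^sub>F F) f = farr G (farr F f)"
  by (simp_all add: comp_functor_def)

lemma fobj_id_functor [simp]: "fobj id_functor x = x"
  and farr_id_functor [simp]: "farr id_functor f = f"
  by (simp_all add: id_functor_def)


section \<open>Colimits of sequences\<close>

text \<open>A sequence is recorded by its objects and successive arrows only, which suits recursion
  over the stages. The link to diagrams over a category of natural numbers is
  \<open>is_colimit_omega\<close>.\<close>

definition chain :: "('o, 'a) category \<Rightarrow> (nat \<Rightarrow> 'o) \<Rightarrow> (nat \<Rightarrow> 'a) \<Rightarrow> bool" where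
  "chain C X c \<longleftrightarrow> (\<forall>n. c n \<in> hom C (X n) (X (Suc n)))"

definition chain_cocone ::
  "('o, 'a) category \<Rightarrow> (nat \<Rightarrow> 'o) \<Rightarrow> (nat \<Rightarrow> 'a) \<Rightarrow> 'o \<Rightarrow> (nat \<Rightarrow> 'a) \<Rightarrow> bool" where
  "chain_cocone C X c L \<kappa> \<longleftrightarrow>
     (\<forall>n. \<kappa> n \<in> hom C (X n) L \<and> \<kappa> (Suc n) \<odot>\<^bsub>C\<^esub> c n = \<kappa> n)"

definition chain_colimit ::
  "('o, 'a) category \<Rightarrow> (nat \<Rightarrow> 'o) \<Rightarrow> (nat \<Rightarrow> 'a) \<Rightarrow> 'o \<Rightarrow> (nat \<Rightarrow> 'a) \<Rightarrow> bool" where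
  "chain_colimit C X c L \<kappa> \<longleftrightarrow> chain C X c \<and> chain_cocone C X c L \<kappa> \<and>
     (\<forall>Z g. chain_cocone C X c Z g \<longrightarrow> (\<exists>!h. h \<in> hom C L Z \<and> (\<forall>n. h \<odot>\<^bsub>C\<^esub> \<kappa> n = g n)))"

definition preserves_chain_colimits ::
  "('o, 'a) category \<Rightarrow> ('p, 'b) category \<Rightarrow> ('o, 'a, 'p, 'b) cat_functor \<Rightarrow> bool" where
  "preserves_chain_colimits C D F \<longleftrightarrow>
     (\<forall>X c L \<kappa>. chain_colimit C X c L \<kappa> \<longrightarrow>
        chain_colimit D (\<lambda>n. fobj F (X n)) (\<lambda>n. farr F (c n)) (fobj F L) (\<lambda>n. farr F (\<kappa> n)))"

lemma chain_arr:
  assumes "chain C X c"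
  shows "c n \<in> Arr C" "Dom C (c n) = X n" "Cod C (c n) = X (Suc n)"
  using assms by (auto simp: chain_def)

lemma chain_coconeD:
  assumes "chain_cocone C X c L \<kappa>"
  shows "\<kappa> n \<in> Arr C" "Dom C (\<kappa> n) = X n" "Cod C (\<kappa> n) = L" "\<kappa> (Suc n) \<odot>\<^bsub>C\<^esub> c n = \<kappa> n"
  using assms by (auto simp: chain_cocone_def)

lemma (in category) chain_colimitD:
  assumes "chain_colimit C X c L \<kappa>"
  shows "c n \<in> Arr C" "Dom C (c n) = X n" "Cod C (c n) = X (Suc n)"
    "\<kappa> n \<in> Arr C" "Dom C (\<kappa> n) = X n" "Cod C (\<kappa> n) = L" "\<kappa> (Suc n) \<odot> c n = \<kappa> n"
    "X n \<in> Obj C"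
proof -
  show c: "c n \<in> Arr C" "Dom C (c n) = X n" "Cod C (c n) = X (Suc n)"
    "\<kappa> n \<in> Arr C" "Dom C (\<kappa> n) = X n" "Cod C (\<kappa> n) = L" "\<kappa> (Suc n) \<odot> c n = \<kappa> n"
    using assms by (auto simp: chain_colimit_def dest: chain_arr chain_coconeD)
  then show "X n \<in> Obj C"
    by (metis Obj_arr(1))
qed

lemma (in category) chain_colimit_Obj: "chain_colimit C X c L \<kappa> \<Longrightarrow> L \<in> Obj C"
  using chain_colimitD(4,6) Obj_arr(2) by metis

lemma chain_colimit_ex1:
  assumes "chain_colimit C X c L \<kappa>" "chain_cocone C X c Z g"
  shows "\<exists>!h. h \<in> hom C L Z \<and> (\<forall>n. h \<odot>\<^bsub>C\<^esub> \<kappa> n = g n)"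
  using assms unfolding chain_colimit_def by blast

lemma (in category) chain_colimit_eqI:
  assumes K: "chain_colimit C X c L \<kappa>"
    and h: "h \<in> hom C L Z" and k: "k \<in> hom C L Z" and eq: "\<And>n. h \<odot> \<kappa> n = k \<odot> \<kappa> n"
  shows "h = k"
proof -
  note [simp] = chain_colimitD[OF K]
  have "chain_cocone C X c Z (\<lambda>n. k \<odot> \<kappa> n)"
    using k by (auto simp: chain_cocone_def)
  then show ?thesis
    using chain_colimit_ex1[OF K] h k eq by blast
qed

primrec chain_map ::
  "('o, 'a) category \<Rightarrow> (nat \<Rightarrow> 'o) \<Rightarrow> (nat \<Rightarrow> 'a) \<Rightarrow> nat \<Rightarrow> nat \<Rightarrow> 'a" where
  "chain_map C X c m 0 = Id C (X m)"
| "chain_map C X c m (Suc k) = c (m + k) \<odot>\<^bsub>C\<^esub> chain_map C X c m k"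

context category
begin

lemma chain_Obj:
  assumes "chain C X c"
  shows "X n \<in> Obj C"
  using chain_arr[OF assms, of n] Obj_arr(1) by metis

lemma chain_map_arr:
  assumes "chain C X c"
  shows "chain_map C X c m k \<in> Arr C" "Dom C (chain_map C X c m k) = X m"
    "Cod C (chain_map C X c m k) = X (m + k)"
  by (induction k) (use chain_arr[OF assms] chain_Obj[OF assms] in auto)

text \<open>The recursion of \<open>chain_map\<close> adds steps at the end; this trades a step at
  the start for one at the end.\<close>

lemma chain_map_shift:
  assumes "chain C X c"
  shows "chain_map C X c (Suc m) k \<odot> c m = c (m + k) \<odot> chain_map C X c m k"
proof (induction k)
  case 0
  show ?case
    using chain_arr[OF assms] chain_Obj[OF assms] by simp
next
  case (Suc k)
  then show ?case
    using chain_arr[OF assms] chain_map_arr[OF assms] by simp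
qed

lemma chain_map_add:
  assumes "chain C X c"
  shows "chain_map C X c (m + k) l \<odot> chain_map C X c m k = chain_map C X c m (k + l)"
proof (induction l)
  case 0
  show ?case
    using chain_map_arr[OF assms] chain_Obj[OF assms] by simp
next
  case (Suc l)
  have "chain_map C X c (m + k) (Suc l) \<odot> chain_map C X c m k
      = c (m + k + l) \<odot> (chain_map C X c (m + k) l \<odot> chain_map C X c m k)"
    using chain_arr[OF assms] chain_map_arr[OF assms] by simp
  then show ?case
    using Suc by (simp add: add.assoc)
qed

lemma chain_cocone_map:
  assumes "chain C X c" "chain_cocone C X c L \<kappa>"
  shows "\<kappa> (m + k) \<odot> chain_map C X c m k = \<kappa> m"
proof (induction k)
  case 0
  show ?case
    using chain_coconeD[OF assms(2)] by simp
next
  case (Suc k)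
  have "\<kappa> (m + Suc k) \<odot> chain_map C X c m (Suc k)
      = (\<kappa> (Suc (m + k)) \<odot> c (m + k)) \<odot> chain_map C X c m k"
    using chain_coconeD(1-3)[OF assms(2)] chain_arr[OF assms(1)] chain_map_arr[OF assms(1)] by simp
  then show ?case
    using Suc chain_coconeD(4)[OF assms(2)] by simp
qed

end


section \<open>Special shapes of small diagrams\<close>

subsection \<open>The empty diagram\<close>

definition empty_cat :: "('i, 'j) category" where
  "empty_cat = \<lparr>Obj = {}, Arr = {}, Dom = undefined, Cod = undefined, Id = undefined, Comp = undefined\<rparr>"

lemma empty_cat_simps [simp]: "Obj empty_cat = {}" "Arr empty_cat = {}"
  by (simp_all add: empty_cat_def)

lemma category_empty: "category empty_cat"
  by unfold_locales auto

lemma cat_functor_empty: "category C \<Longrightarrow> cat_functor empty_cat C E"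
  by (auto simp: cat_functor_def cat_functor_axioms_def category_empty)

lemma small_empty_cat: "small_category (empty_cat :: ('u, 'u) category)"
  using eqpoll_empty_iff_empty[of "UNIV :: 'u set"] eqpoll_sym[of "{}" "UNIV :: 'u set"]
  by (auto simp: small_category_def category_empty small_def lesspoll_def)

lemma is_colimit_empty: "category C \<Longrightarrow> is_colimit C empty_cat E z \<kappa> \<longleftrightarrow> initial C z"
  by (auto simp: is_colimit_def cocone_def initial_def cat_functor_empty)

subsection \<open>Binary coproducts\<close>

text \<open>A discrete category in which each identity is coded by its object. Composable arrows are
  equal, so composition may return either argument.\<close>

definition two_cat :: "'u \<Rightarrow> 'u \<Rightarrow> ('u, 'u) category" where
  "two_cat a b = \<lparr>Obj = {a, b}, Arr = {a, b}, Dom = (\<lambda>u. u), Cod = (\<lambda>u. u), Id = (\<lambda>u. u),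
     Comp = (\<lambda>v u. u)\<rparr>"

lemma two_cat_simps [simp]:
  "Obj (two_cat a b) = {a, b}" "Arr (two_cat a b) = {a, b}"
  "Dom (two_cat a b) u = u" "Cod (two_cat a b) u = u" "Id (two_cat a b) u = u"
  "v \<odot>\<^bsub>two_cat a b\<^esub> u = u"
  by (simp_all add: two_cat_def)

lemma category_two: "category (two_cat a b)"
  by unfold_locales auto

text \<open>This is how uncountability of the universe type enters: diagrams for binary coproducts
  and for sequences have countably many objects and arrows, so they are small.\<close>

lemma countable_lesspoll:
  assumes "uncountable (UNIV :: 'u set)" "countable (A :: 'u set)"
  shows "A \<prec> (UNIV :: 'u set)"
proof -
  have "\<not> (UNIV :: 'u set) \<lesssim> A"
    using assms countable_lepoll by blast
  then show ?thesis
    using lesspoll_def eqpoll_sym eqpoll_imp_lepoll subset_imp_lepoll by (metis subset_UNIV)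
qed

lemma small_two_cat:
  assumes "uncountable (UNIV :: 'u set)"
  shows "small_category (two_cat a (b :: 'u))"
  using assms by (simp add: small_category_def category_two small_def countable_lesspoll)

lemma is_colimit_two:
  assumes ab: "a \<noteq> b" and E: "cat_functor (two_cat a b) C E"
  shows "is_colimit C (two_cat a b) E p \<kappa> \<longleftrightarrow> is_coproduct C (fobj E a) (fobj E b) p (\<kappa> a) (\<kappa> b)"
proof -
  interpret E: cat_functor "two_cat a b" C E by fact
  have "farr E a = Id C (fobj E a)" "farr E b = Id C (fobj E b)"
    using E.farr_Id[of a] E.farr_Id[of b] by simp_all
  then have cc: "cocone C (two_cat a b) E L \<mu> \<longleftrightarrow>
      L \<in> Obj C \<and> \<mu> a \<in> hom C (fobj E a) L \<and> \<mu> b \<in> hom C (fobj E b) L" for L \<mu>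
    using E by (auto simp: cocone_def)
  \<comment> \<open>A cocone is a function on the whole type, but only its values at
    \<open>a\<close> and \<open>b\<close> count; every pair of legs arises because \<open>a\<close>
    and \<open>b\<close> differ.\<close>
  have fg: "(\<forall>\<mu>. P (\<mu> a) (\<mu> b)) \<longleftrightarrow> (\<forall>f g. P f g)" for P :: "_ \<Rightarrow> _ \<Rightarrow> bool"
  proof
    show "\<forall>f g. P f g" if "\<forall>\<mu>. P (\<mu> a) (\<mu> b)"
    proof (intro allI)
      fix f g
      show "P f g"
        using that[rule_format, of "\<lambda>i. if i = a then f else g"] ab by simp
    qed
  qed auto
  have "is_colimit C (two_cat a b) E p \<kappa> \<longleftrightarrow>
      cocone C (two_cat a b) E p \<kappa> \<and>
      (\<forall>z. \<forall>\<mu>. z \<in> Obj C \<and> \<mu> a \<in> hom C (fobj E a) z \<and> \<mu> b \<in> hom C (fobj E b) z \<longrightarrow>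
        (\<exists>!h. h \<in> hom C p z \<and> h \<odot>\<^bsub>C\<^esub> \<kappa> a = \<mu> a \<and> h \<odot>\<^bsub>C\<^esub> \<kappa> b = \<mu> b))"
    unfolding is_colimit_def cc by simp
  also have "\<dots> \<longleftrightarrow> is_coproduct C (fobj E a) (fobj E b) p (\<kappa> a) (\<kappa> b)"
    unfolding is_coproduct_def cc
    by (subst fg[of "\<lambda>f g. _ \<in> Obj C \<and> f \<in> hom C (fobj E a) _ \<and> g \<in> hom C (fobj E b) _ \<longrightarrow>
        (\<exists>!h. h \<in> hom C p _ \<and> h \<odot>\<^bsub>C\<^esub> \<kappa> a = f \<and> h \<odot>\<^bsub>C\<^esub> \<kappa> b = g)"]) blast
  finally show ?thesis .
qed

lemma (in category) cat_functor_two: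
  assumes "x \<in> Obj C" "y \<in> Obj C"
  shows "cat_functor (two_cat a b) C
    \<lparr>fobj = (\<lambda>i. if i = a then x else y), farr = (\<lambda>i. Id C (if i = a then x else y))\<rparr>"
  by (rule cat_functor.intro[OF category_two category_axioms])
    (use assms in \<open>auto simp: cat_functor_axioms_def\<close>)

subsection \<open>Sequences\<close>

text \<open>The poset of natural numbers, with the arrow \<open>m \<rightarrow> n\<close> coded by the pair \<open>(m, n)\<close>.\<close>

definition omega_arr :: "(nat \<Rightarrow> 'u) \<Rightarrow> nat \<Rightarrow> nat \<Rightarrow> 'u" where
  "omega_arr e m n = e (prod_encode (m, n))"

text \<open>Small diagrams range over categories whose objects and arrows lie in the universe type,
  so the poset is copied there along \<open>e\<close>. Sources and targets are decoded with
  \<open>inv e\<close>, which is meaningful for injective \<open>e\<close>.\<close>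

definition omega_cat :: "(nat \<Rightarrow> 'u) \<Rightarrow> ('u, 'u) category" where
  "omega_cat e =
    (let src = (\<lambda>u. fst (prod_decode (inv e u))); tgt = (\<lambda>u. snd (prod_decode (inv e u))) in
     \<lparr>Obj = range e, Arr = {omega_arr e m n |m n. m \<le> n}, Dom = (\<lambda>u. e (src u)), Cod = (\<lambda>u. e (tgt u)),
      Id = (\<lambda>u. omega_arr e (inv e u) (inv e u)), Comp = (\<lambda>v u. omega_arr e (src u) (tgt v))\<rparr>)"

lemma omega_cat_simps:
  assumes "inj e"
  shows "Obj (omega_cat e) = range e" "Arr (omega_cat e) = {omega_arr e m n |m n. m \<le> n}"
    "Dom (omega_cat e) (omega_arr e m n) = e m" "Cod (omega_cat e) (omega_arr e m n) = e n"
    "Id (omega_cat e) (e n) = omega_arr e n n"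
    "omega_arr e k l \<odot>\<^bsub>omega_cat e\<^esub> omega_arr e m n = omega_arr e m l"
    "omega_arr e k l = omega_arr e m n \<longleftrightarrow> k = m \<and> l = n"
    "e m = e n \<longleftrightarrow> m = n"
  using assms by (simp_all add: omega_cat_def omega_arr_def inj_eq)

lemma category_omega:
  assumes "inj e"
  shows "category (omega_cat e)"
  by unfold_locales (use assms in \<open>auto simp: omega_cat_simps\<close>)

lemma small_omega_cat:
  assumes "uncountable (UNIV :: 'u set)" "inj (e :: nat \<Rightarrow> 'u)"
  shows "small_category (omega_cat e)"
proof -
  have "{omega_arr e m n |m n. m \<le> n} \<subseteq> range e"
    by (auto simp: omega_arr_def)
  then have "countable {omega_arr e m n |m n. m \<le> n}"
    using countable_subset by blast
  then show ?thesis
    using assms by (simp add: small_category_def category_omega small_def omega_cat_simps countable_lesspoll)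
qed

lemma filtered_omega_cat:
  assumes "inj e"
  shows "filtered (omega_cat e)"
proof -
  note [simp] = omega_cat_simps[OF assms]
  show ?thesis
    unfolding filtered_def
  proof (intro conjI ballI)
    fix x y
    assume "x \<in> Obj (omega_cat e)" "y \<in> Obj (omega_cat e)"
    then obtain m n where xy: "x = e m" "y = e n"
      by auto
    have "omega_arr e m (max m n) \<in> hom (omega_cat e) x (e (max m n))"
      "omega_arr e n (max m n) \<in> hom (omega_cat e) y (e (max m n))"
      using xy by auto
    moreover have "e (max m n) \<in> Obj (omega_cat e)"
      by simp
    ultimately show "\<exists>z\<in>Obj (omega_cat e). hom (omega_cat e) x z \<noteq> {} \<and> hom (omega_cat e) y z \<noteq> {}"
      by blast
  next
    fix x y f g
    assume y: "y \<in> Obj (omega_cat e)" and fg: "f \<in> hom (omega_cat e) x y" "g \<in> hom (omega_cat e) x y"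
    have "f = g"
      using fg by auto
    moreover have "Id (omega_cat e) y \<in> hom (omega_cat e) y y"
      using y category.Id_in_hom[OF category_omega[OF assms]] by auto
    ultimately show "\<exists>z\<in>Obj (omega_cat e). \<exists>h\<in>hom (omega_cat e) y z.
        h \<odot>\<^bsub>omega_cat e\<^esub> f = h \<odot>\<^bsub>omega_cat e\<^esub> g"
      using y by blast
  qed simp
qed

lemma diagram_chain:
  assumes e: "inj e" and E: "cat_functor (omega_cat e) C E"
  shows "chain C (\<lambda>n. fobj E (e n)) (\<lambda>n. farr E (omega_arr e n (Suc n)))"
    and "chain_map C (\<lambda>n. fobj E (e n)) (\<lambda>n. farr E (omega_arr e n (Suc n))) m k
      = farr E (omega_arr e m (m + k))"
proof -
  interpret E: cat_functor "omega_cat e" C E by fact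
  note [simp] = omega_cat_simps[OF e]
  have a: "omega_arr e m (m + k) \<in> Arr (omega_cat e)" for m k
    using le_add1[of m k] by (simp only: omega_cat_simps(2)[OF e]) blast
  have a1: "omega_arr e m (Suc m) \<in> Arr (omega_cat e)" for m
    using a[of m 1] by simp
  show ch: "chain C (\<lambda>n. fobj E (e n)) (\<lambda>n. farr E (omega_arr e n (Suc n)))"
    using a1 E.farr_arr by (auto simp: chain_def simp del: omega_cat_simps(2))
  show "chain_map C (\<lambda>n. fobj E (e n)) (\<lambda>n. farr E (omega_arr e n (Suc n))) m k
      = farr E (omega_arr e m (m + k))"
  proof (induction k)
    case 0
    show ?case
      using E.farr_Id[of "e m"] by simp
  next
    case (Suc k)
    show ?case
      using E.farr_Comp'[OF a a1, of "m + k" m k] by (simp add: Suc)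
  qed
qed

lemma is_colimit_omega:
  assumes e: "inj e" and E: "cat_functor (omega_cat e) C E"
  shows "is_colimit C (omega_cat e) E L \<kappa> \<longleftrightarrow>
    chain_colimit C (\<lambda>n. fobj E (e n)) (\<lambda>n. farr E (omega_arr e n (Suc n))) L (\<lambda>n. \<kappa> (e n))"
proof -
  interpret E: cat_functor "omega_cat e" C E by fact
  note [simp] = omega_cat_simps[OF e]
  let ?X = "\<lambda>n. fobj E (e n)" and ?c = "\<lambda>n. farr E (omega_arr e n (Suc n))"
  have ch: "chain C ?X ?c"
    by (rule diagram_chain[OF assms])
  have cc: "cocone C (omega_cat e) E L \<kappa> \<longleftrightarrow> chain_cocone C ?X ?c L (\<lambda>n. \<kappa> (e n))" for L \<kappa>
  proof
    assume "cocone C (omega_cat e) E L \<kappa>"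
    then have *: "\<And>n. \<kappa> (e n) \<in> hom C (?X n) L"
      "\<And>u. u \<in> Arr (omega_cat e) \<Longrightarrow> \<kappa> (Cod (omega_cat e) u) \<odot>\<^bsub>C\<^esub> farr E u = \<kappa> (Dom (omega_cat e) u)"
      by (auto simp: cocone_def)
    have "omega_arr e n (Suc n) \<in> Arr (omega_cat e)" for n
      by (auto intro!: exI)
    from *(2)[OF this] show "chain_cocone C ?X ?c L (\<lambda>n. \<kappa> (e n))"
      using *(1) by (auto simp: chain_cocone_def)
  next
    assume *: "chain_cocone C ?X ?c L (\<lambda>n. \<kappa> (e n))"
    \<comment> \<open>The arrow from m to n is the composite of n - m successive steps, so
      compatibility with single steps propagates to it.\<close>
    have "\<kappa> (e n) \<odot>\<^bsub>C\<^esub> farr E (omega_arr e m n) = \<kappa> (e m)" if "m \<le> n" for m n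
      using E.cod.chain_cocone_map[OF ch *, of m "n - m"] diagram_chain(2)[OF assms, of m "n - m"] that
      by simp
    moreover have "L \<in> Obj C"
      using chain_coconeD[OF *, of 0] E.cod.Obj_arr(2) by metis
    ultimately show "cocone C (omega_cat e) E L \<kappa>"
      using chain_coconeD[OF *] E by (auto simp: cocone_def)
  qed
  \<comment> \<open>Cocones are indexed by the universe type, sequences by natural numbers;
    composing with \<open>inv e\<close> extends any sequence to the whole type.\<close>
  have all: "(\<forall>\<mu>. P (\<lambda>n. \<mu> (e n))) \<longleftrightarrow> (\<forall>g. P g)" for P :: "_ \<Rightarrow> bool"
  proof
    show "\<forall>g. P g" if "\<forall>\<mu>. P (\<lambda>n. \<mu> (e n))"
      using that[rule_format, of "\<lambda>i. _ (inv e i)"] e by simp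
  qed auto
  have "is_colimit C (omega_cat e) E L \<kappa> \<longleftrightarrow> chain_cocone C ?X ?c L (\<lambda>n. \<kappa> (e n)) \<and>
     (\<forall>Z. \<forall>\<mu>. chain_cocone C ?X ?c Z (\<lambda>n. \<mu> (e n)) \<longrightarrow>
        (\<exists>!h. h \<in> hom C L Z \<and> (\<forall>n. h \<odot>\<^bsub>C\<^esub> \<kappa> (e n) = \<mu> (e n))))"
    unfolding is_colimit_def cc by simp
  also have "\<dots> \<longleftrightarrow> chain_colimit C ?X ?c L (\<lambda>n. \<kappa> (e n))"
    unfolding chain_colimit_def
    using ch all[of "\<lambda>g. chain_cocone C ?X ?c _ g \<longrightarrow>
        (\<exists>!h. h \<in> hom C L _ \<and> (\<forall>n. h \<odot>\<^bsub>C\<^esub> \<kappa> (e n) = g n))"] by simp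
  finally show ?thesis .
qed

definition sequence_functor ::
  "('o, 'a) category \<Rightarrow> (nat \<Rightarrow> 'u) \<Rightarrow> (nat \<Rightarrow> 'o) \<Rightarrow> (nat \<Rightarrow> 'a) \<Rightarrow> ('u, 'u, 'o, 'a) cat_functor" where
  "sequence_functor C e X c = \<lparr>fobj = (\<lambda>u. X (inv e u)),
     farr = (\<lambda>u. let (m, n) = prod_decode (inv e u) in chain_map C X c m (n - m))\<rparr>"

lemma sequence_functor_simps:
  assumes "inj e"
  shows "fobj (sequence_functor C e X c) (e n) = X n"
    "farr (sequence_functor C e X c) (omega_arr e m n) = chain_map C X c m (n - m)"
  using assms by (simp_all add: sequence_functor_def omega_arr_def)

lemma (in category) cat_functor_sequence:
  assumes e: "inj e" and ch: "chain C X c"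
  shows "cat_functor (omega_cat e) C (sequence_functor C e X c)"
proof (rule cat_functor.intro[OF category_omega[OF e] category_axioms], unfold_locales)
  note [simp] = omega_cat_simps[OF e] sequence_functor_simps[OF e] chain_map_arr[OF ch] chain_Obj[OF ch]
  let ?E = "sequence_functor C e X c"
  show "fobj ?E x \<in> Obj C" if "x \<in> Obj (omega_cat e)" for x
    using that by auto
  show "farr ?E f \<in> hom C (fobj ?E x) (fobj ?E y)" if "f \<in> hom (omega_cat e) x y" for f x y
    using that by auto
  show "farr ?E (Id (omega_cat e) x) = Id C (fobj ?E x)" if "x \<in> Obj (omega_cat e)" for x
    using that by auto
  show "farr ?E (g \<odot>\<^bsub>omega_cat e\<^esub> f) = farr ?E g \<odot> farr ?E f"
    if f: "f \<in> hom (omega_cat e) x y" and g: "g \<in> hom (omega_cat e) y z" for f g x y z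
  proof -
    obtain m n l where "f = omega_arr e m n" "g = omega_arr e n l" "m \<le> n" "n \<le> l"
      using f g by auto
    then show ?thesis
      using chain_map_add[OF ch, of m "n - m" "l - n"] by simp
  qed
qed

lemma (in category) sequence_functor_step:
  assumes e: "inj e" and ch: "chain C X c"
  shows "farr (sequence_functor C e X c) (omega_arr e n (Suc n)) = c n"
  using chain_arr[OF ch] chain_Obj[OF ch] by (simp add: sequence_functor_simps[OF e] Suc_diff_le)

subsection \<open>Consequences of cocompleteness and of preservation of colimits\<close>

lemma infinite_inj:
  assumes "uncountable (UNIV :: 'u set)"
  obtains e :: "nat \<Rightarrow> 'u" where "inj e"
  using assms uncountable_infinite infinite_countable_subset by blast

lemma cocomplete_initial:
  assumes "cocomplete U C"
  shows "\<exists>z. initial C z"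
  using assms small_empty_cat cat_functor_empty is_colimit_empty unfolding cocomplete_def by metis

lemma cocomplete_coproduct:
  assumes "uncountable (UNIV :: 'u set)" "cocomplete TYPE('u) C" "x \<in> Obj C" "y \<in> Obj C"
  shows "\<exists>p i j. is_coproduct C x y p i j"
proof -
  interpret category C
    using assms by (simp add: cocomplete_def)
  obtain e :: "nat \<Rightarrow> 'u" where e: "inj e"
    using infinite_inj[OF assms(1)] .
  then have ab: "e 0 \<noteq> e 1"
    by (simp add: inj_eq)
  let ?E = "\<lparr>fobj = (\<lambda>i. if i = e 0 then x else y), farr = (\<lambda>i. Id C (if i = e 0 then x else y))\<rparr>"
  have E: "cat_functor (two_cat (e 0) (e 1)) C ?E"
    by (rule cat_functor_two) fact+
  then obtain p \<kappa> where "is_colimit C (two_cat (e 0) (e 1)) ?E p \<kappa>"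
    using assms(2) small_two_cat[OF assms(1), of "e 0" "e 1"] unfolding cocomplete_def by blast
  then show ?thesis
    using is_colimit_two[OF ab E] ab by auto
qed

lemma cocomplete_chain_colimit:
  assumes "uncountable (UNIV :: 'u set)" "cocomplete TYPE('u) C" "chain C X c"
  shows "\<exists>L \<kappa>. chain_colimit C X c L \<kappa>"
proof -
  interpret category C
    using assms by (simp add: cocomplete_def)
  obtain e :: "nat \<Rightarrow> 'u" where e: "inj e"
    using infinite_inj[OF assms(1)] .
  have E: "cat_functor (omega_cat e) C (sequence_functor C e X c)"
    by (rule cat_functor_sequence) fact+
  then obtain L \<kappa> where "is_colimit C (omega_cat e) (sequence_functor C e X c) L \<kappa>"
    using assms(2) small_omega_cat[OF assms(1) e] unfolding cocomplete_def by blast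
  then show ?thesis
    using is_colimit_omega[OF e E] sequence_functor_step[OF e assms(3)]
    by (auto simp: sequence_functor_simps[OF e])
qed

lemma preserves_chain_colimitsI:
  assumes F: "cat_functor C D F" and e: "inj e"
    and P: "\<And>E. cat_functor (omega_cat e) C E \<Longrightarrow> preserves_colimit C D F (omega_cat e) E"
  shows "preserves_chain_colimits C D F"
  unfolding preserves_chain_colimits_def
proof (intro allI impI)
  fix X c L \<kappa>
  assume K: "chain_colimit C X c L \<kappa>"
  interpret F: cat_functor C D F by fact
  have ch: "chain C X c"
    using K by (simp add: chain_colimit_def)
  let ?E = "sequence_functor C e X c"
  have E: "cat_functor (omega_cat e) C ?E"
    by (rule F.dom.cat_functor_sequence) fact+
  have FE: "cat_functor (omega_cat e) D (F \<circ>\<^sub>F ?E)"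
    by (rule cat_functor_comp) fact+
  have "is_colimit C (omega_cat e) ?E L (\<lambda>u. \<kappa> (inv e u))"
    using K e by (subst is_colimit_omega[OF e E])
      (simp add: sequence_functor_simps(1)[OF e] inv_f_f[OF e] F.dom.sequence_functor_step[OF e ch])
  then have "is_colimit D (omega_cat e) (F \<circ>\<^sub>F ?E) (fobj F L) (\<lambda>u. farr F (\<kappa> (inv e u)))"
    using P[OF E] unfolding preserves_colimit_def by blast
  then show "chain_colimit D (\<lambda>n. fobj F (X n)) (\<lambda>n. farr F (c n)) (fobj F L) (\<lambda>n. farr F (\<kappa> n))"
    using e by (subst (asm) is_colimit_omega[OF e FE])
      (simp add: sequence_functor_simps(1)[OF e] inv_f_f[OF e] F.dom.sequence_functor_step[OF e ch])
qed

lemma finitary_preserves_chain_colimits: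
  assumes "uncountable (UNIV :: 'u set)" "finitary TYPE('u) C D F"
  shows "preserves_chain_colimits C D F"
proof -
  obtain e :: "nat \<Rightarrow> 'u" where e: "inj e"
    using infinite_inj[OF assms(1)] .
  show ?thesis
    using assms e small_omega_cat[OF assms(1) e] filtered_omega_cat[OF e]
    by (intro preserves_chain_colimitsI[of C D F e]) (auto simp: finitary_def)
qed

lemma cocontinuous_preserves_chain_colimits:
  assumes "uncountable (UNIV :: 'u set)" "cocontinuous TYPE('u) C D F"
  shows "preserves_chain_colimits C D F"
proof -
  obtain e :: "nat \<Rightarrow> 'u" where e: "inj e"
    using infinite_inj[OF assms(1)] .
  show ?thesis
    using assms e small_omega_cat[OF assms(1) e]
    by (intro preserves_chain_colimitsI[of C D F e]) (auto simp: cocontinuous_def)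
qed

lemma cocontinuous_initial:
  assumes F: "cocontinuous TYPE('u) C D F" and z: "initial C z"
  shows "initial D (fobj F z)"
proof -
  interpret F: cat_functor C D F
    using F by (simp add: cocontinuous_def)
  \<comment> \<open>Any data form a functor out of the empty category, and any family of legs is a
    cocone over it, so both can be left unspecified.\<close>
  let ?E = "undefined :: ('u, 'u, 'a, 'b) cat_functor"
  have "is_colimit C empty_cat ?E z undefined"
    using z by (simp add: is_colimit_empty F.dom.category_axioms)
  moreover have "preserves_colimit C D F empty_cat ?E"
    using F small_empty_cat cat_functor_empty[OF F.dom.category_axioms]
    unfolding cocontinuous_def by blast
  ultimately have "is_colimit D empty_cat (F \<circ>\<^sub>F ?E) (fobj F z) (\<lambda>i. farr F (undefined i))"
    unfolding preserves_colimit_def by blast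
  then show ?thesis
    by (simp add: is_colimit_empty F.cod.category_axioms)
qed

lemma cocontinuous_coproduct:
  assumes "uncountable (UNIV :: 'u set)" and F: "cocontinuous TYPE('u) C D F"
    and p: "is_coproduct C x y p i j"
  shows "is_coproduct D (fobj F x) (fobj F y) (fobj F p) (farr F i) (farr F j)"
proof -
  interpret F: cat_functor C D F
    using F by (simp add: cocontinuous_def)
  obtain e :: "nat \<Rightarrow> 'u" where e: "inj e"
    using infinite_inj[OF assms(1)] .
  then have ab: "e 0 \<noteq> e 1"
    by (simp add: inj_eq)
  let ?J = "two_cat (e 0) (e 1)"
  let ?E = "\<lparr>fobj = (\<lambda>i. if i = e 0 then x else y), farr = (\<lambda>i. Id C (if i = e 0 then x else y))\<rparr>"
  let ?k = "\<lambda>u. if u = e 0 then i else j"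
  have xy: "x \<in> Obj C" "y \<in> Obj C"
    using p F.dom.hom_Obj unfolding is_coproduct_def by blast+
  have E: "cat_functor ?J C ?E"
    by (rule F.dom.cat_functor_two) fact+
  have FE: "cat_functor ?J D (F \<circ>\<^sub>F ?E)"
    by (rule cat_functor_comp[OF E F.cat_functor_axioms])
  have "is_colimit C ?J ?E p ?k"
    using p ab by (simp add: is_colimit_two[OF ab E] del: One_nat_def)
  moreover have "preserves_colimit C D F ?J ?E"
    using F small_two_cat[OF assms(1)] E unfolding cocontinuous_def by blast
  ultimately have "is_colimit D ?J (F \<circ>\<^sub>F ?E) (fobj F p) (\<lambda>u. farr F (?k u))"
    unfolding preserves_colimit_def by blast
  then show ?thesis
    using ab by (simp add: is_colimit_two[OF ab FE] del: One_nat_def)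
qed


section \<open>Coproducts\<close>

lemma initial_ex1: "initial C z \<Longrightarrow> x \<in> Obj C \<Longrightarrow> \<exists>!f. f \<in> hom C z x"
  by (simp add: initial_def)

lemma (in category) initial_eqI:
  assumes "initial C z" "f \<in> Arr C" "g \<in> Arr C" "Dom C f = z" "Dom C g = z" "Cod C f = Cod C g"
  shows "f = g"
  using initial_ex1[OF assms(1), of "Cod C f"] assms by auto

locale omega_cocomplete = category C for C :: "('o, 'a) category" (structure) +
  assumes ex_initial: "\<exists>z. initial C z"
    and ex_coproduct: "x \<in> Obj C \<Longrightarrow> y \<in> Obj C \<Longrightarrow> \<exists>p i j. is_coproduct C x y p i j"
    and ex_chain_colimit: "chain C X c \<Longrightarrow> \<exists>L \<kappa>. chain_colimit C X c L \<kappa>"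
begin

lemma coproduct:
  assumes "x \<in> Obj C" "y \<in> Obj C"
  shows "is_coproduct C x y (coprod C x y) (inl C x y) (inr C x y)"
proof -
  have "\<exists>t. case t of (p, i, j) \<Rightarrow> is_coproduct C x y p i j"
    using ex_coproduct[OF assms] by auto
  then have "case coproduct C x y of (p, i, j) \<Rightarrow> is_coproduct C x y p i j"
    unfolding coproduct_def by (rule someI_ex)
  then show ?thesis
    by (simp add: coprod_def inl_def inr_def split: prod.splits)
qed

lemma coprod_arr_simps [simp]:
  assumes "x \<in> Obj C" "y \<in> Obj C"
  shows "coprod C x y \<in> Obj C"
    "inl C x y \<in> Arr C" "Dom C (inl C x y) = x" "Cod C (inl C x y) = coprod C x y"
    "inr C x y \<in> Arr C" "Dom C (inr C x y) = y" "Cod C (inr C x y) = coprod C x y"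
  using coproduct[OF assms] by (auto simp: is_coproduct_def)

lemma copair:
  assumes "f \<in> Arr C" "g \<in> Arr C" "Cod C f = Cod C g"
  shows "copair C f g \<in> hom C (coprod C (Dom C f) (Dom C g)) (Cod C f)"
    and "copair C f g \<odot> inl C (Dom C f) (Dom C g) = f"
    and "copair C f g \<odot> inr C (Dom C f) (Dom C g) = g"
proof -
  have "\<exists>!h. h \<in> hom C (coprod C (Dom C f) (Dom C g)) (Cod C f) \<and>
      h \<odot> inl C (Dom C f) (Dom C g) = f \<and> h \<odot> inr C (Dom C f) (Dom C g) = g"
    using coproduct[of "Dom C f" "Dom C g"] assms unfolding is_coproduct_def by simp
  from theI'[OF this] show "copair C f g \<in> hom C (coprod C (Dom C f) (Dom C g)) (Cod C f)"
    and "copair C f g \<odot> inl C (Dom C f) (Dom C g) = f"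
    and "copair C f g \<odot> inr C (Dom C f) (Dom C g) = g"
    unfolding copair_def by auto
qed

lemma copair_arr [simp]:
  assumes "f \<in> Arr C" "g \<in> Arr C" "Cod C f = Cod C g"
  shows "copair C f g \<in> Arr C" "Dom C (copair C f g) = coprod C (Dom C f) (Dom C g)"
    "Cod C (copair C f g) = Cod C g"
  using copair(1)[OF assms] assms by auto

lemma copair_in [simp]:
  assumes "f \<in> Arr C" "g \<in> Arr C" "Cod C f = Cod C g" "Dom C f = x" "Dom C g = y"
  shows "copair C f g \<odot> inl C x y = f" "copair C f g \<odot> inr C x y = g"
  using copair(2,3)[OF assms(1-3)] assms(4,5) by auto

lemma copair_in_comp [simp]:
  assumes "f \<in> Arr C" "g \<in> Arr C" "Cod C f = Cod C g" "Dom C f = x" "Dom C g = y" "k \<in> Arr C"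
  shows "Cod C k = x \<Longrightarrow> copair C f g \<odot> (inl C x y \<odot> k) = f \<odot> k"
    "Cod C k = y \<Longrightarrow> copair C f g \<odot> (inr C x y \<odot> k) = g \<odot> k"
  by (use assms in \<open>auto intro!: whisker copair_in\<close>)

text \<open>Stated for an arbitrary coproduct cocone, because \<Gamma>(-, Y) sends a chosen
  coproduct to some coproduct, which may differ from the chosen one.\<close>

lemma coproduct_eqI:
  assumes "is_coproduct C x y p i j"
    and "h \<in> Arr C" "k \<in> Arr C" "Dom C h = p" "Dom C k = p" "Cod C h = Cod C k"
    and "h \<odot> i = k \<odot> i" "h \<odot> j = k \<odot> j"
  shows "h = k"
proof -
  have ij: "i \<in> hom C x p" "j \<in> hom C y p"
    using assms(1) by (auto simp: is_coproduct_def)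
  then have k: "k \<odot> i \<in> hom C x (Cod C k)" "k \<odot> j \<in> hom C y (Cod C k)" "Cod C k \<in> Obj C"
    using assms(3,5) by auto
  then have "\<exists>!h. h \<in> hom C p (Cod C k) \<and> h \<odot> i = k \<odot> i \<and> h \<odot> j = k \<odot> j"
    using assms(1) unfolding is_coproduct_def by blast
  then show ?thesis
    using assms(2-) by auto
qed

lemma coprod_eqI:
  assumes "x \<in> Obj C" "y \<in> Obj C" "h \<in> Arr C" "k \<in> Arr C"
    and "Dom C h = coprod C x y" "Dom C k = coprod C x y" "Cod C h = Cod C k"
    and "h \<odot> inl C x y = k \<odot> inl C x y" "h \<odot> inr C x y = k \<odot> inr C x y"
  shows "h = k"
  using coproduct_eqI[OF coproduct[OF assms(1,2)]] assms by auto

lemma comp_copair: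
  assumes "f \<in> Arr C" "g \<in> Arr C" "Cod C f = Cod C g" "h \<in> Arr C" "Dom C h = Cod C g"
  shows "h \<odot> copair C f g = copair C (h \<odot> f) (h \<odot> g)"
  by (rule coprod_eqI[of "Dom C f" "Dom C g"]) (use assms in auto)

lemma copair_coprod_arr:
  assumes "f \<in> Arr C" "g \<in> Arr C" "Cod C f = Cod C g"
    and "f' \<in> Arr C" "g' \<in> Arr C" "Cod C f' = Dom C f" "Cod C g' = Dom C g"
  shows "copair C f g \<odot> coprod_arr C f' g' = copair C (f \<odot> f') (g \<odot> g')"
  unfolding coprod_arr_def
  by (rule coprod_eqI[of "Dom C f'" "Dom C g'"]) (use assms in \<open>auto simp: comp_copair\<close>)

lemma coprod_arr_arr [simp]:
  assumes "f \<in> Arr C" "g \<in> Arr C"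
  shows "coprod_arr C f g \<in> Arr C" "Dom C (coprod_arr C f g) = coprod C (Dom C f) (Dom C g)"
    "Cod C (coprod_arr C f g) = coprod C (Cod C f) (Cod C g)"
  using assms by (auto simp: coprod_arr_def)

lemma coprod_arr_in:
  assumes "f \<in> Arr C" "g \<in> Arr C" "Dom C f = x" "Dom C g = y"
  shows "coprod_arr C f g \<odot> inl C x y = inl C (Cod C f) (Cod C g) \<odot> f"
    "coprod_arr C f g \<odot> inr C x y = inr C (Cod C f) (Cod C g) \<odot> g"
  using assms by (auto simp: coprod_arr_def)

lemma copair3_arr [simp]:
  assumes "f \<in> Arr C" "g \<in> Arr C" "h \<in> Arr C" "Cod C f = Cod C h" "Cod C g = Cod C h"
  shows "copair3 C f g h \<in> Arr C" "Cod C (copair3 C f g h) = Cod C h"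
    "Dom C (copair3 C f g h) = coprod3 C (Dom C f) (Dom C g) (Dom C h)"
  using assms by (auto simp: copair3_def coprod3_def)

lemma coprod3_Obj [simp]: "x \<in> Obj C \<Longrightarrow> y \<in> Obj C \<Longrightarrow> z \<in> Obj C \<Longrightarrow> coprod3 C x y z \<in> Obj C"
  by (auto simp: coprod3_def)

lemma coprod3_arr_arr [simp]:
  assumes "f \<in> Arr C" "g \<in> Arr C" "h \<in> Arr C"
  shows "coprod3_arr C f g h \<in> Arr C"
    "Dom C (coprod3_arr C f g h) = coprod3 C (Dom C f) (Dom C g) (Dom C h)"
    "Cod C (coprod3_arr C f g h) = coprod3 C (Cod C f) (Cod C g) (Cod C h)"
  using assms by (auto simp: coprod3_arr_def coprod3_def)

lemma comp_copair3:
  assumes "f \<in> Arr C" "g \<in> Arr C" "h \<in> Arr C" "Cod C f = Cod C h" "Cod C g = Cod C h"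
    and "k \<in> Arr C" "Dom C k = Cod C h"
  shows "k \<odot> copair3 C f g h = copair3 C (k \<odot> f) (k \<odot> g) (k \<odot> h)"
  using assms by (simp add: copair3_def comp_copair)

lemma copair3_coprod3_arr:
  assumes "f \<in> Arr C" "g \<in> Arr C" "h \<in> Arr C" "Cod C f = Cod C h" "Cod C g = Cod C h"
    and "f' \<in> Arr C" "g' \<in> Arr C" "h' \<in> Arr C"
    and "Cod C f' = Dom C f" "Cod C g' = Dom C g" "Cod C h' = Dom C h"
  shows "copair3 C f g h \<odot> coprod3_arr C f' g' h' = copair3 C (f \<odot> f') (g \<odot> g') (h \<odot> h')"
  using assms by (simp add: copair3_def coprod3_arr_def copair_coprod_arr)

end

lemma cocomplete_omega_cocomplete:
  assumes "uncountable (UNIV :: 'u set)" "cocomplete TYPE('u) C"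
  shows "omega_cocomplete C"
proof -
  interpret category C
    using assms by (simp add: cocomplete_def)
  show ?thesis
    by unfold_locales
      (blast intro: cocomplete_initial[OF assms(2)] cocomplete_coproduct[OF assms]
        cocomplete_chain_colimit[OF assms])+
qed

lemma (in category) chain_colimit_iso:
  assumes K: "chain_colimit C X c L \<kappa>"
    and i: "i \<in> hom C L P" "j \<in> hom C P L" "j \<odot> i = Id C L" "i \<odot> j = Id C P"
  shows "chain_colimit C X c P (\<lambda>n. i \<odot> \<kappa> n)"
  unfolding chain_colimit_def
proof (intro conjI allI impI)
  note [simp] = chain_colimitD[OF K]
  have P: "P \<in> Obj C"
    using i by auto
  show "chain C X c"
    using K by (simp add: chain_colimit_def)
  show "chain_cocone C X c P (\<lambda>n. i \<odot> \<kappa> n)"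
    using i by (auto simp: chain_cocone_def)
  fix Z g
  assume "chain_cocone C X c Z g"
  then obtain h where h: "h \<in> hom C L Z" "\<And>n. h \<odot> \<kappa> n = g n"
    using chain_colimit_ex1[OF K] by blast
  show "\<exists>!h. h \<in> hom C P Z \<and> (\<forall>n. h \<odot> (i \<odot> \<kappa> n) = g n)"
  proof (rule ex1I[of _ "h \<odot> j"])
    have "j \<odot> (i \<odot> \<kappa> n) = \<kappa> n" for n
      using whisker[OF i(3), of "\<kappa> n"] i by simp
    then show "h \<odot> j \<in> hom C P Z \<and> (\<forall>n. (h \<odot> j) \<odot> (i \<odot> \<kappa> n) = g n)"
      using i h by simp
    fix k
    assume k: "k \<in> hom C P Z \<and> (\<forall>n. k \<odot> (i \<odot> \<kappa> n) = g n)"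
    have "k \<odot> i = h"
      by (rule chain_colimit_eqI[OF K, of _ Z]) (use k i h in auto)
    then have "(k \<odot> i) \<odot> j = h \<odot> j"
      by simp
    then show "k = h \<odot> j"
      using i k P by simp
  qed
qed


section \<open>Free algebras\<close>

definition free_algebra ::
  "('o, 'a) category \<Rightarrow> ('o, 'a) endofunctor \<Rightarrow> 'o \<Rightarrow> 'o \<Rightarrow> 'a \<Rightarrow> 'a \<Rightarrow> bool" where
  "free_algebra C F X P e s \<longleftrightarrow> e \<in> hom C X P \<and> s \<in> hom C (fobj F P) P \<and>
     (\<forall>A a f. a \<in> hom C (fobj F A) A \<and> f \<in> hom C X A \<longrightarrow>
        (\<exists>!h. h \<in> hom C P A \<and> h \<odot>\<^bsub>C\<^esub> e = f \<and> h \<odot>\<^bsub>C\<^esub> s = a \<odot>\<^bsub>C\<^esub> farr F h))"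

lemma free_algebra_arr:
  assumes "free_algebra C F X P e s"
  shows "e \<in> Arr C" "Dom C e = X" "Cod C e = P" "s \<in> Arr C" "Dom C s = fobj F P" "Cod C s = P"
  using assms by (auto simp: free_algebra_def)

lemma free_algebra_ex1:
  assumes "free_algebra C F X P e s" "a \<in> hom C (fobj F A) A" "f \<in> hom C X A"
  shows "\<exists>!h. h \<in> hom C P A \<and> h \<odot>\<^bsub>C\<^esub> e = f \<and> h \<odot>\<^bsub>C\<^esub> s = a \<odot>\<^bsub>C\<^esub> farr F h"
  using assms unfolding free_algebra_def by blast

lemma (in category) free_algebra_eqI:
  assumes "free_algebra C F X P e s" "a \<in> hom C (fobj F A) A"
    and "h \<in> hom C P A" "k \<in> hom C P A" "h \<odot> e = k \<odot> e"
    and "h \<odot> s = a \<odot> farr F h" "k \<odot> s = a \<odot> farr F k"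
  shows "h = k"
proof -
  have "k \<odot> e \<in> hom C X A"
    using assms(4) free_algebra_arr[OF assms(1)] by auto
  then show ?thesis
    using free_algebra_ex1[OF assms(1,2)] assms(3-) by blast
qed

lemma (in category) free_algebra_iso:
  assumes F: "cat_functor C C F" and P: "free_algebra C F X P e s"
    and i: "i \<in> hom C P Q" "j \<in> hom C Q P" "j \<odot> i = Id C P" "i \<odot> j = Id C Q"
    and t: "t \<in> hom C (fobj F Q) Q" "i \<odot> s = t \<odot> farr F i"
  shows "free_algebra C F X Q (i \<odot> e) t"
  unfolding free_algebra_def
proof (intro conjI allI impI)
  interpret F: cat_functor C C F by fact
  note [simp] = free_algebra_arr[OF P]
  have Obj [simp]: "P \<in> Obj C" "Q \<in> Obj C"
    using i by auto
  show "i \<odot> e \<in> hom C X Q"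
    using i by auto
  show "t \<in> hom C (fobj F Q) Q"
    by fact
  have FI: "farr F i \<odot> farr F j = Id C (fobj F Q)" "farr F j \<odot> farr F i = Id C (fobj F P)"
    using arg_cong[OF i(4), of "farr F"] arg_cong[OF i(3), of "farr F"] i(1,2) by simp_all
  \<comment> \<open>The inverse of an invertible algebra morphism is an algebra morphism.\<close>
  have t': "j \<odot> t = s \<odot> farr F j"
  proof -
    have "j \<odot> t = j \<odot> (t \<odot> (farr F i \<odot> farr F j))"
      using i(1,2) t(1) by (simp add: FI)
    also have "\<dots> = j \<odot> (i \<odot> (s \<odot> farr F j))"
      using i(1,2) t(1) whisker[OF t(2)[symmetric], of "farr F j"] by simp
    also have "\<dots> = s \<odot> farr F j"
      using i(1,2) whisker[OF i(3), of "s \<odot> farr F j"] by simp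
    finally show ?thesis .
  qed
  fix A a f
  assume af: "a \<in> hom C (fobj F A) A \<and> f \<in> hom C X A"
  then obtain h where h: "h \<in> hom C P A" "h \<odot> e = f" "h \<odot> s = a \<odot> farr F h"
    using free_algebra_ex1[OF P] by blast
  show "\<exists>!h. h \<in> hom C Q A \<and> h \<odot> (i \<odot> e) = f \<and> h \<odot> t = a \<odot> farr F h"
  proof (rule ex1I[of _ "h \<odot> j"])
    have "j \<odot> (i \<odot> e) = e"
      using whisker[OF i(3), of e] i by simp
    moreover have "h \<odot> (j \<odot> t) = a \<odot> (farr F h \<odot> farr F j)"
      using whisker[OF h(3), of "farr F j"] i h t af by (simp add: t')
    ultimately show "h \<odot> j \<in> hom C Q A \<and> (h \<odot> j) \<odot> (i \<odot> e) = f \<and> (h \<odot> j) \<odot> t = a \<odot> farr F (h \<odot> j)"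
      using i t h by simp
    fix k
    assume k: "k \<in> hom C Q A \<and> k \<odot> (i \<odot> e) = f \<and> k \<odot> t = a \<odot> farr F k"
    then have kt: "k \<odot> t = a \<odot> farr F k"
      by simp
    have "k \<odot> i = h"
    proof (rule free_algebra_eqI[OF P, of a A])
      have "(k \<odot> i) \<odot> s = (a \<odot> farr F k) \<odot> farr F i"
        using k i t h af whisker[OF kt, of "farr F i"] by simp
      then show "(k \<odot> i) \<odot> s = a \<odot> farr F (k \<odot> i)"
        using k i af by simp
    qed (use k i h af in auto)
    then have "(k \<odot> i) \<odot> j = h \<odot> j"
      by simp
    then show "k = h \<odot> j"
      using i k by simp
  qed
qed

subsection \<open>The initial sequence\<close>

text \<open>The initial-algebra sequence of the functor sending Z to X + FZ: it starts at an initial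
  object and continues with X + F0, X + F(X + F0), and so on. An algebra for that functor is an
  F-algebra A together with an arrow X \<rightarrow> A.\<close>

primrec iter_obj :: "('o, 'a) category \<Rightarrow> ('o, 'a) endofunctor \<Rightarrow> 'o \<Rightarrow> nat \<Rightarrow> 'o" where
  "iter_obj C F X 0 = (SOME z. initial C z)"
| "iter_obj C F X (Suc n) = coprod C X (fobj F (iter_obj C F X n))"

primrec iter_map :: "('o, 'a) category \<Rightarrow> ('o, 'a) endofunctor \<Rightarrow> 'o \<Rightarrow> nat \<Rightarrow> 'a" where
  "iter_map C F X 0 = (SOME f. f \<in> hom C (iter_obj C F X 0) (iter_obj C F X 1))"
| "iter_map C F X (Suc n) = coprod_arr C (Id C X) (farr F (iter_map C F X n))"

locale omega_functor = omega_cocomplete C + cat_functor C C F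
  for C :: "('o, 'a) category" (structure) and F +
  assumes preserves: "preserves_chain_colimits C C F"
begin

lemma preserves_chain:
  "chain_colimit C X c L \<kappa> \<Longrightarrow>
    chain_colimit C (\<lambda>n. fobj F (X n)) (\<lambda>n. farr F (c n)) (fobj F L) (\<lambda>n. farr F (\<kappa> n))"
  using preserves by (simp add: preserves_chain_colimits_def)

lemma iter_initial: "initial C (iter_obj C F X 0)"
  using someI_ex[OF ex_initial] by simp

lemma iter_obj_Obj [simp]:
  assumes "X \<in> Obj C"
  shows "iter_obj C F X n \<in> Obj C"
proof (induction n)
  case 0
  show ?case
    using iter_initial[of X] by (simp add: initial_def)
next
  case (Suc n)
  then show ?case
    using assms by simp
qed

lemma iter_map_arr:
  assumes "X \<in> Obj C"
  shows "iter_map C F X n \<in> hom C (iter_obj C F X n) (iter_obj C F X (Suc n))"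
proof (induction n)
  case 0
  have "\<exists>f. f \<in> hom C (iter_obj C F X 0) (iter_obj C F X 1)"
    using initial_ex1[OF iter_initial iter_obj_Obj[OF assms]] by blast
  then show ?case
    by (simp only: iter_map.simps One_nat_def) (rule someI_ex)
next
  case (Suc n)
  then show ?case
    using assms by simp
qed

lemma iter_chain: "X \<in> Obj C \<Longrightarrow> chain C (iter_obj C F X) (iter_map C F X)"
  using iter_map_arr by (simp add: chain_def)

context
  fixes X L \<kappa>
  assumes X: "X \<in> Obj C" and K: "chain_colimit C (iter_obj C F X) (iter_map C F X) L \<kappa>"
begin

lemma iter_arr:
  "iter_map C F X n \<in> Arr C" "Dom C (iter_map C F X n) = iter_obj C F X n"
  "Cod C (iter_map C F X n) = coprod C X (fobj F (iter_obj C F X n))"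
  "\<kappa> n \<in> Arr C" "Dom C (\<kappa> n) = iter_obj C F X n" "Cod C (\<kappa> n) = L" "L \<in> Obj C"
  "X \<in> Obj C" "iter_obj C F X n \<in> Obj C"
  using chain_colimitD[OF K, of n] chain_colimit_Obj[OF K] X by auto

text \<open>Stage n + 1 is a coproduct of X and F of stage n, so each leg splits in two. The left
  parts agree for all n, as the connecting arrows are the identity on X, and give \<open>e\<close>.
  The right parts form a cocone on the image sequence, whose colimit is FL, and give
  \<open>s\<close>.\<close>

lemma iter_colimit_structure:
  obtains e s where "e \<in> hom C X L" "s \<in> hom C (fobj F L) L"
    "\<And>n. \<kappa> (Suc n) = copair C e (s \<odot> farr F (\<kappa> n))"
proof -
  note [simp] = iter_arr and [simp del] = iter_map.simps iter_obj.simps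
  note [simp] = iter_obj.simps(2)
  let ?i = "\<lambda>n. inl C X (fobj F (iter_obj C F X n))" and ?j = "\<lambda>n. inr C X (fobj F (iter_obj C F X n))"
  have ij: "iter_map C F X (Suc n) \<odot> ?i n = ?i (Suc n)"
    "iter_map C F X (Suc n) \<odot> ?j n = ?j (Suc n) \<odot> farr F (iter_map C F X n)" for n
    by (simp_all add: iter_map.simps(2) coprod_arr_in)
  have \<kappa>: "\<kappa> (Suc n) \<odot> iter_map C F X n = \<kappa> n" for n
    by (rule chain_colimitD[OF K])
  have "chain_cocone C (\<lambda>n. fobj F (iter_obj C F X n)) (\<lambda>n. farr F (iter_map C F X n)) L
      (\<lambda>n. \<kappa> (Suc n) \<odot> ?j n)"
    unfolding chain_cocone_def
  proof (intro allI conjI)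
    fix n
    have "(\<kappa> (Suc (Suc n)) \<odot> ?j (Suc n)) \<odot> farr F (iter_map C F X n)
        = \<kappa> (Suc (Suc n)) \<odot> (iter_map C F X (Suc n) \<odot> ?j n)"
      by (simp add: ij)
    also have "\<dots> = \<kappa> (Suc n) \<odot> ?j n"
      using whisker[OF \<kappa>, of "Suc n" "?j n"] by simp
    finally show "(\<kappa> (Suc (Suc n)) \<odot> ?j (Suc n)) \<odot> farr F (iter_map C F X n) = \<kappa> (Suc n) \<odot> ?j n" .
  qed simp
  then obtain s where s: "s \<in> hom C (fobj F L) L" "\<And>n. s \<odot> farr F (\<kappa> n) = \<kappa> (Suc n) \<odot> ?j n"
    using chain_colimit_ex1[OF preserves_chain[OF K]] by blast
  have e: "\<kappa> (Suc n) \<odot> ?i n = \<kappa> (Suc 0) \<odot> ?i 0" for n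
  proof (induction n)
    case (Suc n)
    have "\<kappa> (Suc (Suc n)) \<odot> ?i (Suc n) = \<kappa> (Suc (Suc n)) \<odot> (iter_map C F X (Suc n) \<odot> ?i n)"
      by (simp add: ij)
    also have "\<dots> = \<kappa> (Suc n) \<odot> ?i n"
      using whisker[OF \<kappa>, of "Suc n" "?i n"] by simp
    finally show ?case
      using Suc by simp
  qed simp
  show thesis
  proof (rule that[of "\<kappa> (Suc 0) \<odot> ?i 0" s])
    show "\<kappa> (Suc n) = copair C (\<kappa> (Suc 0) \<odot> ?i 0) (s \<odot> farr F (\<kappa> n))" for n
      by (rule coprod_eqI[of X "fobj F (iter_obj C F X n)"]) (use s e[of n] in auto)
  qed (use s in auto)
qed

text \<open>Restricted to stage n + 1, the two equations for an algebra morphism say that its leg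
  there is the copairing of f with a after F of the leg at n. The legs are thus forced, starting
  from the initial object, and they do form a cocone.\<close>

lemma iter_colimit_free:
  assumes e: "e \<in> hom C X L" and s: "s \<in> hom C (fobj F L) L"
    and \<kappa>Suc: "\<And>n. \<kappa> (Suc n) = copair C e (s \<odot> farr F (\<kappa> n))"
  shows "free_algebra C F X L e s"
  unfolding free_algebra_def
proof (intro conjI allI impI)
  note [simp] = iter_arr and [simp del] = iter_map.simps iter_obj.simps
  note [simp] = iter_obj.simps(2)
  show "e \<in> hom C X L" "s \<in> hom C (fobj F L) L"
    by fact+
  fix A a f
  assume af: "a \<in> hom C (fobj F A) A \<and> f \<in> hom C X A"
  then have A [simp]: "A \<in> Obj C"
    by auto
  obtain u where u: "u \<in> hom C (iter_obj C F X 0) A"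
    using initial_ex1[OF iter_initial A] by blast
  define g where "g = rec_nat u (\<lambda>n gn. copair C f (a \<odot> farr F gn))"
  have g0: "g 0 = u" and gSuc: "g (Suc n) = copair C f (a \<odot> farr F (g n))" for n
    by (simp_all add: g_def)
  have g [simp]: "g n \<in> Arr C" "Dom C (g n) = iter_obj C F X n" "Cod C (g n) = A" for n
    by (induction n) (use u af in \<open>auto simp: g0 gSuc\<close>)
  have gc: "g (Suc n) \<odot> iter_map C F X n = g n" for n
  proof (induction n)
    case 0
    show ?case
      by (rule initial_eqI[OF iter_initial[of X]]) auto
  next
    case (Suc n)
    have "farr F (g (Suc n)) \<odot> farr F (iter_map C F X n) = farr F (g n)"
      using arg_cong[OF Suc, of "farr F"] by simp
    then show ?case
      using af by (simp add: gSuc[of "Suc n"] gSuc[of n] iter_map.simps(2) copair_coprod_arr)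
  qed
  have "chain_cocone C (iter_obj C F X) (iter_map C F X) A g"
    using gc by (simp add: chain_cocone_def)
  then obtain h where h: "h \<in> hom C L A" "\<And>n. h \<odot> \<kappa> n = g n"
    using chain_colimit_ex1[OF K] by blast
  have hg: "copair C (h \<odot> e) (h \<odot> (s \<odot> farr F (\<kappa> n))) = copair C f (a \<odot> farr F (g n))" for n
    using h(2)[of "Suc n"] h(1) e s by (simp add: gSuc \<kappa>Suc comp_copair)
  have eq: "p = f \<and> q = r" if "copair C p q = copair C f r"
    "p \<in> Arr C" "q \<in> Arr C" "r \<in> Arr C" "Dom C p = X" "Dom C q = Dom C r" "Cod C p = A" "Cod C q = A" "Cod C r = A" for p q r
  proof
    have "copair C p q \<odot> inl C X (Dom C r) = copair C f r \<odot> inl C X (Dom C r)"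
      "copair C p q \<odot> inr C X (Dom C r) = copair C f r \<odot> inr C X (Dom C r)"
      by (simp_all add: that(1))
    then show "p = f" "q = r"
      using that(2-) af by simp_all
  qed
  show "\<exists>!h. h \<in> hom C L A \<and> h \<odot> e = f \<and> h \<odot> s = a \<odot> farr F h"
  proof (rule ex1I[of _ h])
    have "h \<odot> e = f"
      using eq[OF hg[of 0]] h(1) e s af by simp
    \<comment> \<open>As F preserves the colimit, the equation can be tested on the stages of
      FL.\<close>
    moreover have "h \<odot> s = a \<odot> farr F h"
    proof (rule chain_colimit_eqI[OF preserves_chain[OF K]])
      fix n
      have "farr F h \<odot> farr F (\<kappa> n) = farr F (g n)"
        using arg_cong[OF h(2)[of n], of "farr F"] h(1) by simp
      then show "(h \<odot> s) \<odot> farr F (\<kappa> n) = (a \<odot> farr F h) \<odot> farr F (\<kappa> n)"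
        using eq[OF hg[of n]] h(1) e s af by simp
    qed (use h s af in auto)
    ultimately show "h \<in> hom C L A \<and> h \<odot> e = f \<and> h \<odot> s = a \<odot> farr F h"
      using h by simp
    fix k
    assume k: "k \<in> hom C L A \<and> k \<odot> e = f \<and> k \<odot> s = a \<odot> farr F k"
    then have ks: "k \<odot> s = a \<odot> farr F k"
      by simp
    have "k \<odot> \<kappa> n = g n" for n
    proof (induction n)
      case 0
      show ?case
        by (rule initial_eqI[OF iter_initial[of X]]) (use k in auto)
    next
      case (Suc n)
      have "k \<odot> (s \<odot> farr F (\<kappa> n)) = a \<odot> (farr F k \<odot> farr F (\<kappa> n))"
        using whisker[OF ks, of "farr F (\<kappa> n)"] k s af by simp
      then show ?case
        using arg_cong[OF Suc, of "farr F"] k e s by (simp add: gSuc \<kappa>Suc comp_copair)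
    qed
    then show "k = h"
      by (intro chain_colimit_eqI[OF K, of k A h]) (use k h in auto)
  qed
qed

end

lemma free_algebra_ex:
  assumes "X \<in> Obj C"
  shows "\<exists>P e s. free_algebra C F X P e s"
proof -
  obtain L \<kappa> where "chain_colimit C (iter_obj C F X) (iter_map C F X) L \<kappa>"
    using ex_chain_colimit[OF iter_chain[OF assms]] by blast
  then show ?thesis
    using iter_colimit_structure[OF assms] iter_colimit_free[OF assms] by metis
qed

text \<open>This covers a free algebra known only through its universal property: the colimit of the
  initial sequence is another one, and its legs are carried over along the unique isomorphism. The
  recursion over SB below relies on the explicit form of the legs.\<close>

lemma free_algebra_colimit:
  assumes P: "free_algebra C F X P e s"
  obtains \<kappa> where "chain_colimit C (iter_obj C F X) (iter_map C F X) P \<kappa>"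
    "\<And>n. \<kappa> (Suc n) = copair C e (s \<odot> farr F (\<kappa> n))"
proof -
  note [simp] = free_algebra_arr[OF P]
  have PX [simp]: "X \<in> Obj C" "P \<in> Obj C"
    using hom_Obj[of e X P] by auto
  obtain L \<kappa> where K: "chain_colimit C (iter_obj C F X) (iter_map C F X) L \<kappa>"
    using ex_chain_colimit[OF iter_chain[OF PX(1)]] by blast
  obtain e' s' where e': "e' \<in> hom C X L" "s' \<in> hom C (fobj F L) L"
    "\<And>n. \<kappa> (Suc n) = copair C e' (s' \<odot> farr F (\<kappa> n))"
    using iter_colimit_structure[OF PX(1) K] by metis
  have L: "free_algebra C F X L e' s'"
    by (rule iter_colimit_free[OF PX(1) K]) fact+
  obtain i where i: "i \<in> hom C L P" "i \<odot> e' = e" "i \<odot> s' = s \<odot> farr F i"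
    using free_algebra_ex1[OF L, of s P e] by auto
  obtain j where j: "j \<in> hom C P L" "j \<odot> e = e'" "j \<odot> s = s' \<odot> farr F j"
    using free_algebra_ex1[OF P, of s' L e'] e' by auto
  have Lo [simp]: "L \<in> Obj C"
    by (rule chain_colimit_Obj[OF K])
  have "j \<odot> i = Id C L"
  proof (rule free_algebra_eqI[OF L e'(2)])
    show "(j \<odot> i) \<odot> s' = s' \<odot> farr F (j \<odot> i)"
      using i(1) j(1) e'(2) i(3) whisker[OF j(3), of "farr F i"] by simp
  qed (use i j e' in auto)
  moreover have "i \<odot> j = Id C P"
  proof (rule free_algebra_eqI[OF P])
    show "(i \<odot> j) \<odot> s = s \<odot> farr F (i \<odot> j)"
      using i(1) j(1) e'(2) j(3) whisker[OF i(3), of "farr F j"] by simp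
  qed (use i j e' in auto)
  ultimately have "chain_colimit C (iter_obj C F X) (iter_map C F X) P (\<lambda>n. i \<odot> \<kappa> n)"
    using chain_colimit_iso[OF K] i j by blast
  moreover have "i \<odot> \<kappa> (Suc n) = copair C e (s \<odot> farr F (i \<odot> \<kappa> n))" for n
    using i(1,2) e' chain_colimitD[OF K, of n] whisker[OF i(3), of "farr F (\<kappa> n)"]
    by (simp add: comp_copair)
  ultimately show thesis
    using that[of "\<lambda>n. i \<odot> \<kappa> n"] by blast
qed

end


section \<open>Monads\<close>

sublocale monad \<subseteq> fn: cat_functor C C "mfun M"
  using eta_nat by (simp add: nat_trans_def)

context monad
begin

lemma eta_arr [simp]:
  assumes "x \<in> Obj C"
  shows "eta M x \<in> Arr C" "Dom C (eta M x) = x" "Cod C (eta M x) = fobj (mfun M) x"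
  using nat_trans.component_arr[OF eta_nat assms] by simp_all

lemma mu_arr [simp]:
  assumes "x \<in> Obj C"
  shows "mu M x \<in> Arr C" "Dom C (mu M x) = fobj (mfun M) (fobj (mfun M) x)"
    "Cod C (mu M x) = fobj (mfun M) x"
  using nat_trans.component_arr[OF mu_nat assms] by simp_all

lemma eta_natural [simp]:
  assumes "f \<in> Arr C" "Dom C f = x"
  shows "farr (mfun M) f \<odot> eta M x = eta M (Cod C f) \<odot> f"
  using nat_trans.natural_Comp[OF eta_nat assms(1)] assms(2) by simp

lemma eta_natural' [simp]:
  assumes "f \<in> Arr C" "Dom C f = x" "k \<in> Arr C" "Cod C k = x"
  shows "farr (mfun M) f \<odot> (eta M x \<odot> k) = eta M (Cod C f) \<odot> (f \<odot> k)"
  using nat_trans.natural_Comp'[OF eta_nat assms(1), of "Cod C f" k] assms by simp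

lemma mu_natural:
  assumes "f \<in> Arr C" "Cod C f = y"
  shows "mu M y \<odot> farr (mfun M) (farr (mfun M) f) = farr (mfun M) f \<odot> mu M (Dom C f)"
  using nat_trans.natural_Comp[OF mu_nat assms] by simp

lemma mu_natural':
  assumes "f \<in> Arr C" "Cod C f = y" "k \<in> Arr C" "Cod C k = fobj (mfun M) (fobj (mfun M) (Dom C f))"
  shows "mu M y \<odot> (farr (mfun M) (farr (mfun M) f) \<odot> k) = farr (mfun M) f \<odot> (mu M (Dom C f) \<odot> k)"
  using nat_trans.natural_Comp'[OF mu_nat assms(1,2), of k] assms by simp

lemmas [simp] = mu_eta mu_map_eta

lemma mu_eta' [simp]:
  assumes "x \<in> Obj C" "k \<in> Arr C" "Cod C k = fobj (mfun M) x"
  shows "mu M x \<odot> (eta M (fobj (mfun M) x) \<odot> k) = k"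
    "mu M x \<odot> (farr (mfun M) (eta M x) \<odot> k) = k"
  using whisker[OF mu_eta[OF assms(1)], of k] whisker[OF mu_map_eta[OF assms(1)], of k] assms
  by simp_all

lemma mu_mu':
  assumes "x \<in> Obj C" "k \<in> Arr C" "Cod C k = fobj (mfun M) (fobj (mfun M) (fobj (mfun M) x))"
  shows "mu M x \<odot> (mu M (fobj (mfun M) x) \<odot> k) = mu M x \<odot> (farr (mfun M) (mu M x) \<odot> k)"
  using whisker[OF mu_mu[OF assms(1)], of k] assms by simp

lemma monad_morphism_id: "monad_morphism C M M (\<lambda>x. Id C (fobj (mfun M) x))"
  by unfold_locales (auto simp: mu_mu)

end

context monad_morphism
begin

lemma component_arr [simp]:
  assumes "x \<in> Obj C"
  shows "\<alpha> x \<in> Arr C" "Dom C (\<alpha> x) = fobj (mfun R) x" "Cod C (\<alpha> x) = fobj (mfun R') x"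
  using nat_trans.component_arr[OF natural assms] by simp_all

lemma natural_Comp:
  assumes "f \<in> Arr C" "Cod C f = y"
  shows "\<alpha> y \<odot> farr (mfun R) f = farr (mfun R') f \<odot> \<alpha> (Dom C f)"
  using nat_trans.natural_Comp[OF natural assms] by simp

lemma map_mu':
  assumes "x \<in> Obj C" "k \<in> Arr C" "Cod C k = fobj (mfun R) (fobj (mfun R) x)"
  shows "\<alpha> x \<odot> (mu R x \<odot> k) = mu R' x \<odot> (farr (mfun R') (\<alpha> x) \<odot> (\<alpha> (fobj (mfun R) x) \<odot> k))"
  using source.whisker[OF map_mu[OF assms(1)], of k] assms by simp

end

lemma monad_morphism_comp:
  assumes "monad_morphism C R R' \<alpha>" "monad_morphism C R' R'' \<beta>"
  shows "monad_morphism C R R'' (\<lambda>x. \<beta> x \<odot>\<^bsub>C\<^esub> \<alpha> x)"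
proof -
  interpret \<alpha>: monad_morphism C R R' \<alpha> by fact
  interpret \<beta>: monad_morphism C R' R'' \<beta> by fact
  have nat: "(\<beta> y \<odot>\<^bsub>C\<^esub> \<alpha> y) \<odot>\<^bsub>C\<^esub> farr (mfun R) f = farr (mfun R'') f \<odot>\<^bsub>C\<^esub> (\<beta> x \<odot>\<^bsub>C\<^esub> \<alpha> x)"
    if "f \<in> hom C x y" for f x y
  proof -
    have "(\<beta> y \<odot>\<^bsub>C\<^esub> \<alpha> y) \<odot>\<^bsub>C\<^esub> farr (mfun R) f = (\<beta> y \<odot>\<^bsub>C\<^esub> farr (mfun R') f) \<odot>\<^bsub>C\<^esub> \<alpha> x"
      using that by (auto simp: \<alpha>.natural_Comp)
    then show ?thesis
      using that by (auto simp: \<beta>.natural_Comp)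
  qed
  show ?thesis
  proof (unfold_locales)
    fix x
    assume x: "x \<in> Obj C"
    have 1: "\<alpha> x \<odot>\<^bsub>C\<^esub> eta R x = eta R' x" "\<beta> x \<odot>\<^bsub>C\<^esub> eta R' x = eta R'' x"
      by (rule \<alpha>.map_eta[OF x], rule \<beta>.map_eta[OF x])
    show "(\<beta> x \<odot>\<^bsub>C\<^esub> \<alpha> x) \<odot>\<^bsub>C\<^esub> eta R x = eta R'' x"
      using x by (simp add: 1)
    have 2: "\<beta> (fobj (mfun R') x) \<odot>\<^bsub>C\<^esub> (farr (mfun R') (\<alpha> x) \<odot>\<^bsub>C\<^esub> \<alpha> (fobj (mfun R) x))
       = farr (mfun R'') (\<alpha> x) \<odot>\<^bsub>C\<^esub> (\<beta> (fobj (mfun R) x) \<odot>\<^bsub>C\<^esub> \<alpha> (fobj (mfun R) x))"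
      using x \<alpha>.source.whisker[OF \<beta>.natural_Comp, of "\<alpha> x" "fobj (mfun R') x" "\<alpha> (fobj (mfun R) x)"] by simp
    show "(\<beta> x \<odot>\<^bsub>C\<^esub> \<alpha> x) \<odot>\<^bsub>C\<^esub> mu R x = mu R'' x \<odot>\<^bsub>C\<^esub> farr (mfun R'') (\<beta> x \<odot>\<^bsub>C\<^esub> \<alpha> x) \<odot>\<^bsub>C\<^esub>
        \<beta> (fobj (mfun R) x) \<odot>\<^bsub>C\<^esub> \<alpha> (fobj (mfun R) x)"
      using x by (simp add: \<alpha>.map_mu \<beta>.map_mu' 2)
  qed (use nat in auto)
qed


section \<open>Free monads are algebraically free\<close>

locale functor_to_monad = category C + F: cat_functor C C F + monad C M + \<iota>: nat_trans C C F "mfun M" \<iota>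
  for C :: "('o, 'a) category" (structure) and F M \<iota>
begin

text \<open>The F-algebra structure that a monad M receives from a transformation F \<rightarrow> M.
  When M is free on F, this turns out to be the free algebra on x with the unit as inclusion of
  generators.\<close>

definition act :: "'o \<Rightarrow> 'a" where
  "act x = mu M x \<odot> \<iota> (fobj (mfun M) x)"

lemma act_arr [simp]:
  assumes "x \<in> Obj C"
  shows "act x \<in> Arr C" "Dom C (act x) = fobj F (fobj (mfun M) x)" "Cod C (act x) = fobj (mfun M) x"
  using assms by (auto simp: act_def)

lemma act_natural:
  assumes "f \<in> Arr C" "Dom C f = x"
  shows "farr (mfun M) f \<odot> act x = act (Cod C f) \<odot> farr F (farr (mfun M) f)"
  using assms by (auto simp: act_def \<iota>.natural_Comp mu_natural')

lemma mu_act: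
  assumes "x \<in> Obj C"
  shows "mu M x \<odot> act (fobj (mfun M) x) = act x \<odot> farr F (mu M x)"
  using assms by (auto simp: act_def \<iota>.natural_Comp mu_mu')

lemma act_eta:
  assumes "x \<in> Obj C"
  shows "act x \<odot> farr F (eta M x) = \<iota> x"
  using assms by (auto simp: act_def \<iota>.natural_Comp)

lemmas act_natural' = whisker[OF act_natural]
lemmas mu_act' = whisker[OF mu_act]

end

locale free_algebras = category C + cat_functor C C F for C :: "('o, 'a) category" (structure) and F +
  fixes P :: "'o \<Rightarrow> 'o" and e s :: "'o \<Rightarrow> 'a"
  assumes free: "x \<in> Obj C \<Longrightarrow> free_algebra C F x (P x) (e x) (s x)"
begin

lemmas arr [simp] = free_algebra_arr[OF free]

lemma P_Obj [simp]: "x \<in> Obj C \<Longrightarrow> P x \<in> Obj C"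
  using Obj_arr(2)[of "e x"] by simp

definition ext :: "'o \<Rightarrow> 'o \<Rightarrow> 'a \<Rightarrow> 'a \<Rightarrow> 'a" where
  "ext x A a f = (THE h. h \<in> hom C (P x) A \<and> h \<odot> e x = f \<and> h \<odot> s x = a \<odot> farr F h)"

lemma ext:
  assumes "x \<in> Obj C" "a \<in> Arr C" "f \<in> Arr C" "Dom C f = x" "Cod C f = A" "Dom C a = fobj F A" "Cod C a = A"
  shows "ext x A a f \<in> Arr C" "Dom C (ext x A a f) = P x" "Cod C (ext x A a f) = A"
    "ext x A a f \<odot> e x = f" "ext x A a f \<odot> s x = a \<odot> farr F (ext x A a f)"
proof -
  have "\<exists>!h. h \<in> hom C (P x) A \<and> h \<odot> e x = f \<and> h \<odot> s x = a \<odot> farr F h"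
    using free_algebra_ex1[OF free, of x a A f] assms by simp
  from theI'[OF this] show "ext x A a f \<in> Arr C" "Dom C (ext x A a f) = P x" "Cod C (ext x A a f) = A"
    "ext x A a f \<odot> e x = f" "ext x A a f \<odot> s x = a \<odot> farr F (ext x A a f)"
    unfolding ext_def by auto
qed

lemma eqI:
  assumes "x \<in> Obj C" "a \<in> Arr C" "Dom C a = fobj F A" "Cod C a = A"
    and "h \<in> Arr C" "k \<in> Arr C" "Dom C h = P x" "Dom C k = P x" "Cod C h = A" "Cod C k = A"
    and "h \<odot> e x = k \<odot> e x" "h \<odot> s x = a \<odot> farr F h" "k \<odot> s x = a \<odot> farr F k"
  shows "h = k"
  using free_algebra_eqI[OF free] assms by auto

definition Pmap :: "'a \<Rightarrow> 'a" where
  "Pmap f = ext (Dom C f) (P (Cod C f)) (s (Cod C f)) (e (Cod C f) \<odot> f)"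

lemma Pmap [simp]:
  assumes "f \<in> Arr C"
  shows "Pmap f \<in> Arr C" "Dom C (Pmap f) = P (Dom C f)" "Cod C (Pmap f) = P (Cod C f)"
    "Dom C f = x \<Longrightarrow> Pmap f \<odot> e x = e (Cod C f) \<odot> f"
    "Dom C f = x \<Longrightarrow> Pmap f \<odot> s x = s (Cod C f) \<odot> farr F (Pmap f)"
  using ext[of "Dom C f" "s (Cod C f)" "e (Cod C f) \<odot> f" "P (Cod C f)"] assms
  by (auto simp: Pmap_def)

lemma Pmap' [simp]:
  assumes "f \<in> Arr C" "Dom C f = x" "k \<in> Arr C"
  shows "Cod C k = x \<Longrightarrow> Pmap f \<odot> (e x \<odot> k) = e (Cod C f) \<odot> (f \<odot> k)"
    "Cod C k = fobj F (P x) \<Longrightarrow> Pmap f \<odot> (s x \<odot> k) = s (Cod C f) \<odot> (farr F (Pmap f) \<odot> k)"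
  using whisker[OF Pmap(4)[OF assms(1,2)], of k] whisker[OF Pmap(5)[OF assms(1,2)], of k] assms by auto

definition mult :: "'o \<Rightarrow> 'a" where
  "mult x = ext (P x) (P x) (s x) (Id C (P x))"

lemma mult [simp]:
  assumes "x \<in> Obj C"
  shows "mult x \<in> Arr C" "Dom C (mult x) = P (P x)" "Cod C (mult x) = P x"
    "mult x \<odot> e (P x) = Id C (P x)" "mult x \<odot> s (P x) = s x \<odot> farr F (mult x)"
  using ext[of "P x" "s x" "Id C (P x)" "P x"] assms by (auto simp: mult_def)

lemma mult' [simp]:
  assumes "x \<in> Obj C" "k \<in> Arr C"
  shows "Cod C k = P x \<Longrightarrow> mult x \<odot> (e (P x) \<odot> k) = k"
    "Cod C k = fobj F (P (P x)) \<Longrightarrow> mult x \<odot> (s (P x) \<odot> k) = s x \<odot> (farr F (mult x) \<odot> k)"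
  using whisker[OF mult(4)[OF assms(1)], of k] whisker[OF mult(5)[OF assms(1)], of k] assms by auto

text \<open>The monad of the adjunction between C and the category of F-algebras. It serves as the
  object of comparison for a free monad.\<close>

definition free_alg_monad :: "('o, 'a) monad" where
  "free_alg_monad = \<lparr>mfun = \<lparr>fobj = P, farr = Pmap\<rparr>, eta = e, mu = mult\<rparr>"

lemma free_alg_monad_simps [simp]:
  "fobj (mfun free_alg_monad) = P" "farr (mfun free_alg_monad) = Pmap"
  "eta free_alg_monad = e" "mu free_alg_monad = mult"
  by (simp_all add: free_alg_monad_def)

lemma Pmap_Id [simp]: "x \<in> Obj C \<Longrightarrow> Pmap (Id C x) = Id C (P x)"
  by (rule eqI[of x "s x" "P x"]) auto

lemma Pmap_Comp [simp]:
  "f \<in> Arr C \<Longrightarrow> g \<in> Arr C \<Longrightarrow> Dom C g = Cod C f \<Longrightarrow> Pmap (g \<odot> f) = Pmap g \<odot> Pmap f"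
  by (rule eqI[of "Dom C f" "s (Cod C g)" "P (Cod C g)"]) auto

lemma mult_natural:
  "f \<in> Arr C \<Longrightarrow> mult (Cod C f) \<odot> Pmap (Pmap f) = Pmap f \<odot> mult (Dom C f)"
  by (rule eqI[of "P (Dom C f)" "s (Cod C f)" "P (Cod C f)"]) auto

lemma monad_free_alg_monad: "monad C free_alg_monad"
proof unfold_locales
  fix x
  assume "x \<in> Obj C"
  then show "mu free_alg_monad x \<odot> mu free_alg_monad (fobj (mfun free_alg_monad) x)
      = mu free_alg_monad x \<odot> farr (mfun free_alg_monad) (mu free_alg_monad x)"
    by simp (rule eqI[of "P (P x)" "s x" "P x"]; simp)
  show "mu free_alg_monad x \<odot> farr (mfun free_alg_monad) (eta free_alg_monad x)
      = Id C (fobj (mfun free_alg_monad) x)"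
    using \<open>x \<in> Obj C\<close> by simp (rule eqI[of x "s x" "P x"]; simp)
qed (auto simp: mult_natural)

lemma inclusion_natural: "nat_trans C C F (mfun free_alg_monad) (\<lambda>x. s x \<odot> farr F (e x))"
proof unfold_locales
  fix f x y
  assume f: "f \<in> hom C x y"
  have "farr F (Pmap f) \<odot> farr F (e x) = farr F (e y) \<odot> farr F f"
    using f by (auto simp: farr_eq[OF Pmap(4)])
  then show "(s y \<odot> farr F (e y)) \<odot> farr F f = farr (mfun free_alg_monad) f \<odot> (s x \<odot> farr F (e x))"
    using f by auto
qed auto

text \<open>Freeness of M gives a monad morphism \<alpha> to the monad of free algebras; freeness of
  the algebras gives \<beta> back, as every Mx is an algebra by \<open>act\<close>. Uniqueness of
  monad morphisms out of M makes \<beta>\<alpha> the identity, uniqueness of algebra morphisms does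
  so for \<alpha>\<beta>, and the free structure is carried along \<beta>.\<close>

theorem free_monad_free_algebra:
  assumes M: "free_monad C F M \<iota>" and x: "x \<in> Obj C"
  shows "free_algebra C F x (fobj (mfun M) x) (eta M x) (mu M x \<odot> \<iota> (fobj (mfun M) x))"
proof -
  interpret M: functor_to_monad C F M \<iota>
    using M by (intro functor_to_monad.intro) (auto simp: free_monad_def category_axioms cat_functor_axioms)
  interpret N: monad C free_alg_monad
    by (rule monad_free_alg_monad)
  let ?M = "fobj (mfun M)" and ?Mf = "farr (mfun M)"
  define \<beta> where "\<beta> x = ext x (?M x) (M.act x) (eta M x)" for x
  have \<beta> [simp]: "\<beta> x \<in> Arr C" "Dom C (\<beta> x) = P x" "Cod C (\<beta> x) = ?M x" "\<beta> x \<odot> e x = eta M x"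
    "\<beta> x \<odot> s x = M.act x \<odot> farr F (\<beta> x)" if "x \<in> Obj C" for x
    using ext[of x "M.act x" "eta M x" "?M x"] that by (auto simp: \<beta>_def)
  have \<beta>' [simp]: "Cod C k = x \<Longrightarrow> \<beta> x \<odot> (e x \<odot> k) = eta M x \<odot> k"
    "Cod C k = fobj F (P x) \<Longrightarrow> \<beta> x \<odot> (s x \<odot> k) = M.act x \<odot> (farr F (\<beta> x) \<odot> k)"
    if "x \<in> Obj C" "k \<in> Arr C" for x k
    using whisker[OF \<beta>(4)[OF that(1)], of k] whisker[OF \<beta>(5)[OF that(1)], of k] that by auto
  have "monad_morphism C free_alg_monad M \<beta>"
  proof unfold_locales
    fix f x y
    assume f: "f \<in> hom C x y"
    have "?Mf f \<odot> (M.act x \<odot> farr F (\<beta> x)) = M.act y \<odot> (farr F (?Mf f) \<odot> farr F (\<beta> x))"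
      using M.act_natural'[of f x "farr F (\<beta> x)"] f by auto
    with f show "\<beta> y \<odot> farr (mfun free_alg_monad) f = ?Mf f \<odot> \<beta> x"
      by - (rule eqI[of x "M.act y" "?M y"]; auto)
  next
    fix x
    assume x: "x \<in> Obj C"
    have 1: "?Mf (\<beta> x) \<odot> (M.act (P x) \<odot> farr F (\<beta> (P x))) = M.act (?M x) \<odot> (farr F (?Mf (\<beta> x)) \<odot> farr F (\<beta> (P x)))"
      using M.act_natural'[of "\<beta> x" "P x" "farr F (\<beta> (P x))"] x by auto
    have 2: "mu M x \<odot> (M.act (?M x) \<odot> (farr F (?Mf (\<beta> x)) \<odot> farr F (\<beta> (P x))))
       = M.act x \<odot> (farr F (mu M x) \<odot> (farr F (?Mf (\<beta> x)) \<odot> farr F (\<beta> (P x))))"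
      using M.mu_act'[of x "farr F (?Mf (\<beta> x)) \<odot> farr F (\<beta> (P x))"] x by auto
    show "\<beta> x \<odot> mu free_alg_monad x
        = mu M x \<odot> ?Mf (\<beta> x) \<odot> \<beta> (fobj (mfun free_alg_monad) x)"
      by (rule eqI[of "P x" "M.act x" "?M x"]) (use x in \<open>auto simp: 1 2\<close>)
  qed auto
  then interpret \<beta>: monad_morphism C free_alg_monad M \<beta> .
  obtain \<alpha> where "monad_morphism C M free_alg_monad \<alpha>"
    and \<alpha>\<iota>: "\<And>x. x \<in> Obj C \<Longrightarrow> \<alpha> x \<odot> \<iota> x = s x \<odot> farr F (e x)"
    using M monad_free_alg_monad inclusion_natural unfolding free_monad_def by blast
  then interpret \<alpha>: monad_morphism C M free_alg_monad \<alpha> by simp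
  have \<iota>': "?Mf (eta M x) \<odot> \<iota> x = \<iota> (?M x) \<odot> farr F (eta M x)" if "x \<in> Obj C" for x
    using that by (simp add: M.\<iota>.natural_Comp)
  have "farr F (\<beta> x) \<odot> farr F (e x) = farr F (eta M x)" if "x \<in> Obj C" for x
    using that by (simp add: farr_eq[OF \<beta>(4)])
  then have "(\<beta> x \<odot> \<alpha> x) \<odot> \<iota> x = \<iota> x" if "x \<in> Obj C" for x
    using that by (simp add: \<alpha>\<iota>) (simp add: M.act_def \<iota>'[symmetric])
  then have \<beta>\<alpha>: "\<beta> x \<odot> \<alpha> x = Id C (?M x)" if "x \<in> Obj C" for x
  proof -
    \<comment> \<open>Freeness of M is applied to M itself: all monad endomorphisms that fix \<iota>
      agree on objects of C, in particular \<beta>\<alpha> and the identity.\<close>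
    have "\<exists>\<gamma>. \<forall>\<beta>. monad_morphism C M M \<beta> \<longrightarrow> (\<forall>x \<in> Obj C. \<beta> x \<odot> \<iota> x = \<iota> x) \<longrightarrow>
        (\<forall>x \<in> Obj C. \<beta> x = \<gamma> x)"
      using M M.monad_axioms M.\<iota>.nat_trans_axioms unfolding free_monad_def by blast
    then obtain \<gamma> where \<gamma>: "\<And>\<beta> x. monad_morphism C M M \<beta> \<Longrightarrow> \<forall>x \<in> Obj C. \<beta> x \<odot> \<iota> x = \<iota> x \<Longrightarrow>
        x \<in> Obj C \<Longrightarrow> \<beta> x = \<gamma> x"
      by blast
    have "\<beta> x \<odot> \<alpha> x = \<gamma> x"
      by (rule \<gamma>[OF monad_morphism_comp[OF \<alpha>.monad_morphism_axioms \<beta>.monad_morphism_axioms]])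
        (use that \<open>\<And>x. x \<in> Obj C \<Longrightarrow> (\<beta> x \<odot> \<alpha> x) \<odot> \<iota> x = \<iota> x\<close> in auto)
    also have "\<dots> = Id C (?M x)"
      by (rule \<gamma>[OF M.monad_morphism_id, symmetric]) (use that in auto)
    finally show ?thesis .
  qed
  \<comment> \<open>A monad morphism that respects the transformations from F also respects the
    algebra structures derived from them.\<close>
  have \<alpha>s: "\<alpha> x \<odot> M.act x = s x \<odot> farr F (\<alpha> x)" if "x \<in> Obj C" for x
  proof -
    have "\<alpha> x \<odot> M.act x = mult x \<odot> (Pmap (\<alpha> x) \<odot> (\<alpha> (?M x) \<odot> \<iota> (?M x)))"
      using that by (simp add: M.act_def \<alpha>.map_mu')
    also have "\<dots> = s x \<odot> (farr F (mult x) \<odot> (farr F (Pmap (\<alpha> x)) \<odot> farr F (e (?M x))))"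
      using that by (simp add: \<alpha>\<iota>)
    also have "farr F (Pmap (\<alpha> x)) \<odot> farr F (e (?M x)) = farr F (e (P x)) \<odot> farr F (\<alpha> x)"
      using that by (simp add: farr_eq[OF Pmap(4)])
    also have "farr F (mult x) \<odot> (farr F (e (P x)) \<odot> farr F (\<alpha> x)) = farr F (\<alpha> x)"
      using that by (simp add: farr_eq[OF mult(4)])
    finally show ?thesis .
  qed
  have \<alpha>\<beta>: "\<alpha> x \<odot> \<beta> x = Id C (P x)" if "x \<in> Obj C" for x
    by (rule eqI[of x "s x" "P x"])
      (use that whisker[OF \<alpha>s, of x "farr F (\<beta> x)"] \<alpha>.map_eta in auto)
  have "free_algebra C F x (?M x) (\<beta> x \<odot> e x) (M.act x)"
    by (rule free_algebra_iso[OF cat_functor_axioms free, of _ _ _ "\<alpha> x"]) (use x \<beta>\<alpha> \<alpha>\<beta> in auto)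
  then show ?thesis
    using x by (simp add: M.act_def)
qed

end

lemma (in omega_functor) free_monad_free_algebra:
  assumes "free_monad C F M \<iota>" and x: "x \<in> Obj C"
  shows "free_algebra C F x (fobj (mfun M) x) (eta M x) (mu M x \<odot> \<iota> (fobj (mfun M) x))"
proof -
  have "\<forall>x \<in> Obj C. \<exists>t. free_algebra C F x (fst t) (fst (snd t)) (snd (snd t))"
    using free_algebra_ex by simp
  then obtain t where "\<forall>x \<in> Obj C. free_algebra C F x (fst (t x)) (fst (snd (t x))) (snd (snd (t x)))"
    by metis
  then interpret free_algebras C F "\<lambda>x. fst (t x)" "\<lambda>x. fst (snd (t x))" "\<lambda>x. snd (snd (t x))"
    by unfold_locales simp
  show ?thesis
    by (rule free_monad_free_algebra) fact+
qed

locale algebraically_free = omega_functor C F + functor_to_monad C F M \<iota>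
  for C :: "('o, 'a) category" (structure) and F M \<iota> +
  assumes free_monad: "free_monad C F M \<iota>"
begin

lemma free: "x \<in> Obj C \<Longrightarrow> free_algebra C F x (fobj (mfun M) x) (eta M x) (act x)"
  using free_monad_free_algebra[OF free_monad] by (simp add: act_def)

lemma alg_hom_ex1:
  assumes "x \<in> Obj C" "a \<in> hom C (fobj F A) A" "f \<in> hom C x A"
  shows "\<exists>!h. h \<in> hom C (fobj (mfun M) x) A \<and> h \<odot> eta M x = f \<and> h \<odot> act x = a \<odot> farr F h"
  by (rule free_algebra_ex1[OF free]) fact+

lemma alg_hom_eqI:
  assumes "x \<in> Obj C" "a \<in> hom C (fobj F A) A"
    and "h \<in> hom C (fobj (mfun M) x) A" "k \<in> hom C (fobj (mfun M) x) A"
    and "h \<odot> eta M x = k \<odot> eta M x" "h \<odot> act x = a \<odot> farr F h" "k \<odot> act x = a \<odot> farr F k"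
  shows "h = k"
  by (rule free_algebra_eqI[OF free]) fact+

text \<open>The colimit of the chain of free algebras carries an algebra structure, so it receives a map
  from the free algebra on the colimit of the generators.\<close>

lemma mfun_preserves_chain_colimits: "preserves_chain_colimits C C (mfun M)"
  unfolding preserves_chain_colimits_def
proof (intro allI impI)
  fix X c L \<kappa>
  assume K: "chain_colimit C X c L \<kappa>"
  let ?M = "fobj (mfun M)" and ?Mf = "farr (mfun M)"
  note [simp] = chain_colimitD(1-6,8)[OF K] chain_colimit_Obj[OF K]
  note c = chain_colimitD(7)[OF K]
  have "chain C (\<lambda>n. ?M (X n)) (\<lambda>n. ?Mf (c n))"
    by (simp add: chain_def)
  then obtain P p where P: "chain_colimit C (\<lambda>n. ?M (X n)) (\<lambda>n. ?Mf (c n)) P p"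
    using ex_chain_colimit by blast
  note [simp] = chain_colimitD(4-6)[OF P] chain_colimit_Obj[OF P]
  note p = chain_colimitD(7)[OF P]
  \<comment> \<open>The connecting arrows are algebra morphisms and F preserves the colimit P, so
    the structures on the stages induce one on P.\<close>
  have "chain_cocone C (\<lambda>n. fobj F (?M (X n))) (\<lambda>n. farr F (?Mf (c n))) P (\<lambda>n. p n \<odot> act (X n))"
    unfolding chain_cocone_def
  proof (intro allI conjI)
    fix n
    show "(p (Suc n) \<odot> act (X (Suc n))) \<odot> farr F (?Mf (c n)) = p n \<odot> act (X n)"
      using whisker[OF p, of n "act (X n)"] act_natural[of "c n" "X n"] by simp
  qed simp
  then obtain t where t: "t \<in> hom C (fobj F P) P" "\<And>n. t \<odot> farr F (p n) = p n \<odot> act (X n)"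
    using chain_colimit_ex1[OF preserves_chain[OF P]] by blast
  have "chain_cocone C X c P (\<lambda>n. p n \<odot> eta M (X n))"
    unfolding chain_cocone_def
  proof (intro allI conjI)
    fix n
    show "(p (Suc n) \<odot> eta M (X (Suc n))) \<odot> c n = p n \<odot> eta M (X n)"
      using whisker[OF p, of n "eta M (X n)"] by simp
  qed simp
  then obtain u where u: "u \<in> hom C L P" "\<And>n. u \<odot> \<kappa> n = p n \<odot> eta M (X n)"
    using chain_colimit_ex1[OF K] by blast
  obtain v where v: "v \<in> hom C (?M L) P" "v \<odot> eta M L = u" "v \<odot> act L = t \<odot> farr F v"
    using alg_hom_ex1[of L t P u] t u by auto
  have M\<kappa>: "?Mf (\<kappa> (Suc n)) \<odot> ?Mf (c n) = ?Mf (\<kappa> n)" for n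
    using fn.farr_eq[OF c] by simp
  then have "chain_cocone C (\<lambda>n. ?M (X n)) (\<lambda>n. ?Mf (c n)) (?M L) (\<lambda>n. ?Mf (\<kappa> n))"
    by (simp add: chain_cocone_def)
  \<comment> \<open>The comparison map in the other direction. It is an algebra morphism
    (\<open>wt\<close>) compatible with generators (\<open>wu\<close>), so one composite is the
    identity by freeness; the other is checked on the legs \<open>p n\<close>.\<close>
  then obtain w where w: "w \<in> hom C P (?M L)" "\<And>n. w \<odot> p n = ?Mf (\<kappa> n)"
    using chain_colimit_ex1[OF P] by blast
  note [simp] = t(1)[simplified] u(1)[simplified] v(1)[simplified] w(1)[simplified]
  have wt: "w \<odot> t = act L \<odot> farr F w"
  proof (rule chain_colimit_eqI[OF preserves_chain[OF P]])
    fix n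
    have "w \<odot> (t \<odot> farr F (p n)) = ?Mf (\<kappa> n) \<odot> act (X n)"
      using whisker[OF w(2), of n "act (X n)"] by (simp add: t)
    also have "\<dots> = act L \<odot> (farr F w \<odot> farr F (p n))"
      by (simp add: act_natural farr_eq[OF w(2)])
    finally show "(w \<odot> t) \<odot> farr F (p n) = (act L \<odot> farr F w) \<odot> farr F (p n)"
      by simp
  qed auto
  have wu: "w \<odot> u = eta M L"
  proof (rule chain_colimit_eqI[OF K])
    fix n
    have "w \<odot> (u \<odot> \<kappa> n) = ?Mf (\<kappa> n) \<odot> eta M (X n)"
      using whisker[OF w(2), of n "eta M (X n)"] by (simp add: u)
    then show "(w \<odot> u) \<odot> \<kappa> n = eta M L \<odot> \<kappa> n"
      by simp
  qed auto
  have "v \<odot> w = Id C P"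
  proof (rule chain_colimit_eqI[OF P])
    fix n
    have "v \<odot> ?Mf (\<kappa> n) = p n"
    proof (rule alg_hom_eqI[of "X n" t P])
      show "(v \<odot> ?Mf (\<kappa> n)) \<odot> eta M (X n) = p n \<odot> eta M (X n)"
        using whisker[OF v(2), of "\<kappa> n"] by (simp add: u)
      show "(v \<odot> ?Mf (\<kappa> n)) \<odot> act (X n) = t \<odot> farr F (v \<odot> ?Mf (\<kappa> n))"
        using whisker[OF v(3), of "farr F (?Mf (\<kappa> n))"] by (simp add: act_natural)
    qed (auto simp: t)
    then show "(v \<odot> w) \<odot> p n = Id C P \<odot> p n"
      by (simp add: w)
  qed auto
  moreover have "w \<odot> v = Id C (?M L)"
  proof (rule alg_hom_eqI[of L "act L" "?M L"])
    show "(w \<odot> v) \<odot> act L = act L \<odot> farr F (w \<odot> v)"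
      using whisker[OF wt, of "farr F v"] by (simp add: v)
  qed (auto simp: v wu)
  ultimately show "chain_colimit C (\<lambda>n. ?M (X n)) (\<lambda>n. ?Mf (c n)) (?M L) (\<lambda>n. ?Mf (\<kappa> n))"
    using chain_colimit_iso[OF P w(1) v(1)] by (simp add: w)
qed

end


section \<open>The composite of two monads\<close>

context monad_distributive_law
begin

lemma component_arr [simp]:
  assumes "x \<in> Obj C"
  shows "\<delta> x \<in> Arr C" "Dom C (\<delta> x) = fobj (mfun T) (fobj (mfun S) x)"
    "Cod C (\<delta> x) = fobj (mfun S) (fobj (mfun T) x)"
  using nat_trans.component_arr[OF natural assms] by simp_all

lemma natural_Comp:
  assumes "f \<in> Arr C" "Cod C f = y"
  shows "\<delta> y \<odot> farr (mfun T) (farr (mfun S) f) = farr (mfun S) (farr (mfun T) f) \<odot> \<delta> (Dom C f)"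
  using nat_trans.natural_Comp[OF natural assms] by simp

lemmas natural_Comp' = S.whisker[OF natural_Comp]

text \<open>The \<open>T\<close>-algebra structure on \<open>STx\<close> lifted from the free one on \<open>Tx\<close>.\<close>

definition lifted :: "'o \<Rightarrow> 'a" where
  "lifted x = farr (mfun S) (mu T x) \<odot> \<delta> (fobj (mfun T) x)"

lemma lifted_arr [simp]:
  assumes "x \<in> Obj C"
  shows "lifted x \<in> Arr C" "Dom C (lifted x) = fobj (mfun T) (fobj (mfun S) (fobj (mfun T) x))"
    "Cod C (lifted x) = fobj (mfun S) (fobj (mfun T) x)"
  using assms by (auto simp: lifted_def)

lemma lifted_natural:
  assumes "f \<in> Arr C" "Cod C f = y"
  shows "lifted y \<odot> farr (mfun T) (farr (mfun S) (farr (mfun T) f))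
    = farr (mfun S) (farr (mfun T) f) \<odot> lifted (Dom C f)"
  using assms by (auto simp: lifted_def natural_Comp S.fn.farr_eq[OF T.mu_natural])

text \<open>With \<open>lifted_mu_T\<close>, one of the two laws of an algebra for the monad T on
  STx. In the same reading, \<open>lifted_eta_S\<close> and \<open>lifted_mu_S\<close> make the unit
  and the multiplication of S morphisms of such algebras.\<close>

lemma lifted_eta_T:
  assumes "x \<in> Obj C"
  shows "lifted x \<odot> eta T (fobj (mfun S) (fobj (mfun T) x)) = Id C (fobj (mfun S) (fobj (mfun T) x))"
  using assms by (simp add: lifted_def eta_T S.fn.farr_eq[OF T.mu_map_eta] S.fn.farr_eq[OF T.mu_eta])

lemma lifted_eta_S:
  assumes "x \<in> Obj C"
  shows "lifted x \<odot> farr (mfun T) (eta S (fobj (mfun T) x)) = eta S (fobj (mfun T) x) \<odot> mu T x"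
  using assms by (simp add: lifted_def eta_S)

lemma lifted_mu_T:
  assumes "x \<in> Obj C"
  shows "lifted x \<odot> mu T (fobj (mfun S) (fobj (mfun T) x)) = lifted x \<odot> farr (mfun T) (lifted x)"
  using assms S.whisker[OF natural_Comp, of "mu T x" "fobj (mfun T) x" "farr (mfun T) (\<delta> (fobj (mfun T) x))"]
  by (simp add: lifted_def mu_T S.fn.farr_eq(2)[OF T.mu_mu])

lemma lifted_mu_S:
  assumes "x \<in> Obj C"
  shows "lifted x \<odot> farr (mfun T) (mu S (fobj (mfun T) x))
    = mu S (fobj (mfun T) x) \<odot> farr (mfun S) (lifted x) \<odot> \<delta> (fobj (mfun S) (fobj (mfun T) x))"
  using assms S.mu_natural'[of "mu T x" _ "farr (mfun S) (\<delta> (fobj (mfun T) x)) \<odot> \<delta> (fobj (mfun S) (fobj (mfun T) x))", symmetric]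
  by (simp add: lifted_def mu_S)

lemma composite_monad_simps [simp]:
  "mfun (composite_monad C S T \<delta>) = mfun S \<circ>\<^sub>F mfun T"
  "eta (composite_monad C S T \<delta>) x = eta S (fobj (mfun T) x) \<odot> eta T x"
  by (simp_all add: composite_monad_def)

lemma composite_mu:
  "x \<in> Obj C \<Longrightarrow>
    mu (composite_monad C S T \<delta>) x = mu S (fobj (mfun T) x) \<odot> farr (mfun S) (lifted x)"
  by (simp add: composite_monad_def lifted_def)

lemma monad_composite_monad: "monad C (composite_monad C S T \<delta>)"
proof unfold_locales
  let ?M = "composite_monad C S T \<delta>" and ?S = "fobj (mfun S)" and ?T = "fobj (mfun T)"
  let ?Sf = "farr (mfun S)" and ?Tf = "farr (mfun T)"
  fix f x y
  assume f: "f \<in> hom C x y"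
  show "eta ?M y \<odot> farr id_functor f = farr (mfun ?M) f \<odot> eta ?M x"
    using f S.eta_natural'[of "?Tf f" "?T x" "eta T x"] by auto
  have "mu ?M y \<odot> farr (mfun ?M \<circ>\<^sub>F mfun ?M) f
      = mu S (?T y) \<odot> (?Sf (?Sf (?Tf f)) \<odot> ?Sf (lifted x))"
    using f by (auto simp: composite_mu S.fn.farr_eq[OF lifted_natural])
  also have "\<dots> = farr (mfun ?M) f \<odot> mu ?M x"
    using f by (auto simp: composite_mu S.mu_natural')
  finally show "mu ?M y \<odot> farr (mfun ?M \<circ>\<^sub>F mfun ?M) f = farr (mfun ?M) f \<odot> mu ?M x" .
next
  let ?M = "composite_monad C S T \<delta>" and ?S = "fobj (mfun S)" and ?T = "fobj (mfun T)"
  let ?Sf = "farr (mfun S)" and ?Tf = "farr (mfun T)"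
  fix x
  assume x: "x \<in> Obj C"
  have "mu ?M x \<odot> eta ?M (fobj (mfun ?M) x) = lifted x \<odot> eta T (?S (?T x))"
    using x by (simp add: composite_mu)
  then show "mu ?M x \<odot> eta ?M (fobj (mfun ?M) x) = Id C (fobj (mfun ?M) x)"
    using x by (simp add: lifted_eta_T)
  have "lifted x \<odot> (?Tf (eta S (?T x)) \<odot> ?Tf (eta T x)) = eta S (?T x)"
    using x S.whisker[OF lifted_eta_S, of x "?Tf (eta T x)"] by simp
  then have "?Sf (lifted x \<odot> (?Tf (eta S (?T x)) \<odot> ?Tf (eta T x))) = ?Sf (eta S (?T x))"
    by simp
  then show "mu ?M x \<odot> farr (mfun ?M) (eta ?M x) = Id C (fobj (mfun ?M) x)"
    using x by (simp add: composite_mu)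
  have "mu ?M x \<odot> mu ?M (fobj (mfun ?M) x)
      = mu S (?T x) \<odot> (mu S (?S (?T x)) \<odot> (?Sf (?Sf (lifted x)) \<odot> ?Sf (lifted (?S (?T x)))))"
    using x by (simp add: composite_mu S.mu_natural')
  also have "\<dots> = mu S (?T x) \<odot> ?Sf (mu S (?T x) \<odot> (?Sf (lifted x) \<odot> lifted (?S (?T x))))"
    using x by (simp add: S.mu_mu')
  \<comment> \<open>The action law \<open>lifted_mu_T\<close> replaces the multiplication of T
    inside the inner \<open>lifted\<close> by a second action, and naturality moves \<delta> past
    that action. Then \<open>lifted_mu_S\<close> applies.\<close>
  also have "?Sf (lifted x) \<odot> lifted (?S (?T x))
      = ?Sf (lifted x) \<odot> (\<delta> (?S (?T x)) \<odot> ?Tf (?Sf (lifted x)))"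
    using x by (simp add: natural_Comp) (simp add: lifted_def[of "?S (?T x)"] S.fn.farr_eq(2)[OF lifted_mu_T])
  also have "mu S (?T x) \<odot> \<dots> = lifted x \<odot> (?Tf (mu S (?T x)) \<odot> ?Tf (?Sf (lifted x)))"
    using x S.whisker[OF lifted_mu_S, of x "?Tf (?Sf (lifted x))"] by simp
  also have "mu S (?T x) \<odot> ?Sf \<dots> = mu ?M x \<odot> farr (mfun ?M) (mu ?M x)"
    using x by (simp add: composite_mu)
  finally show "mu ?M x \<odot> mu ?M (fobj (mfun ?M) x) = mu ?M x \<odot> farr (mfun ?M) (mu ?M x)" .
qed (auto simp: composite_mu)

lemma monad_morphism_left: "monad_morphism C S (composite_monad C S T \<delta>) (\<lambda>x. farr (mfun S) (eta T x))"
proof -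
  let ?M = "composite_monad C S T \<delta>" and ?S = "fobj (mfun S)" and ?T = "fobj (mfun T)"
  let ?Sf = "farr (mfun S)" and ?Tf = "farr (mfun T)"
  interpret M: monad C ?M
    by (rule monad_composite_monad)
  show ?thesis
  proof unfold_locales
    fix f x y
    assume f: "f \<in> hom C x y"
    then show "?Sf (eta T y) \<odot> ?Sf f = farr (mfun ?M) f \<odot> ?Sf (eta T x)"
      by (auto simp: S.fn.farr_eq[OF T.eta_natural])
  next
    fix x
    assume x: "x \<in> Obj C"
    then show "?Sf (eta T x) \<odot> eta S x = eta ?M x"
      by simp
    have "lifted x \<odot> (?Tf (?Sf (eta T x)) \<odot> eta T (?S x)) = ?Sf (eta T x)"
      using x S.whisker[OF lifted_eta_T, of x "?Sf (eta T x)"] by simp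
    from arg_cong[OF this, of ?Sf] have "?Sf (lifted x) \<odot> (?Sf (?Tf (?Sf (eta T x))) \<odot> ?Sf (eta T (?S x)))
        = ?Sf (?Sf (eta T x))"
      using x by (simp del: T.eta_natural T.eta_natural')
    then show "?Sf (eta T x) \<odot> mu S x = mu ?M x \<odot> farr (mfun ?M) (?Sf (eta T x)) \<odot> ?Sf (eta T (fobj (mfun S) x))"
      using x by (simp add: composite_mu S.mu_natural)
  qed auto
qed

text \<open>The component at an initial object is the S-image of the unit of T there, and functors
  preserve isomorphisms.\<close>

lemma admissible_left:
  assumes "constant_free C T"
  shows "admissible C S (composite_monad C S T \<delta>) (\<lambda>x. farr (mfun S) (eta T x))"
  unfolding admissible_def
proof (intro conjI allI impI monad_morphism_left)
  fix z
  assume "initial C z"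
  then have z: "z \<in> Obj C" and "iso C (eta T z)"
    using assms by (auto simp: constant_free_def initial_def)
  then obtain g where "g \<in> hom C (fobj (mfun T) z) z" "g \<odot> eta T z = Id C z"
    "eta T z \<odot> g = Id C (fobj (mfun T) z)"
    by (auto simp: iso_def)
  then show "iso C (farr (mfun S) (eta T z))"
    using z S.fn.farr_eq(1)[of g "eta T z"] S.fn.farr_eq(1)[of "eta T z" g]
    by (auto simp: iso_def intro!: bexI[of _ "farr (mfun S) g"])
qed

end


section \<open>Bifunctors\<close>

lemma prod_cat_simps [simp]:
  "Obj (prod_cat C D) = Obj C \<times> Obj D" "Arr (prod_cat C D) = Arr C \<times> Arr D"
  "Dom (prod_cat C D) (f, g) = (Dom C f, Dom D g)" "Cod (prod_cat C D) (f, g) = (Cod C f, Cod D g)"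
  "Id (prod_cat C D) (x, y) = (Id C x, Id D y)"
  "(f', g') \<odot>\<^bsub>prod_cat C D\<^esub> (f, g) = (f' \<odot>\<^bsub>C\<^esub> f, g' \<odot>\<^bsub>D\<^esub> g)"
  by (simp_all add: prod_cat_def)

locale bifunctor = category C + pair: cat_functor "prod_cat C C" C \<Gamma>
  for C :: "('o, 'a) category" (structure) and \<Gamma>
begin

lemma bi_Obj [simp]: "x \<in> Obj C \<Longrightarrow> y \<in> Obj C \<Longrightarrow> fobj \<Gamma> (x, y) \<in> Obj C"
  using pair.fobj_in_Obj[of "(x, y)"] by simp

lemma bi_arr [simp]:
  assumes "f \<in> Arr C" "g \<in> Arr C"
  shows "farr \<Gamma> (f, g) \<in> Arr C" "Dom C (farr \<Gamma> (f, g)) = fobj \<Gamma> (Dom C f, Dom C g)"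
    "Cod C (farr \<Gamma> (f, g)) = fobj \<Gamma> (Cod C f, Cod C g)"
  using pair.farr_arr[of "(f, g)"] assms by simp_all

lemma bi_Id [simp]:
  "x \<in> Obj C \<Longrightarrow> y \<in> Obj C \<Longrightarrow> farr \<Gamma> (Id C x, Id C y) = Id C (fobj \<Gamma> (x, y))"
  using pair.farr_Id[of "(x, y)"] by simp

text \<open>Oriented against \<open>farr_Comp'\<close>: images under \<Gamma> are merged into one,
  so that each coordinate simplifies on its own. The general rule is therefore withdrawn for
  \<Gamma> below.\<close>

lemma bi_Comp [simp]:
  assumes "f \<in> Arr C" "g \<in> Arr C" "f' \<in> Arr C" "g' \<in> Arr C" "Dom C f = Cod C f'" "Dom C g = Cod C g'"
  shows "farr \<Gamma> (f, g) \<odot> farr \<Gamma> (f', g') = farr \<Gamma> (f \<odot> f', g \<odot> g')"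
    and "k \<in> Arr C \<Longrightarrow> Cod C k = fobj \<Gamma> (Dom C f', Dom C g') \<Longrightarrow>
      farr \<Gamma> (f, g) \<odot> (farr \<Gamma> (f', g') \<odot> k) = farr \<Gamma> (f \<odot> f', g \<odot> g') \<odot> k"
proof -
  show *: "farr \<Gamma> (f, g) \<odot> farr \<Gamma> (f', g') = farr \<Gamma> (f \<odot> f', g \<odot> g')"
    using pair.farr_Comp'[of "(f', g')" "(f, g)"] assms by simp
  show "farr \<Gamma> (f, g) \<odot> (farr \<Gamma> (f', g') \<odot> k) = farr \<Gamma> (f \<odot> f', g \<odot> g') \<odot> k"
    if "k \<in> Arr C" "Cod C k = fobj \<Gamma> (Dom C f', Dom C g')"
    by (rule whisker[OF *]) (use that assms in auto)
qed

declare pair.farr_Comp' [simp del]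

end

locale chain_bifunctor = bifunctor C \<Gamma> for C :: "('o, 'a) category" (structure) and \<Gamma> +
  assumes chain_fst: "\<lbrakk>chain_colimit C X c L \<kappa>; y \<in> Obj C\<rbrakk> \<Longrightarrow>
      chain_colimit C (\<lambda>n. fobj \<Gamma> (X n, y)) (\<lambda>n. farr \<Gamma> (c n, Id C y)) (fobj \<Gamma> (L, y)) (\<lambda>n. farr \<Gamma> (\<kappa> n, Id C y))"
    and chain_snd: "\<lbrakk>chain_colimit C X c L \<kappa>; x \<in> Obj C\<rbrakk> \<Longrightarrow>
      chain_colimit C (\<lambda>n. fobj \<Gamma> (x, X n)) (\<lambda>n. farr \<Gamma> (Id C x, c n)) (fobj \<Gamma> (x, L)) (\<lambda>n. farr \<Gamma> (Id C x, \<kappa> n))"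
begin

text \<open>A cocone on the diagonal extends to the whole square: the entry \<open>(m, n)\<close> is sent to the
  diagonal entry \<open>m + n\<close>.\<close>

lemma chain_diagonal:
  assumes K: "chain_colimit C X c L \<kappa>" and K': "chain_colimit C Y b N \<nu>"
  shows "chain_colimit C (\<lambda>n. fobj \<Gamma> (X n, Y n)) (\<lambda>n. farr \<Gamma> (c n, b n))
    (fobj \<Gamma> (L, N)) (\<lambda>n. farr \<Gamma> (\<kappa> n, \<nu> n))"
  unfolding chain_colimit_def
proof (intro conjI allI impI)
  note [simp] = chain_colimitD(1-6,8)[OF K] chain_colimit_Obj[OF K]
    chain_colimitD(1-6,8)[OF K'] chain_colimit_Obj[OF K']
  have ch: "chain C X c" "chain C Y b"
    using K K' by (auto simp: chain_colimit_def)
  note [simp] = chain_map_arr[OF ch(1)] chain_map_arr[OF ch(2)]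
  note shift = chain_map_shift[OF ch(1)] chain_map_shift[OF ch(2)]
  show "chain C (\<lambda>n. fobj \<Gamma> (X n, Y n)) (\<lambda>n. farr \<Gamma> (c n, b n))"
    by (simp add: chain_def)
  show "chain_cocone C (\<lambda>n. fobj \<Gamma> (X n, Y n)) (\<lambda>n. farr \<Gamma> (c n, b n)) (fobj \<Gamma> (L, N))
      (\<lambda>n. farr \<Gamma> (\<kappa> n, \<nu> n))"
    by (simp add: chain_cocone_def chain_colimitD(7)[OF K] chain_colimitD(7)[OF K'])
  fix Z g
  assume g: "chain_cocone C (\<lambda>n. fobj \<Gamma> (X n, Y n)) (\<lambda>n. farr \<Gamma> (c n, b n)) Z g"
  note [simp] = chain_coconeD(1-3)[OF g]
  let ?x = "chain_map C X c" and ?y = "chain_map C Y b"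
  \<comment> \<open>\<open>?x m n\<close> takes n steps from \<open>X m\<close> and
    \<open>?y n m\<close> takes m steps from \<open>Y n\<close>, so both end at stage m + n.\<close>
  define q where "q m n = g (m + n) \<odot> farr \<Gamma> (?x m n, ?y n m)" for m n
  have q [simp]: "q m n \<in> Arr C" "Dom C (q m n) = fobj \<Gamma> (X m, Y n)" "Cod C (q m n) = Z" for m n
    by (simp_all add: q_def add.commute)
  \<comment> \<open>The entry (m, n) may equally be computed at stage m + n + 1; moving one of the
    extra steps to the start, in the second or the first coordinate, yields \<open>q_snd\<close> and
    \<open>q_fst\<close>.\<close>
  have gs: "g (Suc (m + n)) \<odot> farr \<Gamma> (c (m + n) \<odot> ?x m n, b (m + n) \<odot> ?y n m) = q m n" for m n
    using whisker[OF chain_coconeD(4)[OF g], of "m + n" "farr \<Gamma> (?x m n, ?y n m)"]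
    by (simp add: q_def add.commute)
  have q_snd: "q m (Suc n) \<odot> farr \<Gamma> (Id C (X m), b n) = q m n" for m n
    using gs[of m n] by (simp add: q_def shift add.commute)
  have q_fst: "q (Suc m) n \<odot> farr \<Gamma> (c m, Id C (Y n)) = q m n" for m n
    using gs[of m n] by (simp add: q_def shift add.commute)
  \<comment> \<open>The entry (n, n) was sent to stage n + n; this brings it back to
    \<open>g n\<close>.\<close>
  have gx: "g (n + k) \<odot> farr \<Gamma> (?x n k, ?y n k) = g n" for n k
  proof (induction k)
    case (Suc k)
    then show ?case
      using whisker[OF chain_coconeD(4)[OF g], of "n + k" "farr \<Gamma> (?x n k, ?y n k)"] by simp
  qed simp
  \<comment> \<open>The colimit is taken one variable at a time: for each fixed m in the second
    argument, and then over m in the first.\<close>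
  have "\<exists>r. r \<in> hom C (fobj \<Gamma> (X m, N)) Z \<and> (\<forall>n. r \<odot> farr \<Gamma> (Id C (X m), \<nu> n) = q m n)" for m
    using chain_colimit_ex1[OF chain_snd[OF K', of "X m"], of Z "q m"] q_snd by (auto simp: chain_cocone_def)
  then obtain r where r: "\<And>m. r m \<in> hom C (fobj \<Gamma> (X m, N)) Z"
    "\<And>m n. r m \<odot> farr \<Gamma> (Id C (X m), \<nu> n) = q m n"
    by metis
  note [simp] = r(1)[simplified]
  have "r (Suc m) \<odot> farr \<Gamma> (c m, Id C N) = r m" for m
  proof (rule chain_colimit_eqI[OF chain_snd[OF K', of "X m"]])
    fix n
    have "r (Suc m) \<odot> farr \<Gamma> (c m, \<nu> n)
        = (r (Suc m) \<odot> farr \<Gamma> (Id C (X (Suc m)), \<nu> n)) \<odot> farr \<Gamma> (c m, Id C (Y n))"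
      by simp
    also have "\<dots> = r m \<odot> farr \<Gamma> (Id C (X m), \<nu> n)"
      by (simp only: r q_fst)
    finally show "(r (Suc m) \<odot> farr \<Gamma> (c m, Id C N)) \<odot> farr \<Gamma> (Id C (X m), \<nu> n)
        = r m \<odot> farr \<Gamma> (Id C (X m), \<nu> n)"
      by simp
  qed auto
  then obtain h where h: "h \<in> hom C (fobj \<Gamma> (L, N)) Z" "\<And>m. h \<odot> farr \<Gamma> (\<kappa> m, Id C N) = r m"
    using chain_colimit_ex1[OF chain_fst[OF K, of N], of Z r] by (auto simp: chain_cocone_def)
  note [simp] = h(1)[simplified]
  show "\<exists>!h. h \<in> hom C (fobj \<Gamma> (L, N)) Z \<and> (\<forall>n. h \<odot> farr \<Gamma> (\<kappa> n, \<nu> n) = g n)"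
  proof (rule ex1I[of _ h])
    have "h \<odot> farr \<Gamma> (\<kappa> n, \<nu> n) = g n" for n
    proof -
      have "h \<odot> farr \<Gamma> (\<kappa> n, \<nu> n) = (h \<odot> farr \<Gamma> (\<kappa> n, Id C N)) \<odot> farr \<Gamma> (Id C (X n), \<nu> n)"
        by simp
      also have "\<dots> = g n"
        by (simp only: h r) (simp add: q_def gx)
      finally show ?thesis .
    qed
    then show "h \<in> hom C (fobj \<Gamma> (L, N)) Z \<and> (\<forall>n. h \<odot> farr \<Gamma> (\<kappa> n, \<nu> n) = g n)"
      by simp
    fix k
    assume "k \<in> hom C (fobj \<Gamma> (L, N)) Z \<and> (\<forall>n. k \<odot> farr \<Gamma> (\<kappa> n, \<nu> n) = g n)"
    then have k: "k \<in> hom C (fobj \<Gamma> (L, N)) Z" and kg: "\<And>n. k \<odot> farr \<Gamma> (\<kappa> n, \<nu> n) = g n"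
      by auto
    show "k = h"
    proof (rule chain_colimit_eqI[OF chain_fst[OF K, of N]])
      fix m
      have "k \<odot> farr \<Gamma> (\<kappa> m, Id C N) = r m"
      proof (rule chain_colimit_eqI[OF chain_snd[OF K', of "X m"]])
        fix n
        \<comment> \<open>For uniqueness, the entry (m, n) factors through the diagonal at m + n,
          where \<open>k\<close> is known.\<close>
        have "\<kappa> (m + n) \<odot> ?x m n = \<kappa> m" "\<nu> (m + n) \<odot> ?y n m = \<nu> n"
          using chain_cocone_map[of X c L \<kappa> m n] chain_cocone_map[of Y b N \<nu> n m] K K'
          by (auto simp: chain_colimit_def add.commute)
        then have "k \<odot> farr \<Gamma> (\<kappa> m, \<nu> n) = (k \<odot> farr \<Gamma> (\<kappa> (m + n), \<nu> (m + n))) \<odot> farr \<Gamma> (?x m n, ?y n m)"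
          using k by (simp add: add.commute)
        also have "\<dots> = r m \<odot> farr \<Gamma> (Id C (X m), \<nu> n)"
          unfolding kg by (simp add: r q_def)
        finally show "(k \<odot> farr \<Gamma> (\<kappa> m, Id C N)) \<odot> farr \<Gamma> (Id C (X m), \<nu> n)
            = r m \<odot> farr \<Gamma> (Id C (X m), \<nu> n)"
          using k by simp
      qed (use k in auto)
      then show "k \<odot> farr \<Gamma> (\<kappa> m, Id C N) = h \<odot> farr \<Gamma> (\<kappa> m, Id C N)"
        by (simp add: h)
    qed (use k in auto)
  qed
qed

end


section \<open>Lifting along a structural law\<close>

locale structural_law = omega_cocomplete C + chain_bifunctor C \<Gamma> + S: algebraically_free C \<Sigma> S \<iota>
  for C :: "('o, 'a) category" (structure) and \<Sigma> \<Gamma> S \<iota> +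
  fixes d :: "'o \<times> 'o \<Rightarrow> 'a"
  assumes bi_initial: "initial C z \<Longrightarrow> y \<in> Obj C \<Longrightarrow> initial C (fobj \<Gamma> (z, y))"
    and bi_coproduct: "is_coproduct C x x' p i j \<Longrightarrow> y \<in> Obj C \<Longrightarrow>
      is_coproduct C (fobj \<Gamma> (x, y)) (fobj \<Gamma> (x', y)) (fobj \<Gamma> (p, y)) (farr \<Gamma> (i, Id C y)) (farr \<Gamma> (j, Id C y))"
    and law: "nat_trans (prod_cat C C) C (law_source \<Sigma> \<Gamma>) (law_target C \<Gamma> (mfun S)) d"
begin

abbreviation "So \<equiv> fobj (mfun S)"
abbreviation "Sf \<equiv> farr (mfun S)"
abbreviation "\<Sigma>o \<equiv> fobj \<Sigma>"
abbreviation "\<Sigma>f \<equiv> farr \<Sigma>"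
abbreviation "\<Gamma>o x y \<equiv> fobj \<Gamma> (x, y)"
abbreviation "\<Gamma>f f g \<equiv> farr \<Gamma> (f, g)"

lemma law_arr [simp]:
  assumes "x \<in> Obj C" "y \<in> Obj C"
  shows "d (x, y) \<in> Arr C" "Dom C (d (x, y)) = \<Gamma>o (\<Sigma>o x) y"
    "Cod C (d (x, y)) = So (coprod3 C (\<Gamma>o x (So y)) x y)"
  using nat_trans.component_arr[OF law, of "(x, y)"] assms by (simp_all add: law_source_def law_target_def)

text \<open>Naturality of \<open>d\<close> in both variables with the coproduct of arrows absorbed
  into a copairing, since \<open>d\<close> is always followed by the S-image of an interpretation of
  its three summands.\<close>

lemma law_natural:
  assumes "p \<in> Arr C" "r \<in> Arr C" "Cod C p = x'" "Cod C r = y'"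
    and "q \<in> Arr C" "a \<in> Arr C" "b \<in> Arr C" "Dom C q = \<Gamma>o x' (So y')" "Dom C a = x'" "Dom C b = y'"
    and "Cod C q = Cod C b" "Cod C a = Cod C b"
  shows "Sf (copair3 C q a b) \<odot> (d (x', y') \<odot> \<Gamma>f (\<Sigma>f p) r)
    = Sf (copair3 C (q \<odot> \<Gamma>f p (Sf r)) (a \<odot> p) (b \<odot> r)) \<odot> d (Dom C p, Dom C r)"
proof -
  have "d (x', y') \<odot> \<Gamma>f (\<Sigma>f p) r = Sf (coprod3_arr C (\<Gamma>f p (Sf r)) p r) \<odot> d (Dom C p, Dom C r)"
    using nat_trans.natural_Comp[OF law, of "(p, r)" "(x', y')"] assms
    by (simp add: law_source_def law_target_def)
  then show ?thesis
    using assms by (auto simp: S.fn.farr_eq[OF copair3_coprod3_arr])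
qed

subsection \<open>Recursion over free algebras inside the first argument\<close>

text \<open>Recursion over SB with a parameter from Y and values in Z: \<open>g\<close> handles
  generators, and an operation is first rewritten by \<open>d\<close>. The three summands of the
  result are then interpreted in Z: \<Gamma>(SB, SY) by collapsing SY to Y with \<open>m\<close> and
  calling \<open>k\<close> again, SB by \<open>e\<close>, and Y by \<open>l\<close>; finally
  \<open>z\<close> evaluates the outer S. Keeping B, Y and Z independent lets the composites in
  \<open>lift_map\<close> and \<open>lift_mu\<close> be solutions too, so that uniqueness can
  compare them.\<close>

definition is_rec :: "'o \<Rightarrow> 'o \<Rightarrow> 'o \<Rightarrow> 'a \<Rightarrow> 'a \<Rightarrow> 'a \<Rightarrow> 'a \<Rightarrow> 'a \<Rightarrow> 'a \<Rightarrow> bool" where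
  "is_rec B Y Z m l z e g k \<longleftrightarrow> k \<in> hom C (\<Gamma>o (So B) Y) Z \<and>
     k \<odot> \<Gamma>f (eta S B) (Id C Y) = g \<and>
     k \<odot> \<Gamma>f (S.act B) (Id C Y) = z \<odot> (Sf (copair3 C (k \<odot> \<Gamma>f (Id C (So B)) m) e l) \<odot> d (So B, Y))"

text \<open>Since \<open>\<Gamma>(-, Y)\<close> preserves the colimit of the initial sequence building \<open>SB\<close>, a map out of
  \<open>\<Gamma>(SB, Y)\<close> is determined by, and can be built from, its restrictions to the stages.\<close>

lemma is_rec_ex1:
  assumes B: "B \<in> Obj C" and m: "m \<in> hom C (So Y) Y" and l: "l \<in> hom C Y Z"
    and z: "z \<in> hom C (So Z) Z" and e: "e \<in> hom C (So B) Z" and g: "g \<in> hom C (\<Gamma>o B Y) Z"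
  shows "\<exists>!k. is_rec B Y Z m l z e g k"
proof -
  have [simp]: "B \<in> Obj C" "Y \<in> Obj C" "Z \<in> Obj C"
    using B l by auto
  note [simp] = m[simplified] l[simplified] z[simplified] e[simplified] g[simplified]
  let ?X = "iter_obj C \<Sigma> B" and ?c = "iter_map C \<Sigma> B"
  obtain \<kappa> where K: "chain_colimit C ?X ?c (So B) \<kappa>"
    and \<kappa>Suc: "\<And>n. \<kappa> (Suc n) = copair C (eta S B) (S.act B \<odot> \<Sigma>f (\<kappa> n))"
    using S.free_algebra_colimit[OF S.free[OF B]] by metis
  note [simp del] = iter_obj.simps iter_map.simps
  note [simp] = iter_obj.simps(2) chain_colimitD(1,2,4-6,8)[OF K]
  have c_cod [simp]: "Cod C (?c n) = coprod C B (\<Sigma>o (?X n))" for n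
    using chain_colimitD(3)[OF K, of n] by simp
  let ?i = "\<lambda>n. inl C B (\<Sigma>o (?X n))" and ?j = "\<lambda>n. inr C B (\<Sigma>o (?X n))"
  have ij: "?c (Suc n) \<odot> ?i n = ?i (Suc n)" "?c (Suc n) \<odot> ?j n = ?j (Suc n) \<odot> \<Sigma>f (?c n)" for n
    by (simp_all add: iter_map.simps(2) coprod_arr_in)
  have cp: "is_coproduct C (\<Gamma>o B Y) (\<Gamma>o (\<Sigma>o (?X n)) Y) (\<Gamma>o (?X (Suc n)) Y)
      (\<Gamma>f (?i n) (Id C Y)) (\<Gamma>f (?j n) (Id C Y))" for n
    by (simp add: bi_coproduct coproduct)
  \<comment> \<open>The right-hand side of the recursion at a stage x of SB, with inclusion w and
    partial solution q. By naturality of \<open>d\<close> in its first argument,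
    \<open>\<Phi>_nat\<close> allows a change of stage.\<close>
  define \<Phi> where "\<Phi> x w q = z \<odot> (Sf (copair3 C (q \<odot> \<Gamma>f (Id C x) m) (e \<odot> w) l) \<odot> d (x, Y))" for x w q
  have \<Phi> [simp]: "\<Phi> x w q \<in> Arr C" "Dom C (\<Phi> x w q) = \<Gamma>o (\<Sigma>o x) Y" "Cod C (\<Phi> x w q) = Z"
    if "q \<in> Arr C" "Dom C q = \<Gamma>o x Y" "Cod C q = Z" "w \<in> Arr C" "Dom C w = x" "Cod C w = So B" for x w q
  proof -
    have "x \<in> Obj C"
      using that by auto
    then show "\<Phi> x w q \<in> Arr C" "Dom C (\<Phi> x w q) = \<Gamma>o (\<Sigma>o x) Y" "Cod C (\<Phi> x w q) = Z"
      using that by (simp_all add: \<Phi>_def)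
  qed
  have \<Phi>_nat: "\<Phi> x w q \<odot> \<Gamma>f (\<Sigma>f p) (Id C Y) = \<Phi> (Dom C p) (w \<odot> p) (q \<odot> \<Gamma>f p (Id C Y))"
    if "q \<in> Arr C" "Dom C q = \<Gamma>o x Y" "Cod C q = Z" "w \<in> Arr C" "Dom C w = x" "Cod C w = So B"
      "p \<in> Arr C" "Cod C p = x" for x w q p
  proof -
    have "x \<in> Obj C"
      using that by auto
    then show ?thesis
      using that law_natural[of p "Id C Y" x Y "q \<odot> \<Gamma>f (Id C x) m" "e \<odot> w" l]
      by (simp add: \<Phi>_def)
  qed
  have rec_iff: "is_rec B Y Z m l z e g k \<longleftrightarrow> k \<in> hom C (\<Gamma>o (So B) Y) Z \<and>
      k \<odot> \<Gamma>f (eta S B) (Id C Y) = g \<and> k \<odot> \<Gamma>f (S.act B) (Id C Y) = \<Phi> (So B) (Id C (So B)) k" for k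
    by (simp add: is_rec_def \<Phi>_def)
  \<comment> \<open>As \<Gamma>(-, Y) preserves the coproduct B + \<Sigma>(\<open>?X n\<close>), a
    partial solution at stage n + 1 is fixed by its value on generators and by \<Phi> on operations.
    Stage 0 stays initial under \<Gamma>(-, Y).\<close>
  have "\<exists>h. \<forall>n. h n \<in> hom C (\<Gamma>o (?X n) Y) Z \<and>
      (h (Suc n) \<odot> \<Gamma>f (?i n) (Id C Y) = g \<and> h (Suc n) \<odot> \<Gamma>f (?j n) (Id C Y) = \<Phi> (?X n) (\<kappa> n) (h n))"
  proof (rule dependent_nat_choice)
    show "\<exists>h. h \<in> hom C (\<Gamma>o (?X 0) Y) Z"
      using initial_ex1[OF bi_initial[OF S.iter_initial]] by (meson \<open>Y \<in> Obj C\<close> \<open>Z \<in> Obj C\<close>)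
    fix h n
    assume h: "h \<in> hom C (\<Gamma>o (?X n) Y) Z"
    then have "g \<in> hom C (\<Gamma>o B Y) Z" "\<Phi> (?X n) (\<kappa> n) h \<in> hom C (\<Gamma>o (\<Sigma>o (?X n)) Y) Z" "Z \<in> Obj C"
      by auto
    then show "\<exists>h'. h' \<in> hom C (\<Gamma>o (?X (Suc n)) Y) Z \<and>
        (h' \<odot> \<Gamma>f (?i n) (Id C Y) = g \<and> h' \<odot> \<Gamma>f (?j n) (Id C Y) = \<Phi> (?X n) (\<kappa> n) h)"
      using cp[of n] unfolding is_coproduct_def by blast
  qed
  then obtain h where h: "\<And>n. h n \<in> hom C (\<Gamma>o (?X n) Y) Z"
    and hi: "\<And>n. h (Suc n) \<odot> \<Gamma>f (?i n) (Id C Y) = g"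
    and hj: "\<And>n. h (Suc n) \<odot> \<Gamma>f (?j n) (Id C Y) = \<Phi> (?X n) (\<kappa> n) (h n)"
    by blast
  note [simp] = h[simplified]
  have \<kappa>c: "\<kappa> (Suc n) \<odot> ?c n = \<kappa> n" for n
    by (rule chain_colimitD(7)[OF K])
  have hc: "h (Suc n) \<odot> \<Gamma>f (?c n) (Id C Y) = h n" for n
  proof (induction n)
    case 0
    show ?case
      by (rule initial_eqI[OF bi_initial[OF S.iter_initial[of B]]]) auto
  next
    case (Suc n)
    show ?case
    proof (rule coproduct_eqI[OF cp[of n]])
      show "(h (Suc (Suc n)) \<odot> \<Gamma>f (?c (Suc n)) (Id C Y)) \<odot> \<Gamma>f (?i n) (Id C Y)
          = h (Suc n) \<odot> \<Gamma>f (?i n) (Id C Y)"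
        using hi[of n] hi[of "Suc n"] by (simp add: ij)
      have "h (Suc (Suc n)) \<odot> \<Gamma>f (?j (Suc n) \<odot> \<Sigma>f (?c n)) (Id C Y)
          = (h (Suc (Suc n)) \<odot> \<Gamma>f (?j (Suc n)) (Id C Y)) \<odot> \<Gamma>f (\<Sigma>f (?c n)) (Id C Y)"
        by simp
      also have "\<dots> = h (Suc n) \<odot> \<Gamma>f (?j n) (Id C Y)"
        unfolding hj by (subst \<Phi>_nat) (simp_all add: \<kappa>c Suc)
      finally show "(h (Suc (Suc n)) \<odot> \<Gamma>f (?c (Suc n)) (Id C Y)) \<odot> \<Gamma>f (?j n) (Id C Y)
          = h (Suc n) \<odot> \<Gamma>f (?j n) (Id C Y)"
        by (simp add: ij)
    qed auto
  qed
  \<comment> \<open>The equation for operations lives on \<Gamma>(\<Sigma>(SB), Y), which is a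
    colimit of the stages as well because \<Sigma> preserves the sequence.\<close>
  note \<Gamma>K = chain_fst[OF K \<open>Y \<in> Obj C\<close>] and \<Gamma>\<Sigma>K = chain_fst[OF S.preserves_chain[OF K] \<open>Y \<in> Obj C\<close>]
  obtain k where k: "k \<in> hom C (\<Gamma>o (So B) Y) Z" "\<And>n. k \<odot> \<Gamma>f (\<kappa> n) (Id C Y) = h n"
    using chain_colimit_ex1[OF \<Gamma>K, of Z h] hc by (auto simp: chain_cocone_def)
  have \<kappa>i: "\<kappa> (Suc n) \<odot> ?i n = eta S B" and \<kappa>j: "\<kappa> (Suc n) \<odot> ?j n = S.act B \<odot> \<Sigma>f (\<kappa> n)" for n
    by (simp_all add: \<kappa>Suc)
  have eta_stage: "k \<odot> \<Gamma>f (eta S B) (Id C Y) = (k \<odot> \<Gamma>f (\<kappa> (Suc n)) (Id C Y)) \<odot> \<Gamma>f (?i n) (Id C Y)"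
    and act_stage: "(k \<odot> \<Gamma>f (S.act B) (Id C Y)) \<odot> \<Gamma>f (\<Sigma>f (\<kappa> n)) (Id C Y)
      = (k \<odot> \<Gamma>f (\<kappa> (Suc n)) (Id C Y)) \<odot> \<Gamma>f (?j n) (Id C Y)"
    if "k \<in> hom C (\<Gamma>o (So B) Y) Z" for k n
    using that by (simp_all add: \<kappa>i \<kappa>j)
  show ?thesis
  proof (rule ex1I[of _ k])
    have "k \<odot> \<Gamma>f (eta S B) (Id C Y) = g"
      unfolding eta_stage[OF k(1), of 0] k by (rule hi)
    moreover have "k \<odot> \<Gamma>f (S.act B) (Id C Y) = \<Phi> (So B) (Id C (So B)) k"
    proof (rule chain_colimit_eqI[OF \<Gamma>\<Sigma>K])
      fix n
      have "(k \<odot> \<Gamma>f (S.act B) (Id C Y)) \<odot> \<Gamma>f (\<Sigma>f (\<kappa> n)) (Id C Y) = \<Phi> (?X n) (\<kappa> n) (h n)"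
        unfolding act_stage[OF k(1)] k by (rule hj)
      also have "\<dots> = \<Phi> (So B) (Id C (So B)) k \<odot> \<Gamma>f (\<Sigma>f (\<kappa> n)) (Id C Y)"
        using k by (subst \<Phi>_nat) auto
      finally show "(k \<odot> \<Gamma>f (S.act B) (Id C Y)) \<odot> \<Gamma>f (\<Sigma>f (\<kappa> n)) (Id C Y)
          = \<Phi> (So B) (Id C (So B)) k \<odot> \<Gamma>f (\<Sigma>f (\<kappa> n)) (Id C Y)" .
    qed (use k in auto)
    ultimately show "is_rec B Y Z m l z e g k"
      using k by (simp add: rec_iff)
    fix k'
    assume "is_rec B Y Z m l z e g k'"
    then have k': "k' \<in> hom C (\<Gamma>o (So B) Y) Z" "k' \<odot> \<Gamma>f (eta S B) (Id C Y) = g"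
      "k' \<odot> \<Gamma>f (S.act B) (Id C Y) = \<Phi> (So B) (Id C (So B)) k'"
      by (auto simp: rec_iff)
    have "k' \<odot> \<Gamma>f (\<kappa> n) (Id C Y) = h n" for n
    proof (induction n)
      case 0
      show ?case
        by (rule initial_eqI[OF bi_initial[OF S.iter_initial[of B]]]) (use k' in auto)
    next
      case (Suc n)
      show ?case
      proof (rule coproduct_eqI[OF cp[of n]])
        show "(k' \<odot> \<Gamma>f (\<kappa> (Suc n)) (Id C Y)) \<odot> \<Gamma>f (?i n) (Id C Y) = h (Suc n) \<odot> \<Gamma>f (?i n) (Id C Y)"
          unfolding eta_stage[OF k'(1), symmetric] k' hi ..
        have "\<Phi> (So B) (Id C (So B)) k' \<odot> \<Gamma>f (\<Sigma>f (\<kappa> n)) (Id C Y) = \<Phi> (?X n) (\<kappa> n) (h n)"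
          using k'(1) Suc by (subst \<Phi>_nat) auto
        then show "(k' \<odot> \<Gamma>f (\<kappa> (Suc n)) (Id C Y)) \<odot> \<Gamma>f (?j n) (Id C Y) = h (Suc n) \<odot> \<Gamma>f (?j n) (Id C Y)"
          unfolding act_stage[OF k'(1), symmetric] k' hj .
      qed (use k' in auto)
    qed
    then show "k' = k"
      by (intro chain_colimit_eqI[OF \<Gamma>K k'(1) k(1)]) (simp add: k)
  qed
qed

end

section \<open>Lifting algebra structures from A to SA\<close>

lemma Gamma_S_Delta_simps [simp]:
  "fobj (Gamma_S_Delta \<Gamma> F) x = fobj \<Gamma> (x, fobj F x)"
  "farr (Gamma_S_Delta \<Gamma> F) f = farr \<Gamma> (f, farr F f)"
  by (simp_all add: Gamma_S_Delta_def)

context structural_law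
begin

lemma is_rec_eqI:
  assumes k: "is_rec B Y Z m l z e g k" "is_rec B Y Z m l z e g k'"
    and "B \<in> Obj C" "m \<in> hom C (So Y) Y" "l \<in> hom C Y Z" "z \<in> hom C (So Z) Z" "e \<in> hom C (So B) Z"
  shows "k = k'"
proof -
  have "Y \<in> Obj C"
    using assms(5) by auto
  then have "g \<in> hom C (\<Gamma>o B Y) Z"
    using k(1) assms(3) by (auto simp: is_rec_def)
  from is_rec_ex1[OF assms(3-7) this] show ?thesis
    using k by blast
qed

text \<open>The case Y = Z = SA: both multiplications are those of S, and subterm and parameter are
  returned unchanged.\<close>

definition rec :: "'o \<Rightarrow> 'a \<Rightarrow> 'a" where
  "rec A a = (THE k. is_rec A (So A) (So A) (mu S A) (Id C (So A)) (mu S A) (Id C (So A)) (eta S A \<odot> a) k)"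

definition lift :: "'o \<Rightarrow> 'a \<Rightarrow> 'a" where
  "lift A a = rec A a \<odot> \<Gamma>f (Id C (So A)) (mu S A)"

lemma rec:
  assumes "a \<in> Arr C" "Dom C a = \<Gamma>o A (So A)" "Cod C a = A"
  shows "rec A a \<in> Arr C" "Dom C (rec A a) = \<Gamma>o (So A) (So A)" "Cod C (rec A a) = So A"
    "rec A a \<odot> \<Gamma>f (eta S A) (Id C (So A)) = eta S A \<odot> a"
    "rec A a \<odot> \<Gamma>f (S.act A) (Id C (So A)) =
      mu S A \<odot> (Sf (copair3 C (rec A a \<odot> \<Gamma>f (Id C (So A)) (mu S A)) (Id C (So A)) (Id C (So A)))
        \<odot> d (So A, So A))"
proof -
  have "A \<in> Obj C"
    using assms by auto
  then have "\<exists>!k. is_rec A (So A) (So A) (mu S A) (Id C (So A)) (mu S A) (Id C (So A)) (eta S A \<odot> a) k"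
    using assms by (intro is_rec_ex1) auto
  then have "is_rec A (So A) (So A) (mu S A) (Id C (So A)) (mu S A) (Id C (So A)) (eta S A \<odot> a) (rec A a)"
    unfolding rec_def by (rule theI')
  then show "rec A a \<in> Arr C" "Dom C (rec A a) = \<Gamma>o (So A) (So A)" "Cod C (rec A a) = So A"
    "rec A a \<odot> \<Gamma>f (eta S A) (Id C (So A)) = eta S A \<odot> a"
    "rec A a \<odot> \<Gamma>f (S.act A) (Id C (So A)) =
      mu S A \<odot> (Sf (copair3 C (rec A a \<odot> \<Gamma>f (Id C (So A)) (mu S A)) (Id C (So A)) (Id C (So A)))
        \<odot> d (So A, So A))"
    unfolding is_rec_def by auto
qed

text \<open>Naturality of \<open>d\<close> moves its use from (SA, SA) to (B, Y). Thus an operation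
  applied to arguments w, with parameter v, is rewritten before w and v are substituted.\<close>

lemma rec_act:
  assumes a: "a \<in> Arr C" "Dom C a = \<Gamma>o A (So A)" "Cod C a = A"
    and w: "w \<in> hom C B (So A)" "v \<in> hom C Y (So A)"
  shows "rec A a \<odot> \<Gamma>f (S.act A \<odot> \<Sigma>f w) v
    = mu S A \<odot> (Sf (copair3 C (rec A a \<odot> \<Gamma>f w (mu S A \<odot> Sf v)) w v) \<odot> d (B, Y))"
proof -
  note [simp] = rec(1-3)[OF a]
  have A [simp]: "A \<in> Obj C"
    using a by auto
  have [simp]: "B \<in> Obj C" "Y \<in> Obj C"
    using w by auto
  have "rec A a \<odot> \<Gamma>f (S.act A \<odot> \<Sigma>f w) v
      = (rec A a \<odot> \<Gamma>f (S.act A) (Id C (So A))) \<odot> \<Gamma>f (\<Sigma>f w) v"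
    using w by simp
  then show ?thesis
    using w by (simp add: rec(5)[OF a] law_natural)
qed

lemma lift_arr [simp]:
  assumes "a \<in> Arr C" "Dom C a = \<Gamma>o A (So A)" "Cod C a = A"
  shows "lift A a \<in> Arr C" "Dom C (lift A a) = \<Gamma>o (So A) (So (So A))" "Cod C (lift A a) = So A"
proof -
  have "A \<in> Obj C"
    using assms by auto
  then show "lift A a \<in> Arr C" "Dom C (lift A a) = \<Gamma>o (So A) (So (So A))" "Cod C (lift A a) = So A"
    using rec[OF assms] by (auto simp: lift_def)
qed

lemma lift_eta:
  assumes a: "a \<in> Arr C" "Dom C a = \<Gamma>o A (So A)" "Cod C a = A"
  shows "lift A a \<odot> \<Gamma>f (eta S A) (Sf (eta S A)) = eta S A \<odot> a"
proof -
  have "A \<in> Obj C"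
    using a by auto
  then show ?thesis
    using rec[OF a] by (simp add: lift_def)
qed

text \<open>Before \<Gamma>(SA, \<mu>) is composed on the right, both sides solve one recursion over
  SA with parameter from SA and values in SB, where subterm and parameter are both interpreted by
  Sf. For the left side this uses naturality of \<mu>, for the right side
  \<open>rec_act\<close>.\<close>

lemma lift_map:
  assumes a: "a \<in> Arr C" "Dom C a = \<Gamma>o A (So A)" "Cod C a = A"
    and b: "b \<in> Arr C" "Dom C b = \<Gamma>o B (So B)" "Cod C b = B"
    and f: "f \<in> hom C A B" "f \<odot> a = b \<odot> \<Gamma>f f (Sf f)"
  shows "Sf f \<odot> lift A a = lift B b \<odot> \<Gamma>f (Sf f) (Sf (Sf f))"
proof -
  have [simp]: "A \<in> Obj C" "B \<in> Obj C"
    using f by auto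
  note [simp] = a b f(1)[simplified] rec(1-3)[OF a] rec(1-3)[OF b]
  have "Sf f \<odot> rec A a = rec B b \<odot> \<Gamma>f (Sf f) (Sf f)"
  proof (rule is_rec_eqI[where m = "mu S A" and l = "Sf f" and z = "mu S B" and e = "Sf f"])
    have "Sf f \<odot> (rec A a \<odot> \<Gamma>f (S.act A) (Id C (So A)))
        = mu S B \<odot> (Sf (Sf f) \<odot> (Sf (copair3 C (rec A a \<odot> \<Gamma>f (Id C (So A)) (mu S A)) (Id C (So A)) (Id C (So A)))
          \<odot> d (So A, So A)))"
      by (simp add: rec(5)[OF a] S.mu_natural')
    also have "\<dots> = mu S B \<odot> (Sf (copair3 C (Sf f \<odot> (rec A a \<odot> \<Gamma>f (Id C (So A)) (mu S A))) (Sf f) (Sf f))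
          \<odot> d (So A, So A))"
      by (simp add: S.fn.farr_eq[OF comp_copair3])
    finally show "is_rec A (So A) (So B) (mu S A) (Sf f) (mu S B) (Sf f) (eta S B \<odot> (f \<odot> a)) (Sf f \<odot> rec A a)"
      by (simp add: is_rec_def rec(4)[OF a])
    have "rec B b \<odot> \<Gamma>f (eta S B \<odot> f) (Sf f) = (rec B b \<odot> \<Gamma>f (eta S B) (Id C (So B))) \<odot> \<Gamma>f f (Sf f)"
      by simp
    also have "\<dots> = eta S B \<odot> (f \<odot> a)"
      by (simp add: rec(4)[OF b] f(2))
    finally show "is_rec A (So A) (So B) (mu S A) (Sf f) (mu S B) (Sf f) (eta S B \<odot> (f \<odot> a))
        (rec B b \<odot> \<Gamma>f (Sf f) (Sf f))"
      by (simp add: is_rec_def S.act_natural rec_act[OF b] S.mu_natural)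
  qed auto
  from whisker[OF this, of "\<Gamma>f (Id C (So A)) (mu S A)"] show ?thesis
    by (simp add: lift_def S.mu_natural)
qed

text \<open>The common recursion runs over SSA with parameter from SSA and values in SA, with
  \<open>lift A a\<close> on generators. The left side solves it by associativity of \<mu>, the
  right side because \<mu> is a morphism of \<Sigma>-algebras.\<close>

lemma lift_mu:
  assumes a: "a \<in> Arr C" "Dom C a = \<Gamma>o A (So A)" "Cod C a = A"
  shows "mu S A \<odot> lift (So A) (lift A a) = lift A a \<odot> \<Gamma>f (mu S A) (Sf (mu S A))"
proof -
  have [simp]: "A \<in> Obj C"
    using a by auto
  note la = lift_arr[OF a]
  note [simp] = a rec(1-3)[OF a] rec(1-3)[OF la]
  let ?r = "rec (So A) (lift A a)" and ?I = "Id C (So (So A))"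
  have "mu S A \<odot> ?r = rec A a \<odot> \<Gamma>f (mu S A) (mu S A)"
  proof (rule is_rec_eqI[where m = "mu S (So A)" and l = "mu S A" and z = "mu S A" and e = "mu S A"])
    have "mu S A \<odot> (?r \<odot> \<Gamma>f (S.act (So A)) ?I)
        = mu S A \<odot> (Sf (mu S A) \<odot> (Sf (copair3 C (?r \<odot> \<Gamma>f ?I (mu S (So A))) ?I ?I) \<odot> d (So (So A), So (So A))))"
      by (simp add: rec(5)[OF la] S.mu_mu')
    also have "\<dots> = mu S A \<odot> (Sf (copair3 C (mu S A \<odot> (?r \<odot> \<Gamma>f ?I (mu S (So A)))) (mu S A) (mu S A))
        \<odot> d (So (So A), So (So A)))"
      by (simp add: S.fn.farr_eq[OF comp_copair3])
    finally show "is_rec (So A) (So (So A)) (So A) (mu S (So A)) (mu S A) (mu S A) (mu S A) (lift A a) (mu S A \<odot> ?r)"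
      by (simp add: is_rec_def rec(4)[OF la])
    show "is_rec (So A) (So (So A)) (So A) (mu S (So A)) (mu S A) (mu S A) (mu S A) (lift A a)
        (rec A a \<odot> \<Gamma>f (mu S A) (mu S A))"
      by (simp add: is_rec_def lift_def S.mu_act rec_act[OF a] S.mu_mu)
  qed auto
  from whisker[OF this, of "\<Gamma>f ?I (mu S (So A))"] show ?thesis
    by (simp add: lift_def[of "So A"]) (simp add: lift_def S.mu_mu)
qed

text \<open>The image of a sequence is the diagonal formed from the sequence itself and its S-image,
  and S preserves colimits of sequences.\<close>

lemma Gamma_S_Delta_omega_functor: "omega_functor C (Gamma_S_Delta \<Gamma> (mfun S))"
proof unfold_locales
  show "preserves_chain_colimits C C (Gamma_S_Delta \<Gamma> (mfun S))"
    using S.mfun_preserves_chain_colimits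
    by (auto simp: preserves_chain_colimits_def intro: chain_diagonal)
qed auto

end

section \<open>The distributive law induced by the lifting\<close>

locale structural_law_free = structural_law C \<Sigma> \<Gamma> S \<iota> d +
    T: algebraically_free C "Gamma_S_Delta \<Gamma> (mfun S)" T \<iota>'
  for C :: "('o, 'a) category" (structure) and \<Sigma> \<Gamma> S \<iota> d T \<iota>'
begin

abbreviation "To \<equiv> fobj (mfun T)"
abbreviation "Tf \<equiv> farr (mfun T)"
abbreviation "lift_free x \<equiv> lift (To x) (T.act x)"

text \<open>Since \<Gamma>(-, Y) preserves initial objects, Gz is initial when z is, so z carries an
  algebra structure. The extension r of the identity of z is then inverse to the unit: the unit is
  an algebra morphism too, and an algebra endomorphism of Tz that fixes the generators is the
  identity.\<close>

lemma constant_free_T: "constant_free C T"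
  unfolding constant_free_def
proof (intro conjI allI impI T.monad_axioms)
  fix z
  assume z: "initial C z"
  then have [simp]: "z \<in> Obj C"
    by (simp add: initial_def)
  have Gz: "initial C (\<Gamma>o z (So z))"
    by (rule bi_initial[OF z]) simp
  then obtain a where a: "a \<in> hom C (\<Gamma>o z (So z)) z"
    using initial_ex1 \<open>z \<in> Obj C\<close> by meson
  obtain r where r: "r \<in> hom C (To z) z" "r \<odot> eta T z = Id C z" "r \<odot> T.act z = a \<odot> \<Gamma>f r (Sf r)"
    using T.alg_hom_ex1[of z a z "Id C z"] a by auto
  have "(eta T z \<odot> r) \<odot> T.act z = (eta T z \<odot> a) \<odot> \<Gamma>f r (Sf r)"
    using r a by simp
  \<comment> \<open>Both arrows start at the initial object Gz.\<close>
  also have "eta T z \<odot> a = T.act z \<odot> \<Gamma>f (eta T z) (Sf (eta T z))"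
    by (rule initial_eqI[OF Gz]) (use a in auto)
  finally have "eta T z \<odot> r = Id C (To z)"
    by - (rule T.alg_hom_eqI[of z "T.act z" "To z"]; use r a in simp)
  then show "iso C (eta T z)"
    using r by (auto simp: iso_def intro!: bexI[of _ r])
qed

definition \<delta> :: "'o \<Rightarrow> 'a" where
  "\<delta> x = (THE h. h \<in> hom C (To (So x)) (So (To x)) \<and> h \<odot> eta T (So x) = Sf (eta T x) \<and>
     h \<odot> T.act (So x) = lift_free x \<odot> \<Gamma>f h (Sf h))"

lemma \<delta>:
  assumes "x \<in> Obj C"
  shows "\<delta> x \<in> Arr C" "Dom C (\<delta> x) = To (So x)" "Cod C (\<delta> x) = So (To x)"
    "\<delta> x \<odot> eta T (So x) = Sf (eta T x)"
    "\<delta> x \<odot> T.act (So x) = lift_free x \<odot> \<Gamma>f (\<delta> x) (Sf (\<delta> x))"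
proof -
  have "\<exists>!h. h \<in> hom C (To (So x)) (So (To x)) \<and> h \<odot> eta T (So x) = Sf (eta T x) \<and>
      h \<odot> T.act (So x) = lift_free x \<odot> \<Gamma>f h (Sf h)"
    using T.alg_hom_ex1[of "So x" "lift_free x" "So (To x)" "Sf (eta T x)"] assms by simp
  from theI'[OF this] show "\<delta> x \<in> Arr C" "Dom C (\<delta> x) = To (So x)" "Cod C (\<delta> x) = So (To x)"
    "\<delta> x \<odot> eta T (So x) = Sf (eta T x)"
    "\<delta> x \<odot> T.act (So x) = lift_free x \<odot> \<Gamma>f (\<delta> x) (Sf (\<delta> x))"
    unfolding \<delta>_def[symmetric] by auto
qed

lemmas \<delta>_arr [simp] = \<delta>(1-3)

lemmas \<delta>_eta = \<delta>(4) whisker[OF \<delta>(4)]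
lemmas \<delta>_act = \<delta>(5) whisker[OF \<delta>(5)]

lemma lift_free_natural:
  assumes "f \<in> Arr C" "Dom C f = x"
  shows "Sf (Tf f) \<odot> lift_free x = lift_free (Cod C f) \<odot> \<Gamma>f (Sf (Tf f)) (Sf (Sf (Tf f)))"
  by (rule lift_map) (use assms in \<open>auto simp: T.act_natural\<close>)

lemma lift_free_mu:
  assumes "x \<in> Obj C"
  shows "Sf (mu T x) \<odot> lift_free (To x) = lift_free x \<odot> \<Gamma>f (Sf (mu T x)) (Sf (Sf (mu T x)))"
  by (rule lift_map) (use assms in \<open>auto simp: T.mu_act\<close>)

text \<open>By construction \<delta> is a G-algebra morphism into the lifted structure, so it can be
  lifted once more. This handles the composite with two occurrences of \<delta> in the axiom for the
  multiplication of S.\<close>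

lemma lift_\<delta>:
  assumes "x \<in> Obj C"
  shows "Sf (\<delta> x) \<odot> lift_free (So x) = lift (So (To x)) (lift_free x) \<odot> \<Gamma>f (Sf (\<delta> x)) (Sf (Sf (\<delta> x)))"
  by (rule lift_map) (use assms in \<open>auto simp: \<delta>(5)\<close>)

lemma distributive_law: "monad_distributive_law C S T \<delta>"
proof (intro monad_distributive_law.intro monad_distributive_law_axioms.intro)
  show "monad C S" "monad C T"
    by unfold_locales
  have "\<delta> y \<odot> Tf (Sf f) = Sf (Tf f) \<odot> \<delta> x" if f: "f \<in> hom C x y" for f x y
  proof -
    from f have xy [simp]: "x \<in> Obj C" "y \<in> Obj C" and [simp]: "f \<in> Arr C" "Dom C f = x" "Cod C f = y"
      by auto
    show ?thesis
    proof (rule T.alg_hom_eqI[of "So x" "lift_free y" "So (To y)"])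
      show "(\<delta> y \<odot> Tf (Sf f)) \<odot> eta T (So x) = (Sf (Tf f) \<odot> \<delta> x) \<odot> eta T (So x)"
        by (simp add: \<delta>_eta S.fn.farr_eq[OF T.eta_natural])
      show "(Sf (Tf f) \<odot> \<delta> x) \<odot> T.act (So x)
          = lift_free y \<odot> farr (Gamma_S_Delta \<Gamma> (mfun S)) (Sf (Tf f) \<odot> \<delta> x)"
        by (simp add: \<delta>_act whisker[OF lift_free_natural])
    qed (auto simp: T.act_natural \<delta>_act)
  qed
  then show "nat_trans C C (mfun T \<circ>\<^sub>F mfun S) (mfun S \<circ>\<^sub>F mfun T) \<delta>"
    by (intro nat_trans.intro nat_trans_axioms.intro cat_functor_comp[OF S.fn.cat_functor_axioms]
        cat_functor_comp[OF T.fn.cat_functor_axioms] S.fn.cat_functor_axioms T.fn.cat_functor_axioms)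
      auto
next
  fix x
  assume x [simp]: "x \<in> Obj C"
  show "\<delta> x \<odot> Tf (eta S x) = eta S (To x)"
    by (rule T.alg_hom_eqI[of x "lift_free x" "So (To x)"])
      (auto simp: \<delta>_eta T.act_natural \<delta>_act lift_eta)
  show "\<delta> x \<odot> eta T (So x) = Sf (eta T x)"
    by (rule \<delta>(4)) simp
  \<comment> \<open>On the right, the free algebra on SSx is mapped to the lift of the free algebra
    on Sx, then by S\<delta> to the double lift on SSTx, and by the multiplication to the lift on
    STx. Every factor is a G-algebra morphism.\<close>
  show "\<delta> x \<odot> Tf (mu S x) = mu S (To x) \<odot> Sf (\<delta> x) \<odot> \<delta> (So x)"
  proof (rule T.alg_hom_eqI[of "So (So x)" "lift_free x" "So (To x)"])
    show "(\<delta> x \<odot> Tf (mu S x)) \<odot> eta T (So (So x)) = (mu S (To x) \<odot> Sf (\<delta> x) \<odot> \<delta> (So x)) \<odot> eta T (So (So x))"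
      by (simp add: \<delta>_eta S.fn.farr_eq[OF \<delta>(4)] S.mu_natural)
    show "(mu S (To x) \<odot> Sf (\<delta> x) \<odot> \<delta> (So x)) \<odot> T.act (So (So x))
        = lift_free x \<odot> farr (Gamma_S_Delta \<Gamma> (mfun S)) (mu S (To x) \<odot> Sf (\<delta> x) \<odot> \<delta> (So x))"
      by (simp add: \<delta>_act whisker[OF lift_\<delta>] whisker[OF lift_mu])
  qed (auto simp: T.act_natural \<delta>_act)
  \<comment> \<open>Here the intermediate algebras are the free one on STx and the lift of the free
    one on Tx; the last factor is a morphism because \<open>mu T x\<close> is one before
    lifting.\<close>
  show "\<delta> x \<odot> mu T (So x) = Sf (mu T x) \<odot> \<delta> (To x) \<odot> Tf (\<delta> x)"
  proof (rule T.alg_hom_eqI[of "To (So x)" "lift_free x" "So (To x)"])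
    show "(\<delta> x \<odot> mu T (So x)) \<odot> eta T (To (So x)) = (Sf (mu T x) \<odot> \<delta> (To x) \<odot> Tf (\<delta> x)) \<odot> eta T (To (So x))"
      by (simp add: \<delta>_eta S.fn.farr_eq[OF T.mu_eta])
    show "(Sf (mu T x) \<odot> \<delta> (To x) \<odot> Tf (\<delta> x)) \<odot> T.act (To (So x))
        = lift_free x \<odot> farr (Gamma_S_Delta \<Gamma> (mfun S)) (Sf (mu T x) \<odot> \<delta> (To x) \<odot> Tf (\<delta> x))"
      by (simp add: T.act_natural \<delta>_act whisker[OF lift_free_mu])
  qed (auto simp: T.mu_act \<delta>_act)
qed

lemma \<delta>_law:
  assumes [simp]: "X \<in> Obj C"
  shows "\<delta> X \<odot> \<iota>' (So X) \<odot> \<Gamma>f (Id C (So X)) (eta S (So X)) \<odot> \<Gamma>f (\<iota> X) (eta S X)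
    = Sf (copair3 C (\<iota>' X) (eta T X) (eta T X)) \<odot> d (X, X)"
proof -
  let ?w = "eta S (To X) \<odot> eta T X" and ?r = "rec (To X) (T.act X)"
  note r = rec[of "T.act X" "To X"]
  have [simp]: "?r \<in> Arr C" "Dom C ?r = \<Gamma>o (So (To X)) (So (To X))" "Cod C ?r = So (To X)"
    by (simp_all add: r)
  have \<iota> [simp]: "\<iota> X \<in> Arr C" "Dom C (\<iota> X) = \<Sigma>o X" "Cod C (\<iota> X) = So X"
    and [simp]: "\<iota>' X \<in> Arr C" "Dom C (\<iota>' X) = \<Gamma>o X (So X)" "Cod C (\<iota>' X) = To X"
    by simp_all
  \<comment> \<open>\<iota>' is an operation applied to generators. On these \<delta> is the S-image
    of the unit of T, so only the lifted operation remains to be computed.\<close>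
  have "\<delta> X \<odot> \<iota>' (So X) = lift_free X \<odot> \<Gamma>f (Sf (eta T X)) (Sf (Sf (eta T X)))"
    using T.act_eta[of "So X", symmetric] S.fn.farr_eq[OF \<delta>(4)[of X]] by (simp add: \<delta>_act \<delta>_eta)
  also have "\<dots> = ?r \<odot> \<Gamma>f (Sf (eta T X)) (Sf (eta T X) \<odot> mu S X)"
    by (simp add: lift_def S.mu_natural)
  finally have "\<delta> X \<odot> \<iota>' (So X) \<odot> \<Gamma>f (Id C (So X)) (eta S (So X)) \<odot> \<Gamma>f (\<iota> X) (eta S X)
      = ?r \<odot> \<Gamma>f (Sf (eta T X) \<odot> \<iota> X) ?w"
    using whisker[of "\<delta> X" "\<iota>' (So X)" _ "\<Gamma>f (\<iota> X) (eta S (So X) \<odot> eta S X)"] by simp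
  \<comment> \<open>Likewise \<iota> is a \<Sigma>-operation applied to variables; in this form the
    recursion equation \<open>rec_act\<close> can unfold it.\<close>
  also have "Sf (eta T X) \<odot> \<iota> X = S.act (To X) \<odot> \<Sigma>f ?w"
    using S.act_eta[of X, symmetric] S.farr_eq[OF S.eta_natural[of "eta T X" X]]
    by (simp add: whisker[OF S.act_natural])
  also have "?r \<odot> \<Gamma>f (S.act (To X) \<odot> \<Sigma>f ?w) ?w
      = mu S (To X) \<odot> (Sf (copair3 C (?r \<odot> \<Gamma>f ?w (Sf (eta T X))) ?w ?w) \<odot> d (X, X))"
    using rec_act[of "T.act X" "To X" ?w X ?w X] by (simp del: S.farr_Comp')
  \<comment> \<open>The recursive call meets only generators, where \<open>rec\<close> is given by
    the original structure on TX; that structure on variables is \<iota>'.\<close>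
  also have "?r \<odot> \<Gamma>f ?w (Sf (eta T X))
      = (?r \<odot> \<Gamma>f (eta S (To X)) (Id C (So (To X)))) \<odot> \<Gamma>f (eta T X) (Sf (eta T X))"
    by simp
  also have "\<dots> = eta S (To X) \<odot> \<iota>' X"
    using T.act_eta[of X] by (simp add: r)
  also have "Sf (copair3 C (eta S (To X) \<odot> \<iota>' X) ?w ?w)
      = Sf (eta S (To X)) \<odot> Sf (copair3 C (\<iota>' X) (eta T X) (eta T X))"
    by (simp add: S.fn.farr_eq[OF comp_copair3])
  finally show ?thesis
    by simp
qed

end

section \<open>From small colimits to sequences, coproducts and initial objects; the theorem\<close>

lemma simple_structural_law_locale:
  assumes universe: "uncountable (UNIV :: 'u set)"
    and cocomplete: "cocomplete TYPE('u) C"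
    and law: "simple_structural_law TYPE('u) C \<Sigma> \<Gamma> S \<iota> d"
  shows "structural_law C \<Sigma> \<Gamma> S \<iota> d"
proof -
  interpret omega_cocomplete C
    by (rule cocomplete_omega_cocomplete) fact+
  have fst: "\<And>y. y \<in> Obj C \<Longrightarrow> cocontinuous TYPE('u) C C (fix_snd C \<Gamma> y)"
    and snd: "\<And>x. x \<in> Obj C \<Longrightarrow> finitary TYPE('u) C C (fix_fst C \<Gamma> x)"
    and \<Sigma>: "finitary TYPE('u) C C \<Sigma>" and S: "free_monad C \<Sigma> S \<iota>"
    using law by (auto simp: simple_structural_law_def)
  interpret pair: cat_functor "prod_cat C C" C \<Gamma>
    using law by (simp add: simple_structural_law_def)
  interpret \<Sigma>: cat_functor C C \<Sigma>
    using \<Sigma> by (simp add: finitary_def)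
  interpret S: monad C S
    using S by (simp add: free_monad_def)
  interpret \<iota>: nat_trans C C \<Sigma> "mfun S" \<iota>
    using S by (simp add: free_monad_def)
  show ?thesis
  proof (intro structural_law.intro structural_law_axioms.intro)
    show "omega_cocomplete C"
      by unfold_locales
    show "chain_bifunctor C \<Gamma>"
    proof unfold_locales
      show "chain_colimit C (\<lambda>n. fobj \<Gamma> (X n, y)) (\<lambda>n. farr \<Gamma> (c n, Id C y)) (fobj \<Gamma> (L, y))
          (\<lambda>n. farr \<Gamma> (\<kappa> n, Id C y))" if "chain_colimit C X c L \<kappa>" "y \<in> Obj C" for X c L \<kappa> y
        using cocontinuous_preserves_chain_colimits[OF universe fst[OF that(2)]] that(1)
        by (auto simp: preserves_chain_colimits_def fix_snd_def)
      show "chain_colimit C (\<lambda>n. fobj \<Gamma> (x, X n)) (\<lambda>n. farr \<Gamma> (Id C x, c n)) (fobj \<Gamma> (x, L))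
          (\<lambda>n. farr \<Gamma> (Id C x, \<kappa> n))" if "chain_colimit C X c L \<kappa>" "x \<in> Obj C" for X c L \<kappa> x
        using finitary_preserves_chain_colimits[OF universe snd[OF that(2)]] that(1)
        by (auto simp: preserves_chain_colimits_def fix_fst_def)
    qed
    show "algebraically_free C \<Sigma> S \<iota>"
      by unfold_locales (rule finitary_preserves_chain_colimits[OF universe \<Sigma>], rule S)
    show "initial C (fobj \<Gamma> (z, y))" if "initial C z" "y \<in> Obj C" for z y
      using cocontinuous_initial[OF fst[OF that(2)] that(1)] by (simp add: fix_snd_def)
    show "is_coproduct C (fobj \<Gamma> (x, y)) (fobj \<Gamma> (x', y)) (fobj \<Gamma> (p, y)) (farr \<Gamma> (i, Id C y))
        (farr \<Gamma> (j, Id C y))" if "is_coproduct C x x' p i j" "y \<in> Obj C" for x x' p i j y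
      using cocontinuous_coproduct[OF universe fst[OF that(2)] that(1)] by (simp add: fix_snd_def)
    show "nat_trans (prod_cat C C) C (law_source \<Sigma> \<Gamma>) (law_target C \<Gamma> (mfun S)) d"
      using law by (simp add: simple_structural_law_def)
  qed
qed

theorem theorem3p5:
  fixes C :: "('o, 'a) category"
    and \<Sigma> :: "('o, 'a) endofunctor"
    and \<Gamma> :: "('o \<times> 'o, 'a \<times> 'a, 'o, 'a) cat_functor"
    and S T :: "('o, 'a) monad"
    and \<eta>\<Sigma> \<eta>\<Gamma> :: "'o \<Rightarrow> 'a"
    and d :: "'o \<times> 'o \<Rightarrow> 'a"
  assumes universe: "uncountable (UNIV :: 'u set)"
    and lfp: "locally_finitely_presentable TYPE('u) C"
    and law: "simple_structural_law TYPE('u) C \<Sigma> \<Gamma> S \<eta>\<Sigma> d"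
    and T: "free_monad C (Gamma_S_Delta \<Gamma> (mfun S)) T \<eta>\<Gamma>"
  shows "constant_free C T \<and>
    (\<exists>\<delta>. monad_distributive_law C S T \<delta> \<and>
      (\<forall>X \<in> Obj C.
        \<delta> X \<odot>\<^bsub>C\<^esub> \<eta>\<Gamma> (fobj (mfun S) X)
            \<odot>\<^bsub>C\<^esub> farr \<Gamma> (Id C (fobj (mfun S) X), eta S (fobj (mfun S) X))
            \<odot>\<^bsub>C\<^esub> farr \<Gamma> (\<eta>\<Sigma> X, eta S X)
        = farr (mfun S) (copair3 C (\<eta>\<Gamma> X) (eta T X) (eta T X)) \<odot>\<^bsub>C\<^esub> d (X, X)) \<and>
      admissible C S (composite_monad C S T \<delta>) (\<lambda>X. farr (mfun S) (eta T X)))"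
proof -
  interpret structural_law C \<Sigma> \<Gamma> S \<eta>\<Sigma> d
    by (rule simple_structural_law_locale[OF universe _ law])
      (use lfp in \<open>simp add: locally_finitely_presentable_def\<close>)
  interpret G: omega_functor C "Gamma_S_Delta \<Gamma> (mfun S)"
    by (rule Gamma_S_Delta_omega_functor)
  have "monad C T" "nat_trans C C (Gamma_S_Delta \<Gamma> (mfun S)) (mfun T) \<eta>\<Gamma>"
    using T by (simp_all add: free_monad_def)
  then interpret T: algebraically_free C "Gamma_S_Delta \<Gamma> (mfun S)" T \<eta>\<Gamma>
    by (intro algebraically_free.intro algebraically_free_axioms.intro functor_to_monad.intro
        G.omega_functor_axioms category_axioms G.cat_functor_axioms T)
  interpret structural_law_free C \<Sigma> \<Gamma> S \<eta>\<Sigma> d T \<eta>\<Gamma> ..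
  interpret law: monad_distributive_law C S T \<delta>
    by (rule distributive_law)
  show ?thesis
    using constant_free_T distributive_law \<delta>_law law.admissible_left by blast
qed

end
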